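(* Let $G$ be an ADE graph and $(A,\cdot,{}^* )$ a double triangle algebra of $G$, $A=End^{gr}(\mathcal E)$, with coproduct $\Delta(\xi\otimes\xi')=\sum_{\xi_i}(\xi\otimes\xi_i)_{\mathcal E}\otimes(\xi_i\otimes\xi')_{\mathcal E}$ for $\xi,\xi'\in\mathcal E_n$, where $\xi_i$ runs over the elementary paths of length $n$. Let $\epsilon:A\to\mathbb C$ be the linear map with $\epsilon(\xi\otimes\xi')=\delta_{\xi\xi'}$ for $\xi,\xi'$ in the fixed basis $B_n$ of $\mathcal E_n$ (all $n$). Then $\epsilon$ is a counit: $$(\epsilon\otimes id)\Delta=id=(id\otimes\epsilon)\Delta .$$
   Context: Graph and paths. $G$ is an ADE graph (simply laced Dynkin diagram) with adjacency matrix $M$; $\beta$ is the largest eigenvalue of $M$ and $\mu=(\mu_v)$ its Perron–Frobenius eigenvector, normalized so that its smallest component is $1$. An elementary path of length $n\ge 0$ is a sequence $\xi=(v_0,\dots,v_n)$ of vertices with consecutive vertices adjacent; $s(\xi)=v_0$, $r(\xi)=v_n$, $\#\xi=n$, and $\tilde\xi=(v_n,\dots,v_0)$ (extended linearly). $\mathcal P=\bigoplus_n\mathcal P_n$ is the complex vector space with basis the elementary paths, graded by length. Concatenation: $\xi\star\xi'=\delta_{r(\xi)s(\xi')}\,(v_0,\dots,v_n,v_1',\dots,v_m')$. For $k\ge1$ the operator $c_k$ kills paths of length $n\le k$ and for $n>k$ is given by $c_k(v_0,\dots,v_n)=\sqrt{\mu_{v_k}/\mu_{v_{k+1}}}\;\delta_{v_{k-1},v_{k+1}}\,(v_0,\dots,v_{k-1},v_{k+2},\dots,v_n)$.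 The space of essential paths is $\mathcal E=\bigcap_k\ker c_k=\bigoplus_n\mathcal E_n$, which is finite dimensional for ADE graphs. Endomorphisms. Using the symmetric bilinear form on $\mathcal P_n$ for which elementary paths are orthonormal, the duals of $\mathcal P_n$ and $\mathcal E_n$ are identified with $\mathcal P_n$ and $\mathcal E_n$, so $End^{gr}(\mathcal P)=\bigoplus_n\mathcal P_n\otimes\mathcal P_n$ and $End^{gr}(\mathcal E)=\bigoplus_n\mathcal E_n\otimes\mathcal E_n$. For each $n$ fix a basis $B_n$ of $\mathcal E_n$ consisting of real combinations of elementary paths and orthonormal for this form. DTA. A double triangle algebra of $G$ is a finite-dimensional unital $C^*$-algebra $(A,\cdot,{}^* )$ with underlying vector space $A=End^{gr}(\mathcal E)$ (the product $\cdot$ is not composition of endomorphisms), together with a set of "fundamental" irreducible matrix $*$-representations $\Phi^f$ of $A$, whose matrix indices $\alpha,\beta$ are the length-one elementary paths, such that: (0) $\Phi^f_{\alpha\beta}(\xi\otimes\xi')=0$ unless $s(\alpha)=s(\xi)$, $r(\alpha)=s(\xi')$, $s(\beta)=r(\xi)$, $r(\beta)=r(\xi')$; and for $\#\xi=\#\xi'=0$, $\Phi^f_{\alpha\alpha}(\xi\otimes\xi')=\delta_{s(\alpha)\xi}\delta_{r(\alpha)\xi'}$. (iii) Concatenation: $\Phi^f_{\alpha\beta}((\xi_1\star\xi_2)\otimes(\xi_1'\star\xi_2'))=\Phi^f_{\alpha\gamma}(\xi_1\otimes\xi_1')\,\Phi^f_{\gamma\beta}(\xi_2\otimes\xi_2')$,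 where $\gamma$ is the edge from $r(\xi_1)$ to $r(\xi_1')$ (zero if there is none); this defines $\Phi^f$ on all of $End^{gr}(\mathcal P)$ from its values on paths of length $0$ and $1$. (i) Unitarity: for elementary paths $\xi,\lambda$ of length $n$, $\sum_{\alpha,\xi'}\overline{\Phi^f_{\alpha\beta}(\xi\otimes\xi')}\,\Phi^f_{\alpha\eta}(\lambda\otimes\xi')=\delta_{\beta\eta}\delta_{\xi\lambda}$ (sum over edges $\alpha$ and elementary $\xi'$ of length $n$). (ii) Reflection: for elementary $\xi,\xi'$ of equal length, with $c=\sqrt{\mu_{r(\xi)}\mu_{s(\xi')}/(\mu_{s(\xi)}\mu_{r(\xi')})}$, $\Phi^f_{\alpha\beta}(\xi\otimes\xi')=c\,\overline{\Phi^f_{\beta\alpha}(\tilde\xi\otimes\tilde\xi')}=c\,\overline{\Phi^f_{\tilde\alpha\tilde\beta}(\xi'\otimes\xi)}$. (4) Tensor products of representations are given by $\Phi^{f\otimes f'}_{\alpha\star\beta,\alpha'\star\beta'}(\xi\otimes\xi')=\sum_{\xi_i}\Phi^f_{\alpha\alpha'}(\xi\otimes\xi_i)\,\Phi^{f'}_{\beta\beta'}(\xi_i\otimes\xi')$ (sum over elementary paths $\xi_i$ of length $\#\xi$; iterated similarly); every irreducible representation of $A$ occurs in the decomposition of tensor products of fundamental ones. Irreps and cells. $x$ runs over the irreducible representations of $A$, realized as matrix $*$-representations $\Phi^x$. $\Phi^x$ is extended to $End^{gr}(\mathcal P)$ by bilinearity and, for elementary paths of length $n\ge1$ that are concatenations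 $\xi=e_1\star\dots\star e_n$, $\xi'=e_1'\star\dots\star e_n'$ of edges, by the matrix product $\Phi^x(\xi\otimes\xi')=\Phi^x(e_1\otimes e_1')\cdots\Phi^x(e_n\otimes e_n')$. The matrix units $E^x_{\eta\eta'}\in A$ are the elements with $\Phi^y_{\alpha\beta}(E^x_{\eta\eta'})=\delta_{xy}\delta_{\alpha\eta}\delta_{\beta\eta'}$. For $\xi\otimes\xi'\in End^{gr}(\mathcal P)$ put $(\xi\otimes\xi')_{\mathcal E}=\sum_{x,\alpha,\beta}\Phi^x_{\alpha\beta}(\xi\otimes\xi')\,E^x_{\alpha\beta}\in A$.
   Formalization: Unitarity (i) is required only for composable pairs, r(ξ)=s(β) and r(λ)=s(η). As printed, for all β, ξ, it contradicts (0): if s(β)≠r(ξ), β=η and ξ=λ, the left side is 0 and the right side 1. *)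

theory Defs
  imports "HOL-Analysis.Analysis" "HOL-Library.Poly_Mapping"
begin

section \<open>Free complex vector spaces\<close>

text \<open>The type \<open>'k \<Rightarrow>\<^sub>0 complex\<close> of finitely supported functions is the complex vector space with
  basis \<open>'k\<close>; \<open>single k 1\<close> is the basis vector \<open>k\<close>. The tensor product of two such spaces is
  realized on the product of the bases.\<close>

definition cscale :: "complex \<Rightarrow> ('k \<Rightarrow>\<^sub>0 complex) \<Rightarrow> ('k \<Rightarrow>\<^sub>0 complex)" where
  "cscale c f = Poly_Mapping.map ((*) c) f"

lemma lookup_cscale [simp]:
  "Poly_Mapping.lookup (cscale c f) k = c * Poly_Mapping.lookup f k"
  by (simp add: cscale_def map.rep_eq when_def)

global_interpretation free: vector_space "cscale :: complex \<Rightarrow> ('k \<Rightarrow>\<^sub>0 complex) \<Rightarrow> _"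
  by unfold_locales
    (auto intro!: poly_mapping_eqI simp: lookup_add algebra_simps)

abbreviation basis_vec :: "'k \<Rightarrow> ('k \<Rightarrow>\<^sub>0 complex)" where
  "basis_vec k \<equiv> Poly_Mapping.single k 1"

definition linear_on ::
  "('k \<Rightarrow>\<^sub>0 complex) set \<Rightarrow> (complex \<Rightarrow> 'b \<Rightarrow> 'b) \<Rightarrow> (('k \<Rightarrow>\<^sub>0 complex) \<Rightarrow> 'b::plus) \<Rightarrow> bool" where
  "linear_on S t f \<longleftrightarrow>
     (\<forall>x\<in>S. \<forall>y\<in>S. f (x + y) = f x + f y) \<and> (\<forall>c. \<forall>x\<in>S. f (cscale c x) = t c (f x))"

definition tensor :: "('i \<Rightarrow>\<^sub>0 complex) \<Rightarrow> ('j \<Rightarrow>\<^sub>0 complex) \<Rightarrow> ('i \<times> 'j \<Rightarrow>\<^sub>0 complex)" where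
  "tensor f g = (\<Sum>i\<in>Poly_Mapping.keys f. \<Sum>j\<in>Poly_Mapping.keys g.
     Poly_Mapping.single (i, j) (Poly_Mapping.lookup f i * Poly_Mapping.lookup g j))"

text \<open>\<open>tensor_map_left e\<close> is \<open>e \<otimes> id\<close> and \<open>tensor_map_right e\<close> is \<open>id \<otimes> e\<close>, for a linear functional
  \<open>e\<close>: the functional is applied to the slices of a tensor obtained by fixing the other index. The
  slices of an element of \<open>A \<otimes> A\<close> lie in \<open>A\<close>, so \<open>e\<close> need only be given on \<open>A\<close>.\<close>

definition tensor_map_left ::
  "(('i \<Rightarrow>\<^sub>0 complex) \<Rightarrow> complex) \<Rightarrow> ('i \<times> 'j \<Rightarrow>\<^sub>0 complex) \<Rightarrow> ('j \<Rightarrow>\<^sub>0 complex)" where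
  "tensor_map_left e t = (\<Sum>j\<in>snd ` Poly_Mapping.keys t.
     Poly_Mapping.single j (e (Poly_Mapping.map_key (\<lambda>i. (i, j)) t)))"

definition tensor_map_right ::
  "(('j \<Rightarrow>\<^sub>0 complex) \<Rightarrow> complex) \<Rightarrow> ('i \<times> 'j \<Rightarrow>\<^sub>0 complex) \<Rightarrow> ('i \<Rightarrow>\<^sub>0 complex)" where
  "tensor_map_right e t = (\<Sum>i\<in>fst ` Poly_Mapping.keys t.
     Poly_Mapping.single i (e (Poly_Mapping.map_key (\<lambda>j. (i, j)) t)))"

lemma lookup_tensor [simp]:
  "Poly_Mapping.lookup (tensor f g) (i, j) = Poly_Mapping.lookup f i * Poly_Mapping.lookup g j"
proof -
  have "Poly_Mapping.lookup (tensor f g) (i, j) =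
      (\<Sum>i'\<in>Poly_Mapping.keys f. \<Sum>j'\<in>Poly_Mapping.keys g.
        if i' = i then (if j' = j then Poly_Mapping.lookup f i * Poly_Mapping.lookup g j else 0)
        else 0)"
    unfolding tensor_def lookup_sum
    by (intro sum.cong refl) (auto simp: lookup_single when_def)
  also have "\<dots> = (\<Sum>i'\<in>Poly_Mapping.keys f. if i' = i then
        (\<Sum>j'\<in>Poly_Mapping.keys g. if j' = j then Poly_Mapping.lookup f i * Poly_Mapping.lookup g j else 0)
        else 0)"
    by (intro sum.cong refl) auto
  also have "\<dots> = Poly_Mapping.lookup f i * Poly_Mapping.lookup g j"
    by (simp add: sum.delta' in_keys_iff)
  finally show ?thesis .
qed

lemma tensor_map_left_tensor:
  assumes "linear_on S (*) e" and "f \<in> S"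
  shows "tensor_map_left e (tensor f g) = cscale (e f) g"
proof (rule poly_mapping_eqI)
  fix j
  have slice: "Poly_Mapping.map_key (\<lambda>i. (i, k)) (tensor f g) = cscale (Poly_Mapping.lookup g k) f" for k
    by (rule poly_mapping_eqI) (simp add: map_key.rep_eq inj_on_def mult.commute)
  have e: "e (cscale c f) = c * e f" for c
    using assms by (simp add: linear_on_def)
  have "j \<notin> snd ` Poly_Mapping.keys (tensor f g) \<Longrightarrow> Poly_Mapping.lookup g j * e f = 0"
  proof (rule ccontr)
    assume j: "j \<notin> snd ` Poly_Mapping.keys (tensor f g)" and n: "Poly_Mapping.lookup g j * e f \<noteq> 0"
    have "f \<noteq> 0" using n e[of 0] by auto
    then obtain i where "Poly_Mapping.lookup f i \<noteq> 0" by (metis lookup_zero poly_mapping_eqI)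
    then have "(i, j) \<in> Poly_Mapping.keys (tensor f g)" using n by (simp add: in_keys_iff)
    then show False using j by force
  qed
  then show "Poly_Mapping.lookup (tensor_map_left e (tensor f g)) j =
      Poly_Mapping.lookup (cscale (e f) g) j"
    by (auto simp: tensor_map_left_def lookup_sum lookup_single when_def slice e sum.delta')
qed

lemma tensor_map_right_tensor:
  assumes "linear_on S (*) e" and "g \<in> S"
  shows "tensor_map_right e (tensor f g) = cscale (e g) f"
proof (rule poly_mapping_eqI)
  fix i
  have slice: "Poly_Mapping.map_key (\<lambda>j. (k, j)) (tensor f g) = cscale (Poly_Mapping.lookup f k) g" for k
    by (rule poly_mapping_eqI) (simp add: map_key.rep_eq inj_on_def)
  have e: "e (cscale c g) = c * e g" for c
    using assms by (simp add: linear_on_def)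
  have "i \<notin> fst ` Poly_Mapping.keys (tensor f g) \<Longrightarrow> Poly_Mapping.lookup f i * e g = 0"
  proof (rule ccontr)
    assume i: "i \<notin> fst ` Poly_Mapping.keys (tensor f g)" and n: "Poly_Mapping.lookup f i * e g \<noteq> 0"
    have "g \<noteq> 0" using n e[of 0] by auto
    then obtain j where "Poly_Mapping.lookup g j \<noteq> 0" by (metis lookup_zero poly_mapping_eqI)
    then have "(i, j) \<in> Poly_Mapping.keys (tensor f g)" using n by (simp add: in_keys_iff)
    then show False using i by force
  qed
  then show "Poly_Mapping.lookup (tensor_map_right e (tensor f g)) i =
      Poly_Mapping.lookup (cscale (e g) f) i"
    by (auto simp: tensor_map_right_def lookup_sum lookup_single when_def slice e sum.delta')
qed


section \<open>ADE graphs\<close>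

definition A_adj :: "nat \<Rightarrow> nat \<Rightarrow> bool" where
  "A_adj i j \<longleftrightarrow> j = Suc i \<or> i = Suc j"

text \<open>On the vertices \<open>{..<n}\<close>: the chain \<open>0, \<dots>, n - 2\<close> with the additional vertex \<open>n - 1\<close> attached
  to \<open>b\<close>.\<close>

definition branched_adj :: "nat \<Rightarrow> nat \<Rightarrow> nat \<Rightarrow> nat \<Rightarrow> bool" where
  "branched_adj n b i j \<longleftrightarrow>
     (i < n - 1 \<and> j < n - 1 \<and> A_adj i j) \<or> (i = b \<and> j = n - 1) \<or> (i = n - 1 \<and> j = b)"

definition graph_iso :: "'v set \<Rightarrow> ('v \<Rightarrow> 'v \<Rightarrow> bool) \<Rightarrow> 'w set \<Rightarrow> ('w \<Rightarrow> 'w \<Rightarrow> bool) \<Rightarrow> bool" where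
  "graph_iso V adj W adj' \<longleftrightarrow>
     (\<exists>h. bij_betw h V W \<and> (\<forall>u\<in>V. \<forall>v\<in>V. adj u v \<longleftrightarrow> adj' (h u) (h v)))"

definition ADE_graph :: "'v set \<Rightarrow> ('v \<Rightarrow> 'v \<Rightarrow> bool) \<Rightarrow> bool" where
  "ADE_graph V adj \<longleftrightarrow>
     (\<exists>n\<ge>1. graph_iso V adj {..<n} A_adj) \<or>
     (\<exists>n\<ge>4. graph_iso V adj {..<n} (branched_adj n (n - 3))) \<or>
     (\<exists>n\<in>{6,7,8}. graph_iso V adj {..<n} (branched_adj n 2))"

definition adj_matrix :: "('v \<Rightarrow> 'v \<Rightarrow> bool) \<Rightarrow> 'v \<Rightarrow> 'v \<Rightarrow> real" where
  "adj_matrix adj v w = (if adj v w then 1 else 0)"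

definition adj_eigenvector ::
  "'v set \<Rightarrow> ('v \<Rightarrow> 'v \<Rightarrow> bool) \<Rightarrow> real \<Rightarrow> ('v \<Rightarrow> real) \<Rightarrow> bool" where
  "adj_eigenvector V adj \<theta> x \<longleftrightarrow>
     (\<exists>v\<in>V. x v \<noteq> 0) \<and> (\<forall>v\<in>V. (\<Sum>w\<in>V. adj_matrix adj v w * x w) = \<theta> * x v)"

definition perron_frobenius :: "'v set \<Rightarrow> ('v \<Rightarrow> 'v \<Rightarrow> bool) \<Rightarrow> ('v \<Rightarrow> real) \<Rightarrow> bool" where
  "perron_frobenius V adj \<mu> \<longleftrightarrow>
     (\<exists>\<beta>. adj_eigenvector V adj \<beta> \<mu> \<and> (\<forall>\<theta> x. adj_eigenvector V adj \<theta> x \<longrightarrow> \<theta> \<le> \<beta>))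
     \<and> Min (\<mu> ` V) = 1"


section \<open>Elementary and essential paths\<close>

text \<open>An elementary path is its nonempty list of vertices, so \<open>s(\<xi>) = hd \<xi>\<close>, \<open>r(\<xi>) = last \<xi>\<close>, the
  reversed path is \<open>rev \<xi>\<close>, and the length is \<open>length \<xi> - 1\<close>.\<close>

definition paths :: "'v set \<Rightarrow> ('v \<Rightarrow> 'v \<Rightarrow> bool) \<Rightarrow> nat \<Rightarrow> 'v list set" where
  "paths V adj n = {p. length p = Suc n \<and> set p \<subseteq> V \<and> (\<forall>i<n. adj (p ! i) (p ! Suc i))}"

abbreviation edges :: "'v set \<Rightarrow> ('v \<Rightarrow> 'v \<Rightarrow> bool) \<Rightarrow> 'v list set" where
  "edges V adj \<equiv> paths V adj 1"

definition concat_path :: "'v list \<Rightarrow> 'v list \<Rightarrow> ('v list \<Rightarrow>\<^sub>0 complex)" where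
  "concat_path p q = (if last p = hd q then basis_vec (p @ tl q) else 0)"

definition path_space :: "'v set \<Rightarrow> ('v \<Rightarrow> 'v \<Rightarrow> bool) \<Rightarrow> nat \<Rightarrow> ('v list \<Rightarrow>\<^sub>0 complex) set" where
  "path_space V adj n = {f. Poly_Mapping.keys f \<subseteq> paths V adj n}"

definition c_path :: "('v \<Rightarrow> real) \<Rightarrow> nat \<Rightarrow> 'v list \<Rightarrow> ('v list \<Rightarrow>\<^sub>0 complex)" where
  "c_path \<mu> k p =
     (if length p - 1 > k \<and> p ! (k - 1) = p ! (k + 1)
      then cscale (complex_of_real (sqrt (\<mu> (p ! k) / \<mu> (p ! (k + 1)))))
             (basis_vec (take k p @ drop (k + 2) p))
      else 0)"

definition c_op :: "('v \<Rightarrow> real) \<Rightarrow> nat \<Rightarrow> ('v list \<Rightarrow>\<^sub>0 complex) \<Rightarrow> ('v list \<Rightarrow>\<^sub>0 complex)" where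
  "c_op \<mu> k f = (\<Sum>p\<in>Poly_Mapping.keys f. cscale (Poly_Mapping.lookup f p) (c_path \<mu> k p))"

definition ess_space ::
  "'v set \<Rightarrow> ('v \<Rightarrow> 'v \<Rightarrow> bool) \<Rightarrow> ('v \<Rightarrow> real) \<Rightarrow> nat \<Rightarrow> ('v list \<Rightarrow>\<^sub>0 complex) set" where
  "ess_space V adj \<mu> n = {f \<in> path_space V adj n. \<forall>k\<ge>1. c_op \<mu> k f = 0}"

definition path_form :: "('v list \<Rightarrow>\<^sub>0 complex) \<Rightarrow> ('v list \<Rightarrow>\<^sub>0 complex) \<Rightarrow> complex" where
  "path_form f g = (\<Sum>p\<in>Poly_Mapping.keys f. Poly_Mapping.lookup f p * Poly_Mapping.lookup g p)"

definition ess_basis ::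
  "'v set \<Rightarrow> ('v \<Rightarrow> 'v \<Rightarrow> bool) \<Rightarrow> ('v \<Rightarrow> real) \<Rightarrow> nat \<Rightarrow> ('v list \<Rightarrow>\<^sub>0 complex) set \<Rightarrow> bool" where
  "ess_basis V adj \<mu> n B \<longleftrightarrow>
     \<not> free.dependent B \<and> free.span B = ess_space V adj \<mu> n \<and>
     (\<forall>b\<in>B. \<forall>p. Poly_Mapping.lookup b p \<in> \<real>) \<and>
     (\<forall>b\<in>B. \<forall>b'\<in>B. path_form b b' = (if b = b' then 1 else 0))"

type_synonym 'v endo = "'v list \<times> 'v list \<Rightarrow>\<^sub>0 complex"

definition End_P :: "'v set \<Rightarrow> ('v \<Rightarrow> 'v \<Rightarrow> bool) \<Rightarrow> 'v endo set" where
  "End_P V adj = free.span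
     (\<Union>n. {tensor \<xi> \<xi>' | \<xi> \<xi>'. \<xi> \<in> path_space V adj n \<and> \<xi>' \<in> path_space V adj n})"

definition End_E :: "'v set \<Rightarrow> ('v \<Rightarrow> 'v \<Rightarrow> bool) \<Rightarrow> ('v \<Rightarrow> real) \<Rightarrow> 'v endo set" where
  "End_E V adj \<mu> = free.span
     (\<Union>n. {tensor \<xi> \<xi>' | \<xi> \<xi>'. \<xi> \<in> ess_space V adj \<mu> n \<and> \<xi>' \<in> ess_space V adj \<mu> n})"


section \<open>Finite-dimensional C*-algebras and their matrix representations\<close>

text \<open>The algebra is a finite-dimensional subspace \<open>A\<close> of a free vector space; completeness for the
  C*-norm is automatic in finite dimension.\<close>

locale fd_cstar_algebra =
  fixes A :: "('k \<Rightarrow>\<^sub>0 complex) set"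
    and mul :: "('k \<Rightarrow>\<^sub>0 complex) \<Rightarrow> ('k \<Rightarrow>\<^sub>0 complex) \<Rightarrow> ('k \<Rightarrow>\<^sub>0 complex)"
    and one :: "'k \<Rightarrow>\<^sub>0 complex"
    and star :: "('k \<Rightarrow>\<^sub>0 complex) \<Rightarrow> ('k \<Rightarrow>\<^sub>0 complex)"
  assumes subspace: "free.subspace A"
    and finite_dim: "\<exists>S. finite S \<and> free.span S = A"
    and mult_closed: "\<lbrakk>a \<in> A; b \<in> A\<rbrakk> \<Longrightarrow> mul a b \<in> A"
    and mult_assoc: "\<lbrakk>a \<in> A; b \<in> A; c \<in> A\<rbrakk> \<Longrightarrow> mul (mul a b) c = mul a (mul b c)"
    and mult_linear_right: "a \<in> A \<Longrightarrow> linear_on A cscale (\<lambda>b. mul a b)"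
    and mult_linear_left: "b \<in> A \<Longrightarrow> linear_on A cscale (\<lambda>a. mul a b)"
    and one_closed: "one \<in> A"
    and one_left: "a \<in> A \<Longrightarrow> mul one a = a"
    and one_right: "a \<in> A \<Longrightarrow> mul a one = a"
    and star_closed: "a \<in> A \<Longrightarrow> star a \<in> A"
    and star_antilinear: "linear_on A (\<lambda>c. cscale (cnj c)) star"
    and star_star: "a \<in> A \<Longrightarrow> star (star a) = a"
    and star_mult: "\<lbrakk>a \<in> A; b \<in> A\<rbrakk> \<Longrightarrow> star (mul a b) = mul (star b) (star a)"
    and cstar_norm: "\<exists>N :: ('k \<Rightarrow>\<^sub>0 complex) \<Rightarrow> real.
           (\<forall>a\<in>A. 0 \<le> N a \<and> (N a = 0 \<longleftrightarrow> a = 0)) \<and>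
           (\<forall>a\<in>A. \<forall>c. N (cscale c a) = cmod c * N a) \<and>
           (\<forall>a\<in>A. \<forall>b\<in>A. N (a + b) \<le> N a + N b \<and> N (mul a b) \<le> N a * N b) \<and>
           (\<forall>a\<in>A. N (mul (star a) a) = (N a)\<^sup>2)"

text \<open>A matrix representation is given by its coefficients: \<open>R i j a\<close> is the \<open>(i, j)\<close> entry of the
  matrix representing \<open>a\<close>; only \<open>i, j \<in> I\<close> and \<open>a \<in> A\<close> matter.\<close>

definition matrix_rep ::
  "('k \<Rightarrow>\<^sub>0 complex) set \<Rightarrow> (('k \<Rightarrow>\<^sub>0 complex) \<Rightarrow> ('k \<Rightarrow>\<^sub>0 complex) \<Rightarrow> ('k \<Rightarrow>\<^sub>0 complex)) \<Rightarrow>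
   ('k \<Rightarrow>\<^sub>0 complex) \<Rightarrow> 'i set \<Rightarrow> ('i \<Rightarrow> 'i \<Rightarrow> ('k \<Rightarrow>\<^sub>0 complex) \<Rightarrow> complex) \<Rightarrow> bool" where
  "matrix_rep A mul one I R \<longleftrightarrow> finite I \<and>
     (\<forall>i\<in>I. \<forall>j\<in>I. linear_on A (*) (R i j)) \<and>
     (\<forall>i\<in>I. \<forall>j\<in>I. \<forall>a\<in>A. \<forall>b\<in>A. R i j (mul a b) = (\<Sum>k\<in>I. R i k a * R k j b)) \<and>
     (\<forall>i\<in>I. \<forall>j\<in>I. R i j one = (if i = j then 1 else 0))"

definition star_rep ::
  "('k \<Rightarrow>\<^sub>0 complex) set \<Rightarrow> (('k \<Rightarrow>\<^sub>0 complex) \<Rightarrow> ('k \<Rightarrow>\<^sub>0 complex) \<Rightarrow> ('k \<Rightarrow>\<^sub>0 complex)) \<Rightarrow>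
   ('k \<Rightarrow>\<^sub>0 complex) \<Rightarrow> (('k \<Rightarrow>\<^sub>0 complex) \<Rightarrow> ('k \<Rightarrow>\<^sub>0 complex)) \<Rightarrow>
   'i set \<Rightarrow> ('i \<Rightarrow> 'i \<Rightarrow> ('k \<Rightarrow>\<^sub>0 complex) \<Rightarrow> complex) \<Rightarrow> bool" where
  "star_rep A mul one star I R \<longleftrightarrow> matrix_rep A mul one I R \<and>
     (\<forall>i\<in>I. \<forall>j\<in>I. \<forall>a\<in>A. R i j (star a) = cnj (R j i a))"

definition rep_act ::
  "'i set \<Rightarrow> ('i \<Rightarrow> 'i \<Rightarrow> ('k \<Rightarrow>\<^sub>0 complex) \<Rightarrow> complex) \<Rightarrow> ('k \<Rightarrow>\<^sub>0 complex) \<Rightarrow>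
   ('i \<Rightarrow>\<^sub>0 complex) \<Rightarrow> ('i \<Rightarrow>\<^sub>0 complex)" where
  "rep_act I R a w =
     (\<Sum>i\<in>I. Poly_Mapping.single i (\<Sum>j\<in>I. R i j a * Poly_Mapping.lookup w j))"

definition irreducible_rep ::
  "('k \<Rightarrow>\<^sub>0 complex) set \<Rightarrow> (('k \<Rightarrow>\<^sub>0 complex) \<Rightarrow> ('k \<Rightarrow>\<^sub>0 complex) \<Rightarrow> ('k \<Rightarrow>\<^sub>0 complex)) \<Rightarrow>
   ('k \<Rightarrow>\<^sub>0 complex) \<Rightarrow> 'i set \<Rightarrow> ('i \<Rightarrow> 'i \<Rightarrow> ('k \<Rightarrow>\<^sub>0 complex) \<Rightarrow> complex) \<Rightarrow> bool" where
  "irreducible_rep A mul one I R \<longleftrightarrow> matrix_rep A mul one I R \<and> I \<noteq> {} \<and>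
     (\<forall>W. free.subspace W \<and> W \<subseteq> {w. Poly_Mapping.keys w \<subseteq> I} \<and>
          (\<forall>a\<in>A. \<forall>w\<in>W. rep_act I R a w \<in> W) \<longrightarrow>
          W = {0} \<or> W = {w. Poly_Mapping.keys w \<subseteq> I})"

definition intertwiner ::
  "('k \<Rightarrow>\<^sub>0 complex) set \<Rightarrow> 'i set \<Rightarrow> ('i \<Rightarrow> 'i \<Rightarrow> ('k \<Rightarrow>\<^sub>0 complex) \<Rightarrow> complex) \<Rightarrow>
   'j set \<Rightarrow> ('j \<Rightarrow> 'j \<Rightarrow> ('k \<Rightarrow>\<^sub>0 complex) \<Rightarrow> complex) \<Rightarrow> ('j \<Rightarrow> 'i \<Rightarrow> complex) \<Rightarrow> bool" where
  "intertwiner A I R J Q T \<longleftrightarrow>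
     (\<forall>a\<in>A. \<forall>j\<in>J. \<forall>i\<in>I. (\<Sum>k\<in>J. Q j k a * T k i) = (\<Sum>k\<in>I. T j k * R k i a))"

text \<open>\<open>R\<close> is isomorphic to a direct summand of \<open>Q\<close>.\<close>

definition occurs_in ::
  "('k \<Rightarrow>\<^sub>0 complex) set \<Rightarrow> 'i set \<Rightarrow> ('i \<Rightarrow> 'i \<Rightarrow> ('k \<Rightarrow>\<^sub>0 complex) \<Rightarrow> complex) \<Rightarrow>
   'j set \<Rightarrow> ('j \<Rightarrow> 'j \<Rightarrow> ('k \<Rightarrow>\<^sub>0 complex) \<Rightarrow> complex) \<Rightarrow> bool" where
  "occurs_in A I R J Q \<longleftrightarrow>
     (\<exists>T S. intertwiner A I R J Q T \<and> intertwiner A J Q I R S \<and>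
        (\<forall>i\<in>I. \<forall>i'\<in>I. (\<Sum>j\<in>J. S i j * T j i') = (if i = i' then 1 else 0)))"

definition equivalent_rep ::
  "('k \<Rightarrow>\<^sub>0 complex) set \<Rightarrow> 'i set \<Rightarrow> ('i \<Rightarrow> 'i \<Rightarrow> ('k \<Rightarrow>\<^sub>0 complex) \<Rightarrow> complex) \<Rightarrow>
   'j set \<Rightarrow> ('j \<Rightarrow> 'j \<Rightarrow> ('k \<Rightarrow>\<^sub>0 complex) \<Rightarrow> complex) \<Rightarrow> bool" where
  "equivalent_rep A I R J Q \<longleftrightarrow>
     (\<exists>T S. intertwiner A I R J Q T \<and>
        (\<forall>i\<in>I. \<forall>i'\<in>I. (\<Sum>j\<in>J. S i j * T j i') = (if i = i' then 1 else 0)) \<and>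
        (\<forall>j\<in>J. \<forall>j'\<in>J. (\<Sum>i\<in>I. T j i * S i j') = (if j = j' then 1 else 0)))"

text \<open>A complete system of representatives \<open>\<Psi> x\<close>, \<open>x \<in> X\<close>, of the equivalence classes of
  irreducible representations, each of them a *-representation by \<open>d x \<times> d x\<close> matrices.\<close>

definition irrep_system ::
  "('k \<Rightarrow>\<^sub>0 complex) set \<Rightarrow> (('k \<Rightarrow>\<^sub>0 complex) \<Rightarrow> ('k \<Rightarrow>\<^sub>0 complex) \<Rightarrow> ('k \<Rightarrow>\<^sub>0 complex)) \<Rightarrow>
   ('k \<Rightarrow>\<^sub>0 complex) \<Rightarrow> (('k \<Rightarrow>\<^sub>0 complex) \<Rightarrow> ('k \<Rightarrow>\<^sub>0 complex)) \<Rightarrow>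
   'x set \<Rightarrow> ('x \<Rightarrow> nat) \<Rightarrow> ('x \<Rightarrow> nat \<Rightarrow> nat \<Rightarrow> ('k \<Rightarrow>\<^sub>0 complex) \<Rightarrow> complex) \<Rightarrow> bool" where
  "irrep_system A mul one star X d \<Psi> \<longleftrightarrow>
     (\<forall>x\<in>X. irreducible_rep A mul one {..<d x} (\<Psi> x) \<and> star_rep A mul one star {..<d x} (\<Psi> x)) \<and>
     (\<forall>x\<in>X. \<forall>y\<in>X. equivalent_rep A {..<d x} (\<Psi> x) {..<d y} (\<Psi> y) \<longrightarrow> x = y) \<and>
     (\<forall>(n::nat) R. irreducible_rep A mul one {..<n} R \<longrightarrow>
        (\<exists>x\<in>X. equivalent_rep A {..<n} R {..<d x} (\<Psi> x)))"

definition matrix_units ::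
  "('k \<Rightarrow>\<^sub>0 complex) set \<Rightarrow> 'x set \<Rightarrow> ('x \<Rightarrow> nat) \<Rightarrow>
   ('x \<Rightarrow> nat \<Rightarrow> nat \<Rightarrow> ('k \<Rightarrow>\<^sub>0 complex) \<Rightarrow> complex) \<Rightarrow> ('x \<Rightarrow> nat \<Rightarrow> nat \<Rightarrow> ('k \<Rightarrow>\<^sub>0 complex)) \<Rightarrow> bool" where
  "matrix_units A X d \<Psi> E \<longleftrightarrow>
     (\<forall>x\<in>X. \<forall>\<eta><d x. \<forall>\<eta>'<d x. E x \<eta> \<eta>' \<in> A \<and>
        (\<forall>y\<in>X. \<forall>\<alpha><d y. \<forall>\<beta><d y.
           \<Psi> y \<alpha> \<beta> (E x \<eta> \<eta>') = (if x = y \<and> \<alpha> = \<eta> \<and> \<beta> = \<eta>' then 1 else 0)))"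


section \<open>Double triangle algebras\<close>

text \<open>The tensor product of the fundamental representations \<open>f\<^sub>1, \<dots>, f\<^sub>m\<close>, with matrix indices the
  elementary paths of length \<open>m\<close>; the first edge of the path \<open>p\<close> is \<open>take 2 p\<close> and the rest is \<open>tl p\<close>.
  First on \<open>\<xi> \<otimes> \<xi>'\<close> for elementary paths, then extended bilinearly.\<close>

fun tensor_rep_elem ::
  "'v set \<Rightarrow> ('v \<Rightarrow> 'v \<Rightarrow> bool) \<Rightarrow> ('f \<Rightarrow> 'v list \<Rightarrow> 'v list \<Rightarrow> 'v endo \<Rightarrow> complex) \<Rightarrow>
   'f list \<Rightarrow> 'v list \<Rightarrow> 'v list \<Rightarrow> 'v list \<Rightarrow> 'v list \<Rightarrow> complex" where
  "tensor_rep_elem V adj \<Phi> [] p p' \<xi> \<xi>' = 0"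
| "tensor_rep_elem V adj \<Phi> [f] p p' \<xi> \<xi>' = \<Phi> f p p' (basis_vec (\<xi>, \<xi>'))"
| "tensor_rep_elem V adj \<Phi> (f # g # fs) p p' \<xi> \<xi>' =
     (\<Sum>\<zeta>\<in>paths V adj (length \<xi> - 1).
        \<Phi> f (take 2 p) (take 2 p') (basis_vec (\<xi>, \<zeta>)) *
        tensor_rep_elem V adj \<Phi> (g # fs) (tl p) (tl p') \<zeta> \<xi>')"

definition tensor_rep ::
  "'v set \<Rightarrow> ('v \<Rightarrow> 'v \<Rightarrow> bool) \<Rightarrow> ('f \<Rightarrow> 'v list \<Rightarrow> 'v list \<Rightarrow> 'v endo \<Rightarrow> complex) \<Rightarrow>
   'f list \<Rightarrow> 'v list \<Rightarrow> 'v list \<Rightarrow> 'v endo \<Rightarrow> complex" where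
  "tensor_rep V adj \<Phi> fs p p' a =
     (\<Sum>(\<xi>, \<xi>')\<in>Poly_Mapping.keys a.
        Poly_Mapping.lookup a (\<xi>, \<xi>') * tensor_rep_elem V adj \<Phi> fs p p' \<xi> \<xi>')"

text \<open>\<open>\<Phi> f \<alpha> \<beta>\<close> is defined on all of \<open>End_P\<close>; its restriction to \<open>A = End_E\<close> is the representation.
  By \<open>support\<close> the left-hand side of \<open>unitarity\<close> vanishes unless \<open>\<xi> \<star> \<beta>\<close> and \<open>\<zeta> \<star> \<eta>\<close> are nonzero paths,
  so the condition is required in that case only: it is unitarity of the matrix with rows
  \<open>\<alpha> \<star> \<xi>'\<close> and columns \<open>\<xi> \<star> \<beta>\<close>.\<close>

locale double_triangle_algebra =
  fd_cstar_algebra "End_E V adj \<mu>" mul one star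
  for V :: "'v set"
    and adj :: "'v \<Rightarrow> 'v \<Rightarrow> bool"
    and \<mu> :: "'v \<Rightarrow> real"
    and mul :: "'v endo \<Rightarrow> 'v endo \<Rightarrow> 'v endo"
    and one :: "'v endo"
    and star :: "'v endo \<Rightarrow> 'v endo" +
  fixes F :: "'f set"
    and \<Phi> :: "'f \<Rightarrow> 'v list \<Rightarrow> 'v list \<Rightarrow> 'v endo \<Rightarrow> complex"
  assumes fundamental_linear:
      "\<lbrakk>f \<in> F; \<alpha> \<in> edges V adj; \<beta> \<in> edges V adj\<rbrakk> \<Longrightarrow> linear_on (End_P V adj) (*) (\<Phi> f \<alpha> \<beta>)"
    and fundamental_irreducible:
      "f \<in> F \<Longrightarrow> irreducible_rep (End_E V adj \<mu>) mul one (edges V adj) (\<Phi> f)"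
    and fundamental_star:
      "f \<in> F \<Longrightarrow> star_rep (End_E V adj \<mu>) mul one star (edges V adj) (\<Phi> f)"
    and support:
      "\<lbrakk>f \<in> F; \<alpha> \<in> edges V adj; \<beta> \<in> edges V adj; \<xi> \<in> paths V adj n; \<xi>' \<in> paths V adj n;
        \<not> (hd \<alpha> = hd \<xi> \<and> last \<alpha> = hd \<xi>' \<and> hd \<beta> = last \<xi> \<and> last \<beta> = last \<xi>')\<rbrakk>
       \<Longrightarrow> \<Phi> f \<alpha> \<beta> (basis_vec (\<xi>, \<xi>')) = 0"
    and length_zero:
      "\<lbrakk>f \<in> F; \<alpha> \<in> edges V adj; v \<in> V; v' \<in> V\<rbrakk>
       \<Longrightarrow> \<Phi> f \<alpha> \<alpha> (basis_vec ([v], [v'])) = (if hd \<alpha> = v \<and> last \<alpha> = v' then 1 else 0)"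
    and concatenation:
      "\<lbrakk>f \<in> F; \<alpha> \<in> edges V adj; \<beta> \<in> edges V adj;
        \<xi>\<^sub>1 \<in> paths V adj n; \<xi>\<^sub>1' \<in> paths V adj n; \<xi>\<^sub>2 \<in> paths V adj m; \<xi>\<^sub>2' \<in> paths V adj m\<rbrakk>
       \<Longrightarrow> \<Phi> f \<alpha> \<beta> (tensor (concat_path \<xi>\<^sub>1 \<xi>\<^sub>2) (concat_path \<xi>\<^sub>1' \<xi>\<^sub>2')) =
           (if adj (last \<xi>\<^sub>1) (last \<xi>\<^sub>1')
            then \<Phi> f \<alpha> [last \<xi>\<^sub>1, last \<xi>\<^sub>1'] (basis_vec (\<xi>\<^sub>1, \<xi>\<^sub>1')) *
                 \<Phi> f [last \<xi>\<^sub>1, last \<xi>\<^sub>1'] \<beta> (basis_vec (\<xi>\<^sub>2, \<xi>\<^sub>2'))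
            else 0)"
    and unitarity:
      "\<lbrakk>f \<in> F; \<beta> \<in> edges V adj; \<eta> \<in> edges V adj; \<xi> \<in> paths V adj n; \<zeta> \<in> paths V adj n;
        last \<xi> = hd \<beta>; last \<zeta> = hd \<eta>\<rbrakk>
       \<Longrightarrow> (\<Sum>\<alpha>\<in>edges V adj. \<Sum>\<xi>'\<in>paths V adj n.
              cnj (\<Phi> f \<alpha> \<beta> (basis_vec (\<xi>, \<xi>'))) * \<Phi> f \<alpha> \<eta> (basis_vec (\<zeta>, \<xi>'))) =
           (if \<beta> = \<eta> \<and> \<xi> = \<zeta> then 1 else 0)"
    and reflection:
      "\<lbrakk>f \<in> F; \<alpha> \<in> edges V adj; \<beta> \<in> edges V adj; \<xi> \<in> paths V adj n; \<xi>' \<in> paths V adj n;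
        c = sqrt (\<mu> (last \<xi>) * \<mu> (hd \<xi>') / (\<mu> (hd \<xi>) * \<mu> (last \<xi>')))\<rbrakk>
       \<Longrightarrow> \<Phi> f \<alpha> \<beta> (basis_vec (\<xi>, \<xi>')) =
             complex_of_real c * cnj (\<Phi> f \<beta> \<alpha> (basis_vec (rev \<xi>, rev \<xi>'))) \<and>
           \<Phi> f \<alpha> \<beta> (basis_vec (\<xi>, \<xi>')) =
             complex_of_real c * cnj (\<Phi> f (rev \<alpha>) (rev \<beta>) (basis_vec (\<xi>', \<xi>)))"
    and tensor_products:
      "\<lbrakk>fs \<noteq> []; set fs \<subseteq> F\<rbrakk>
       \<Longrightarrow> matrix_rep (End_E V adj \<mu>) mul one (paths V adj (length fs)) (tensor_rep V adj \<Phi> fs)"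
    and generated:
      "irreducible_rep (End_E V adj \<mu>) mul one {..<d::nat} R
       \<Longrightarrow> \<exists>fs. fs \<noteq> [] \<and> set fs \<subseteq> F \<and>
             occurs_in (End_E V adj \<mu>) {..<d} R (paths V adj (length fs)) (tensor_rep V adj \<Phi> fs)"


section \<open>Extension of representations to all paths and projection to the algebra\<close>

text \<open>The extension of a \<open>d \<times> d\<close> matrix representation \<open>R\<close> to \<open>\<xi> \<otimes> \<xi>'\<close> for elementary paths of equal
  length: the product of the matrices of the successive pairs of edges.\<close>

fun ext_elem ::
  "nat \<Rightarrow> (nat \<Rightarrow> nat \<Rightarrow> 'v endo \<Rightarrow> complex) \<Rightarrow> 'v list \<Rightarrow> 'v list \<Rightarrow> nat \<Rightarrow> nat \<Rightarrow> complex" where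
  "ext_elem d R (u # v # w # p) (u' # v' # w' # p') i j =
     (\<Sum>k<d. R i k (basis_vec ([u, v], [u', v'])) * ext_elem d R (v # w # p) (v' # w' # p') k j)"
| "ext_elem d R p p' i j = R i j (basis_vec (p, p'))"

definition ext_rep ::
  "nat \<Rightarrow> (nat \<Rightarrow> nat \<Rightarrow> 'v endo \<Rightarrow> complex) \<Rightarrow> nat \<Rightarrow> nat \<Rightarrow> 'v endo \<Rightarrow> complex" where
  "ext_rep d R i j a =
     (\<Sum>(\<xi>, \<xi>')\<in>Poly_Mapping.keys a. Poly_Mapping.lookup a (\<xi>, \<xi>') * ext_elem d R \<xi> \<xi>' i j)"

definition ess_part ::
  "'x set \<Rightarrow> ('x \<Rightarrow> nat) \<Rightarrow> ('x \<Rightarrow> nat \<Rightarrow> nat \<Rightarrow> 'v endo \<Rightarrow> complex) \<Rightarrow>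
   ('x \<Rightarrow> nat \<Rightarrow> nat \<Rightarrow> 'v endo) \<Rightarrow> 'v endo \<Rightarrow> 'v endo" where
  "ess_part X d \<Psi> E a =
     (\<Sum>x\<in>X. \<Sum>\<alpha><d x. \<Sum>\<beta><d x. cscale (ext_rep (d x) (\<Psi> x) \<alpha> \<beta> a) (E x \<alpha> \<beta>))"

definition coproduct ::
  "'v set \<Rightarrow> ('v \<Rightarrow> 'v \<Rightarrow> bool) \<Rightarrow> ('v \<Rightarrow> real) \<Rightarrow> 'x set \<Rightarrow> ('x \<Rightarrow> nat) \<Rightarrow>
   ('x \<Rightarrow> nat \<Rightarrow> nat \<Rightarrow> 'v endo \<Rightarrow> complex) \<Rightarrow> ('x \<Rightarrow> nat \<Rightarrow> nat \<Rightarrow> 'v endo) \<Rightarrow>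
   ('v endo \<Rightarrow> (('v list \<times> 'v list) \<times> ('v list \<times> 'v list) \<Rightarrow>\<^sub>0 complex)) \<Rightarrow> bool" where
  "coproduct V adj \<mu> X d \<Psi> E \<Delta> \<longleftrightarrow>
     linear_on (End_E V adj \<mu>) cscale \<Delta> \<and>
     (\<forall>n. \<forall>\<xi>\<in>ess_space V adj \<mu> n. \<forall>\<xi>'\<in>ess_space V adj \<mu> n.
        \<Delta> (tensor \<xi> \<xi>') =
          (\<Sum>\<zeta>\<in>paths V adj n.
             tensor (ess_part X d \<Psi> E (tensor \<xi> (basis_vec \<zeta>)))
                    (ess_part X d \<Psi> E (tensor (basis_vec \<zeta>) \<xi>'))))"

end

theory Submission
  imports Defs
begin

text \<open>
  Unitarity and the two reflection identities imply that every fundamental representation satisfies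
  \<open>\<Phi>(\<xi> \<otimes> c\<^sub>k\<^sup>T \<eta>) = \<Phi>(c\<^sub>k \<xi> \<otimes> \<eta>)\<close>, where \<open>c\<^sub>k\<^sup>T\<close> is the transpose of \<open>c\<^sub>k\<close>. The relation passes to tensor
  products, and from there to the extension of every irreducible representation to all paths, which
  on \<open>A\<close> agrees with the representation itself. Hence for essential \<open>\<xi>\<close> the function
  \<open>\<zeta> \<mapsto> (\<xi> \<otimes> \<zeta>)\<^sub>\<E>\<close> on elementary paths is itself essential, so \<open>(\<xi> \<otimes> \<zeta>)\<^sub>\<E>\<close> is the sum of the
  \<open>\<langle>b, \<zeta>\<rangle> \<xi> \<otimes> b\<close> over the orthonormal basis. Since the irreducible representations of a
  finite-dimensional C*-algebra separate points, \<open>a \<mapsto> a\<^sub>\<E>\<close> is the identity on \<open>A\<close>, and both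
  counit identities reduce to expansions in the basis.
\<close>

text \<open>The coproduct sums over elementary paths \<zeta>, which need not be essential, so its
  factors are at first only known through their matrix entries. Seeing just the projection of
  \<zeta> to the essential space collapses the sum to \<Delta>(\<xi> \<otimes> \<xi>') = sum_b
  (\<xi> \<otimes> b) \<otimes> (b \<otimes> \<xi>'). It suffices to treat the left factor: once b
  replaces \<zeta> there, linearity reassembles b in the right one. The weights of c_k are exactly
  those that cancel the reflection factors. Unitarity supplies orthonormal columns, while the
  relation needs orthonormal rows; for edges, rows and columns are both indexed by the paths of
  length 2, so the matrix is square and one follows from the other. An irreducible representation
  and its intertwiner into a tensor product are given on A only, but the extension multiplies
  matrices of edges. Vertices and edges are essential, so the intertwiner works there and spreads to
  all paths along concatenation. For this, tensor products must first be shown to respect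
  concatenation.\<close>

section \<open>Unitary matrices and linear maps\<close>

text \<open>The sum of the squared absolute values of the entries of \<open>1 - U U\<^sup>*\<close> is
  \<open>card I - 2 card I + card I\<close>.\<close>

lemma isometry_imp_coisometry:
  fixes U :: "'a \<Rightarrow> 'a \<Rightarrow> complex"
  assumes fin: "finite I"
    and iso: "\<And>q q'. q \<in> I \<Longrightarrow> q' \<in> I \<Longrightarrow>
      (\<Sum>p\<in>I. cnj (U p q) * U p q') = (if q = q' then 1 else 0)"
    and p: "p \<in> I" "p' \<in> I"
  shows "(\<Sum>q\<in>I. U p q * cnj (U p' q)) = (if p = p' then 1 else 0)"
proof -
  define M where "M a b = (\<Sum>q\<in>I. U a q * cnj (U b q))" for a b
  define D :: "'a \<Rightarrow> 'a \<Rightarrow> complex" where "D a b = (if a = b then 1 else 0)" for a b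
  have cM: "cnj (M a b) = M b a" for a b
    by (simp add: M_def mult.commute)
  have tr: "(\<Sum>a\<in>I. M a a) = of_nat (card I)"
  proof -
    have "(\<Sum>a\<in>I. M a a) = (\<Sum>q\<in>I. \<Sum>a\<in>I. cnj (U a q) * U a q)"
      unfolding M_def by (subst sum.swap) (simp add: mult.commute)
    also have "\<dots> = (\<Sum>q\<in>I. 1)" by (intro sum.cong refl) (simp add: iso)
    finally show ?thesis by simp
  qed
  have sq: "(\<Sum>a\<in>I. \<Sum>b\<in>I. M a b * M b a) = of_nat (card I)"
  proof -
    have "(\<Sum>a\<in>I. \<Sum>b\<in>I. M a b * M b a) =
       (\<Sum>a\<in>I. \<Sum>b\<in>I. \<Sum>q\<in>I. \<Sum>q'\<in>I. (cnj (U b q) * U b q') * (cnj (U a q') * U a q))"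
      unfolding M_def sum_product by (intro sum.cong refl) (simp add: mult_ac)
    also have "\<dots> = (\<Sum>a\<in>I. \<Sum>q\<in>I. \<Sum>b\<in>I. \<Sum>q'\<in>I. (cnj (U b q) * U b q') * (cnj (U a q') * U a q))"
      by (rule sum.cong[OF refl]) (rule sum.swap)
    also have "\<dots> = (\<Sum>a\<in>I. \<Sum>q\<in>I. \<Sum>q'\<in>I. \<Sum>b\<in>I. (cnj (U b q) * U b q') * (cnj (U a q') * U a q))"
      by (rule sum.cong[OF refl], rule sum.cong[OF refl]) (rule sum.swap)
    also have "\<dots> = (\<Sum>a\<in>I. \<Sum>q\<in>I. \<Sum>q'\<in>I. (if q = q' then cnj (U a q') * U a q else 0))"
      by (intro sum.cong refl) (simp add: sum_distrib_right[symmetric] iso)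
    also have "\<dots> = (\<Sum>a\<in>I. \<Sum>q\<in>I. cnj (U a q) * U a q)"
      by (intro sum.cong refl) (simp add: fin)
    also have "\<dots> = (\<Sum>a\<in>I. M a a)"
      by (simp add: M_def mult.commute)
    finally show ?thesis using tr by simp
  qed
  have "(\<Sum>a\<in>I. \<Sum>b\<in>I. complex_of_real ((cmod (D a b - M a b))\<^sup>2)) =
      (\<Sum>a\<in>I. \<Sum>b\<in>I. (if a = b then 1 - M a b - M b a else 0) + M a b * M b a)"
    unfolding complex_norm_square
    by (intro sum.cong refl) (auto simp: cM D_def algebra_simps)
  also have "\<dots> = (\<Sum>a\<in>I. 1 - M a a - M a a) + (\<Sum>a\<in>I. \<Sum>b\<in>I. M a b * M b a)"
    by (simp add: sum.distrib fin)
  also have "\<dots> = 0"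
    by (simp add: sum_subtractf tr sq flip: sum_distrib_left)
  finally have "complex_of_real (\<Sum>a\<in>I. \<Sum>b\<in>I. (cmod (D a b - M a b))\<^sup>2) = 0"
    by simp
  then have "(\<Sum>a\<in>I. \<Sum>b\<in>I. (cmod (D a b - M a b))\<^sup>2) = 0"
    using of_real_eq_0_iff by blast
  then have "(\<Sum>b\<in>I. (cmod (D p b - M p b))\<^sup>2) = 0"
    using p fin by (subst (asm) sum_nonneg_eq_0_iff) (auto intro: sum_nonneg)
  then have "(cmod (D p p' - M p p'))\<^sup>2 = 0"
    using p fin by (subst (asm) sum_nonneg_eq_0_iff) auto
  then show ?thesis by (simp add: D_def M_def)
qed

section \<open>Linear maps on subspaces of free complex vector spaces\<close>

abbreviation coef :: "('k \<Rightarrow>\<^sub>0 complex) \<Rightarrow> 'k \<Rightarrow> complex" where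
  "coef \<equiv> Poly_Mapping.lookup"

lemma linear_on_add: "linear_on S t f \<Longrightarrow> x \<in> S \<Longrightarrow> y \<in> S \<Longrightarrow> f (x + y) = f x + f y"
  and linear_on_scale: "linear_on S t f \<Longrightarrow> x \<in> S \<Longrightarrow> f (cscale c x) = t c (f x)"
  by (auto simp: linear_on_def)

text \<open>The scalar action \<open>t\<close> stays generic so that functionals and vector-valued
  maps are covered together. The target is only a monoid, without cancellation, so
  \<open>f 0 = 0\<close> is drawn from scaling by 0.\<close>

lemma linear_on_sum:
  fixes f :: "('k \<Rightarrow>\<^sub>0 complex) \<Rightarrow> 'b :: comm_monoid_add"
  assumes lin: "linear_on S t f" and S: "free.subspace S" and t: "\<And>x. t 0 x = 0"
    and x: "\<And>i. i \<in> I \<Longrightarrow> x i \<in> S"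
  shows "f (\<Sum>i\<in>I. x i) = (\<Sum>i\<in>I. f (x i))"
proof -
  have "f (cscale 0 0) = t 0 (f 0)"
    using lin S by (intro linear_on_scale) (auto simp: free.subspace_0)
  then have z: "f 0 = 0" using t by simp
  show ?thesis using x
  proof (induction I rule: infinite_finite_induct)
    case (insert i I)
    then show ?case
      using free.subspace_sum[OF S, of I x] lin by (simp add: linear_on_add)
  qed (auto simp: z)
qed

lemma linear_on_complex_sum:
  assumes "linear_on S (*) f" "free.subspace S" "\<And>i. i \<in> I \<Longrightarrow> x i \<in> S"
  shows "f (\<Sum>i\<in>I. cscale (c i) (x i)) = (\<Sum>i\<in>I. c i * f (x i))"
  using assms by (subst linear_on_sum[OF assms(1)])
     (auto intro!: sum.cong linear_on_scale[OF assms(1)] free.subspace_scale)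

lemma linear_on_cscale_sum:
  assumes "linear_on S cscale f" "free.subspace S" "\<And>i. i \<in> I \<Longrightarrow> x i \<in> S"
  shows "f (\<Sum>i\<in>I. cscale (c i) (x i)) = (\<Sum>i\<in>I. cscale (c i) (f (x i)))"
  using assms by (subst linear_on_sum[OF assms(1)])
     (auto intro!: sum.cong linear_on_scale[OF assms(1)] free.subspace_scale)

lemma linear_on_0:
  fixes f :: "('k \<Rightarrow>\<^sub>0 complex) \<Rightarrow> 'b :: comm_monoid_add"
  assumes "linear_on S t f" "free.subspace S" "\<And>x. t 0 x = 0"
  shows "f 0 = 0"
  using linear_on_sum[OF assms, where I = "{}"] by simp

lemma coef_sum_cscale: "coef (\<Sum>i\<in>I. cscale (c i) (x i)) k = (\<Sum>i\<in>I. c i * coef (x i) k)"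
  by (simp add: lookup_sum)

text \<open>A basis of the smaller space extends to one of the larger. The ambient space may have
  infinite dimension; the finite set \<open>S\<close> is what makes the two bases finite and
  comparable by cardinality.\<close>

lemma subspace_eq_if_dim_le:
  assumes "free.subspace L'" "L' \<subseteq> L" "finite S" "L \<subseteq> free.span S" "free.subspace L"
    and "free.dim L \<le> free.dim L'"
  shows "L' = L"
proof -
  obtain C' where C': "C' \<subseteq> L'" "free.independent C'" "L' \<subseteq> free.span C'"
    using free.maximal_independent_subset by blast
  obtain C where C: "C' \<subseteq> C" "C \<subseteq> L" "free.independent C" "L \<subseteq> free.span C"
    using free.maximal_independent_subset_extend[OF _ C'(2), of L] C'(1) assms(2) by blast
  have "finite C"
    using free.independent_span_bound[OF assms(3) C(3)] C(2) assms(4) by auto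
  moreover have "free.dim L = card C" using free.basis_card_eq_dim[OF C(2,4,3)] by simp
  moreover have "free.dim L' = card C'" using free.basis_card_eq_dim[OF C'(1,3,2)] by simp
  ultimately have "C' = C" using C(1) assms(6) by (metis card_seteq)
  then have "L \<subseteq> L'"
    using C(4) C'(1) assms(1) free.span_minimal by blast
  then show ?thesis using assms(2) by auto
qed

section \<open>Irreducible representations separate points\<close>

definition left_ideal ::
  "('k \<Rightarrow>\<^sub>0 complex) set \<Rightarrow> (('k \<Rightarrow>\<^sub>0 complex) \<Rightarrow> ('k \<Rightarrow>\<^sub>0 complex) \<Rightarrow> ('k \<Rightarrow>\<^sub>0 complex)) \<Rightarrow>
   ('k \<Rightarrow>\<^sub>0 complex) set \<Rightarrow> bool" where
  "left_ideal A mul L \<longleftrightarrow> free.subspace L \<and> L \<subseteq> A \<and> (\<forall>a\<in>A. \<forall>y\<in>L. mul a y \<in> L)"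

context fd_cstar_algebra
begin

lemma mul_zero_right: "a \<in> A \<Longrightarrow> mul a 0 = 0"
  using linear_on_0[OF mult_linear_right subspace] by simp

lemma mul_zero_left: "a \<in> A \<Longrightarrow> mul 0 a = 0"
  using linear_on_0[OF mult_linear_left subspace] by simp

text \<open>The C*-identity in the form in which it is applied below: the involution is definite, so
  a nonzero left ideal cannot be annihilated by its own generator.\<close>

lemma star_mult_eq_0_imp:
  assumes "a \<in> A" "mul (star a) a = 0"
  shows "a = 0"
proof -
  from cstar_norm obtain N :: "('k \<Rightarrow>\<^sub>0 complex) \<Rightarrow> real" where
    "\<forall>a\<in>A. 0 \<le> N a \<and> (N a = 0 \<longleftrightarrow> a = 0)"
    "\<forall>a\<in>A. N (mul (star a) a) = (N a)\<^sup>2"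
    by (elim exE conjE) (rule that)
  then have N: "\<And>a. a \<in> A \<Longrightarrow> N a = 0 \<longleftrightarrow> a = 0"
    "\<And>a. a \<in> A \<Longrightarrow> N (mul (star a) a) = (N a)\<^sup>2" by simp_all
  have "(N a)\<^sup>2 = 0"
    using N(2)[OF assms(1)] N(1)[of 0] assms(2) free.subspace_0[OF subspace] by simp
  then show ?thesis using N(1)[OF assms(1)] by simp
qed

lemma principal_left_ideal:
  assumes h: "h \<in> A"
  shows "left_ideal A mul {mul x h | x. x \<in> A}"
  unfolding left_ideal_def
proof (intro conjI ballI)
  show "free.subspace {mul x h | x. x \<in> A}"
  proof (rule free.subspaceI)
    show "0 \<in> {mul x h | x. x \<in> A}"
      using mul_zero_left[OF h] free.subspace_0[OF subspace] by force
  next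
    fix y z assume "y \<in> {mul x h | x. x \<in> A}" "z \<in> {mul x h | x. x \<in> A}"
    then obtain x x' where x: "x \<in> A" "x' \<in> A" "y = mul x h" "z = mul x' h" by auto
    then have "y + z = mul (x + x') h"
      using linear_on_add[OF mult_linear_left[OF h]] by simp
    then show "y + z \<in> {mul x h | x. x \<in> A}"
      using x free.subspace_add[OF subspace] by blast
  next
    fix c y assume "y \<in> {mul x h | x. x \<in> A}"
    then obtain x where x: "x \<in> A" "y = mul x h" by auto
    then have "cscale c y = mul (cscale c x) h"
      using linear_on_scale[OF mult_linear_left[OF h]] by simp
    then show "cscale c y \<in> {mul x h | x. x \<in> A}"
      using x free.subspace_scale[OF subspace] by blast
  qed
  show "{mul x h | x. x \<in> A} \<subseteq> A" using h mult_closed by auto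
  show "mul a y \<in> {mul x h | x. x \<in> A}" if "a \<in> A" "y \<in> {mul x h | x. x \<in> A}" for a y
    using that h by (auto simp: mult_assoc[symmetric] intro: mult_closed)
qed

text \<open>Least dimension replaces a chain argument: a nonzero ideal inside one of least dimension
  has the same dimension, hence is equal to it.\<close>

lemma minimal_left_ideal_exists:
  assumes "left_ideal A mul L\<^sub>0" "L\<^sub>0 \<noteq> {0}"
  obtains L where "left_ideal A mul L" "L \<subseteq> L\<^sub>0" "L \<noteq> {0}"
    "\<And>L'. left_ideal A mul L' \<Longrightarrow> L' \<subseteq> L \<Longrightarrow> L' = {0} \<or> L' = L"
proof -
  let ?P = "\<lambda>L. left_ideal A mul L \<and> L \<subseteq> L\<^sub>0 \<and> L \<noteq> {0}"
  obtain L where L: "?P L" and min: "\<And>L'. ?P L' \<Longrightarrow> free.dim L \<le> free.dim L'"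
    using ex_has_least_nat[of ?P L\<^sub>0 free.dim] assms by auto
  obtain S where S: "finite S" "free.span S = A" using finite_dim by auto
  have "L' = L" if "left_ideal A mul L'" "L' \<subseteq> L" "L' \<noteq> {0}" for L'
  proof (rule subspace_eq_if_dim_le[OF _ that(2) S(1)])
    show "free.dim L \<le> free.dim L'" using that L by (intro min) auto
  qed (use that L S in \<open>auto simp: left_ideal_def\<close>)
  with L that show ?thesis by blast
qed

text \<open>Left multiplication on \<open>L\<close>, written in a basis \<open>e\<close>. Invariant
  subspaces of the coordinate space are the left ideals inside \<open>L\<close>, so minimality of
  \<open>L\<close> is irreducibility.\<close>

lemma minimal_left_ideal_irreducible_rep:
  assumes L: "left_ideal A mul L" "L \<noteq> {0}"
    and min: "\<And>L'. left_ideal A mul L' \<Longrightarrow> L' \<subseteq> L \<Longrightarrow> L' = {0} \<or> L' = L"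
  obtains n :: nat and R e where "irreducible_rep A mul one {..<n} R"
    "\<And>a j. a \<in> A \<Longrightarrow> j < n \<Longrightarrow> mul a (e j) = (\<Sum>i<n. cscale (R i j a) (e i))"
    "free.span (e ` {..<n}) = L"
proof -
  have subL: "free.subspace L" and LA: "L \<subseteq> A"
    and mulL: "\<And>a y. a \<in> A \<Longrightarrow> y \<in> L \<Longrightarrow> mul a y \<in> L"
    using L by (auto simp: left_ideal_def)
  obtain S where S: "finite S" "free.span S = A" using finite_dim by auto
  obtain C where C: "C \<subseteq> L" "free.independent C" "L \<subseteq> free.span C"
    using free.maximal_independent_subset by blast
  have finC: "finite C"
    using free.independent_span_bound[OF S(1) C(2)] C(1) LA S(2) by auto
  have spanC: "free.span C = L"
    using C(1,3) subL free.span_minimal by blast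
  define n where "n = card C"
  obtain e where e: "bij_betw e {..<n} C"
    using ex_bij_betw_nat_finite[OF finC] by (auto simp: n_def atLeast0LessThan)
  have eC: "e j \<in> C" if "j < n" for j using e that by (auto simp: bij_betw_def)
  have eL: "e j \<in> L" if "j < n" for j using eC C that by auto
  have eA: "e j \<in> A" if "j < n" for j using eL LA that by auto
  have einj: "e i = e j \<longleftrightarrow> i = j" if "i < n" "j < n" for i j
    using e that by (auto simp: bij_betw_def inj_on_def)
  let ?rep = "free.representation C"
  have reindex: "(\<Sum>b\<in>C. f b) = (\<Sum>i<n. f (e i))" for f :: "_ \<Rightarrow> 'k \<Rightarrow>\<^sub>0 complex"
    using sum.reindex_bij_betw[OF e, of f] by simp
  have expand: "y = (\<Sum>i<n. cscale (?rep y (e i)) (e i))" if "y \<in> L" for y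
    using free.sum_representation_eq[OF C(2) _ finC order_refl, of y] that spanC
    by (simp add: reindex)
  have rep_sum: "?rep (\<Sum>j<n. cscale (c j) (y j)) b = (\<Sum>j<n. c j * ?rep (y j) b)"
    if "\<And>j. j < n \<Longrightarrow> y j \<in> L" for c y b
  proof -
    have y: "y j \<in> free.span C" if "j < n" for j
      using \<open>\<And>j. j < n \<Longrightarrow> y j \<in> L\<close> that spanC by simp
    have "?rep (\<Sum>j<n. cscale (c j) (y j)) = (\<lambda>b. \<Sum>j<n. ?rep (cscale (c j) (y j)) b)"
      by (rule free.representation_sum[OF C(2)]) (auto intro: y free.span_scale)
    then show ?thesis
      using y by (simp add: free.representation_scale[OF C(2)])
  qed
  have rep_e: "?rep (e j) (e i) = (if i = j then 1 else 0)" if "i < n" "j < n" for i j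
    using free.representation_basis[OF C(2) eC[OF that(2)]] that einj by auto
  define R where "R i j a = ?rep (mul a (e j)) (e i)" for i j a
  have act: "mul a (e j) = (\<Sum>i<n. cscale (R i j a) (e i))" if "a \<in> A" "j < n" for a j
    unfolding R_def by (rule expand) (use that mulL eL in auto)
  have mulsum: "mul a (\<Sum>j<n. cscale (c j) (e j)) = (\<Sum>i<n. cscale (\<Sum>j<n. R i j a * c j) (e i))"
    if a: "a \<in> A" for a c
  proof -
    have "mul a (\<Sum>j<n. cscale (c j) (e j)) = (\<Sum>j<n. cscale (c j) (mul a (e j)))"
      using linear_on_cscale_sum[OF mult_linear_right[OF a] subspace, of "{..<n}" e c] eA by simp
    also have "\<dots> = (\<Sum>j<n. \<Sum>i<n. cscale (R i j a * c j) (e i))"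
      using a by (intro sum.cong refl) (simp add: act free.scale_sum_right mult.commute)
    finally show ?thesis by (subst (asm) sum.swap) (simp add: free.scale_sum_left)
  qed
  have R: "matrix_rep A mul one {..<n} R"
    unfolding matrix_rep_def
  proof (intro conjI ballI)
    fix i j assume "i \<in> {..<n}" "j \<in> {..<n}"
    then have ij: "i < n" "j < n" by auto
    show "linear_on A (*) (R i j)"
      using linear_on_add[OF mult_linear_left[OF eA[OF ij(2)]]]
        linear_on_scale[OF mult_linear_left[OF eA[OF ij(2)]]] mulL[OF _ eL[OF ij(2)]] C(2) spanC
      by (simp add: linear_on_def R_def free.representation_add free.representation_scale)
    show "R i j one = (if i = j then 1 else 0)"
      using ij by (simp add: R_def one_left eA rep_e)
    fix a b assume ab: "a \<in> A" "b \<in> A"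
    have "mul (mul a b) (e j) = mul a (mul b (e j))"
      using ab eA ij by (simp add: mult_assoc)
    also have "\<dots> = (\<Sum>k<n. cscale (\<Sum>l<n. R k l a * R l j b) (e k))"
      using ab ij by (simp add: act mulsum)
    finally have "R i j (mul a b) = ?rep (\<Sum>k<n. cscale (\<Sum>l<n. R k l a * R l j b) (e k)) (e i)"
      by (simp add: R_def)
    also have "\<dots> = (\<Sum>k<n. (\<Sum>l<n. R k l a * R l j b) * (if i = k then 1 else 0))"
      using ij eL by (simp add: rep_sum rep_e)
    also have "\<dots> = (\<Sum>l<n. R i l a * R l j b)"
      using ij by (simp add: mult_delta_right)
    finally show "R i j (mul a b) = (\<Sum>k\<in>{..<n}. R i k a * R k j b)" by simp
  qed simp
  have "n \<noteq> 0"
  proof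
    assume "n = 0"
    then have "C = {}" using finC by (simp add: n_def)
    then show False using L(2) spanC by simp
  qed
  have coord: "w = 0" if "Poly_Mapping.keys w \<subseteq> {..<n}" "(\<Sum>i<n. cscale (coef w i) (e i)) = 0"
    for w :: "nat \<Rightarrow>\<^sub>0 complex"
  proof (rule poly_mapping_eqI)
    fix k
    show "coef w k = coef 0 k"
    proof (cases "k < n")
      case True
      then have "(\<Sum>i<n. coef w i * ?rep (e i) (e k)) = 0"
        using rep_sum[of e "coef w" "e k"] eL that(2) by (simp add: free.representation_zero)
      then show ?thesis using True by (simp add: rep_e mult_delta_right)
    next
      case False
      then show ?thesis using that(1) by (auto simp: in_keys_iff)
    qed
  qed
  have irr: "irreducible_rep A mul one {..<n} R"
    unfolding irreducible_rep_def
  proof (intro conjI allI impI)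
    show "{..<n} \<noteq> {}" using \<open>n \<noteq> 0\<close> by auto
    fix W :: "(nat \<Rightarrow>\<^sub>0 complex) set"
    assume W: "free.subspace W \<and> W \<subseteq> {w. Poly_Mapping.keys w \<subseteq> {..<n}} \<and>
      (\<forall>a\<in>A. \<forall>w\<in>W. rep_act {..<n} R a w \<in> W)"
    \<comment> \<open>The coordinate isomorphism onto \<open>L\<close>; it carries
      \<open>rep_act\<close> to left multiplication, and \<open>coord\<close> above is its
      injectivity.\<close>
    define g where "g w = (\<Sum>i<n. cscale (coef w i) (e i))" for w
    have g_add: "g (v + w) = g v + g w" for v w
      by (simp add: g_def lookup_add free.scale_left_distrib sum.distrib)
    have g_scale: "g (cscale c w) = cscale c (g w)" for c w
      by (simp add: g_def free.scale_sum_right)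
    have coef_act: "coef (rep_act {..<n} R a w) i = (if i < n then \<Sum>j<n. R i j a * coef w j else 0)" for a w i
      by (simp add: rep_act_def lookup_sum lookup_single when_def)
    have g_act: "g (rep_act {..<n} R a w) = mul a (g w)" if "a \<in> A" for a w
      unfolding g_def mulsum[OF that] by (intro sum.cong refl) (simp add: coef_act)
    have gL: "g w \<in> L" for w
      unfolding g_def using eL subL by (intro free.subspace_sum free.subspace_scale) auto
    have "left_ideal A mul (g ` W)"
      unfolding left_ideal_def
    proof (intro conjI ballI)
      show "free.subspace (g ` W)"
      proof (rule free.subspaceI)
        have "g 0 = 0" by (simp add: g_def)
        then show "0 \<in> g ` W" using W free.subspace_0 by (metis image_eqI)
      next
        fix x y assume "x \<in> g ` W" "y \<in> g ` W"
        then obtain v w where "v \<in> W" "w \<in> W" "x + y = g (v + w)" by (auto simp: g_add)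
        then show "x + y \<in> g ` W" using W free.subspace_add by blast
      next
        fix c x assume "x \<in> g ` W"
        then obtain v where "v \<in> W" "cscale c x = g (cscale c v)" by (auto simp: g_scale)
        then show "cscale c x \<in> g ` W" using W free.subspace_scale by blast
      qed
      show "g ` W \<subseteq> A" using gL LA by auto
      show "mul a y \<in> g ` W" if "a \<in> A" "y \<in> g ` W" for a y
        using that W by (auto simp: g_act[symmetric])
    qed
    then consider "g ` W = {0}" | "g ` W = L"
      using min[of "g ` W"] gL by auto
    then show "W = {0} \<or> W = {w. Poly_Mapping.keys w \<subseteq> {..<n}}"
    proof cases
      case 1
      then have "W \<subseteq> {0}" using W coord unfolding g_def by blast
      then show ?thesis using W free.subspace_0 by blast
    next
      \<comment> \<open>Each coordinate vector has the same image as some element of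
        \<open>W\<close>, and injectivity identifies the two.\<close>
      case 2
      have "w \<in> W" if w: "Poly_Mapping.keys w \<subseteq> {..<n}" for w
      proof -
        obtain v where v: "v \<in> W" "g w = g v" using 2 gL by (metis imageE)
        have "g (w - v) = 0"
          using v(2) g_add[of "w - v" v] by simp
        moreover have "Poly_Mapping.keys (w - v) \<subseteq> {..<n}"
          using w v(1) W Poly_Mapping.keys_diff[of w v] by blast
        ultimately have "w - v = 0" using coord unfolding g_def by blast
        then have "w = v" by simp
        then show ?thesis using v by simp
      qed
      then show ?thesis using W by auto
    qed
  qed (rule R)
  have sp: "free.span (e ` {..<n}) = L" using e spanC by (simp add: bij_betw_def)
  show ?thesis by (rule that[of n R e]) (fact irr act sp)+
qed

text \<open>For \<open>h = a\<^sup>*a\<close> take a minimal left ideal \<open>L \<subseteq> A h\<close>. If \<open>h\<close> annihilated \<open>L\<close>, every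
  \<open>y = x h\<close> in \<open>L\<close> would satisfy \<open>y\<^sup>*y = h (x\<^sup>*y) = 0\<close>.\<close>

lemma irreducible_reps_separate:
  assumes a: "a \<in> A" "a \<noteq> 0"
  obtains n :: nat and R i j where "irreducible_rep A mul one {..<n} R" "i < n" "j < n" "R i j a \<noteq> 0"
proof -
  define h where "h = mul (star a) a"
  have hA: "h \<in> A" using a by (simp add: h_def mult_closed star_closed)
  have h0: "h \<noteq> 0" using star_mult_eq_0_imp a by (auto simp: h_def)
  have hstar: "star h = h" using a by (simp add: h_def star_mult star_closed star_star)
  have "mul one h \<in> {mul x h | x. x \<in> A}" using one_closed by blast
  then have "h \<in> {mul x h | x. x \<in> A}" using one_left[OF hA] by simp
  then have nz: "{mul x h | x. x \<in> A} \<noteq> {0}" using h0 by auto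
  obtain L where L: "left_ideal A mul L" "L \<subseteq> {mul x h | x. x \<in> A}" "L \<noteq> {0}"
    and min: "\<And>L'. left_ideal A mul L' \<Longrightarrow> L' \<subseteq> L \<Longrightarrow> L' = {0} \<or> L' = L"
    by (rule minimal_left_ideal_exists[OF principal_left_ideal[OF hA] nz]) (rule that)
  obtain n :: nat and R e where R: "irreducible_rep A mul one {..<n} R"
    and act: "\<And>a j. a \<in> A \<Longrightarrow> j < n \<Longrightarrow> mul a (e j) = (\<Sum>i<n. cscale (R i j a) (e i))"
    and e: "free.span (e ` {..<n}) = L"
    by (rule minimal_left_ideal_irreducible_rep[OF L(1,3) min]) (assumption | rule that)+
  have LA: "L \<subseteq> A" using L(1) by (auto simp: left_ideal_def)
  have "\<exists>i j. i < n \<and> j < n \<and> R i j a \<noteq> 0"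
  proof (rule ccontr)
    assume "\<not> ?thesis"
    \<comment> \<open>Multiplicativity passes the vanishing from \<open>a\<close> to
      \<open>h = mul (star a) a\<close>.\<close>
    then have "R i j h = 0" if "i < n" "j < n" for i j
      using R that a star_closed
      by (simp add: irreducible_rep_def matrix_rep_def h_def)
    then have he: "mul h (e j) = 0" if "j < n" for j using act[OF hA that] that by simp
    have hL: "mul h y = 0" if "y \<in> L" for y
    proof -
      have "y \<in> free.span (e ` {..<n})" using that e by simp
      then have "y \<in> A \<and> mul h y = 0"
      proof (induction rule: free.span_induct_alt)
        case base
        show ?case using mul_zero_right[OF hA] free.subspace_0[OF subspace] by simp
      next
        case (step c x y)
        then have "x \<in> L" using e free.span_base[of x "e ` {..<n}"] by simp
        then have "x \<in> A" using LA by auto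
        moreover from this have "cscale c x \<in> A" by (rule free.subspace_scale[OF subspace])
        moreover have "mul h x = 0" using step(1) he by auto
        ultimately show ?case using step(2) free.subspace_add[OF subspace]
          by (simp add: linear_on_add[OF mult_linear_right[OF hA]]
              linear_on_scale[OF mult_linear_right[OF hA]])
      qed
      then show ?thesis ..
    qed
    obtain y where y: "y \<in> L" "y \<noteq> 0"
      using L(1,3) free.subspace_0[of L] unfolding left_ideal_def by blast
    then obtain x where x: "x \<in> A" "y = mul x h" using L(2) by auto
    have "star y = mul h (star x)" using x hA by (simp add: star_mult hstar)
    then have "mul (star y) y = mul h (mul (star x) y)"
      using x y LA hA by (metis mult_assoc star_closed subsetD)
    also have "\<dots> = 0"
      using hL L(1) x y star_closed by (simp add: left_ideal_def)
    finally show False using star_mult_eq_0_imp y LA by blast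
  qed
  then obtain i j where "i < n" "j < n" "R i j a \<noteq> 0" by auto
  then show ?thesis by (rule that[OF R])
qed

text \<open>A left inverse \<open>S\<close> of the equivalence \<open>T\<close> gives R = S T R = S
  \<Psi> T, so the entries of R at \<open>a\<close> vanish together with those of \<Psi>.\<close>

lemma irrep_system_separates:
  assumes sys: "irrep_system A mul one star X d \<Psi>" and a: "a \<in> A"
    and zero: "\<And>x \<alpha> \<beta>. x \<in> X \<Longrightarrow> \<alpha> < d x \<Longrightarrow> \<beta> < d x \<Longrightarrow> \<Psi> x \<alpha> \<beta> a = 0"
  shows "a = 0"
proof (rule ccontr)
  assume "a \<noteq> 0"
  then obtain n :: nat and R i j
    where R: "irreducible_rep A mul one {..<n} R" "i < n" "j < n" "R i j a \<noteq> 0"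
    using irreducible_reps_separate[OF a] by blast
  obtain x where x: "x \<in> X" and "equivalent_rep A {..<n} R {..<d x} (\<Psi> x)"
    using sys R(1) unfolding irrep_system_def by blast
  then obtain T S where T: "intertwiner A {..<n} R {..<d x} (\<Psi> x) T"
    and S: "\<And>i i'. i < n \<Longrightarrow> i' < n \<Longrightarrow> (\<Sum>j<d x. S i j * T j i') = (if i = i' then 1 else 0)"
    unfolding equivalent_rep_def by auto
  have "R i j a = (\<Sum>k<n. (\<Sum>l<d x. S i l * T l k) * R k j a)"
    using R by (simp add: S mult_delta_left)
  also have "\<dots> = (\<Sum>l<d x. S i l * (\<Sum>k<n. T l k * R k j a))"
    by (simp add: sum_distrib_left sum_distrib_right mult_ac) (rule sum.swap)
  also have "\<dots> = 0"
    using T a R x by (simp add: zero flip: T[unfolded intertwiner_def, rule_format])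
  finally show False using R by simp
qed

end

section \<open>Elementary paths\<close>

lemma paths_0: "paths V adj 0 = (\<lambda>v. [v]) ` V"
  by (auto simp: paths_def length_Suc_conv)

lemma paths_Cons_Cons:
  "u # v # p \<in> paths V adj (Suc n) \<longleftrightarrow> u \<in> V \<and> adj u v \<and> v # p \<in> paths V adj n"
  by (auto simp: paths_def less_Suc_eq_0_disj)

lemma paths_SucE:
  assumes "p \<in> paths V adj (Suc n)"
  obtains u v q where "p = u # v # q" "u \<in> V" "adj u v" "v # q \<in> paths V adj n"
proof -
  obtain u v q where "p = u # v # q"
    using assms by (auto simp: paths_def length_Suc_conv)
  with assms that show ?thesis by (auto simp: paths_Cons_Cons)
qed

lemma paths_length: "p \<in> paths V adj n \<Longrightarrow> length p = Suc n"
  by (simp add: paths_def)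

lemma paths_Nil: "[] \<notin> paths V adj n"
  by (simp add: paths_def)

lemma paths_hd: "p \<in> paths V adj n \<Longrightarrow> hd p \<in> V"
  by (cases p) (auto simp: paths_def)

lemma paths_last: "p \<in> paths V adj n \<Longrightarrow> last p \<in> V"
  by (auto simp: paths_def) (metis last_in_set list.size(3) nat.distinct(1) subsetD)

lemma edges_iff: "[u, v] \<in> paths V adj (Suc 0) \<longleftrightarrow> u \<in> V \<and> v \<in> V \<and> adj u v"
  by (auto simp: paths_Cons_Cons paths_0)

lemma edgesE:
  assumes "p \<in> paths V adj (Suc 0)"
  obtains u v where "p = [u, v]" "u \<in> V" "v \<in> V" "adj u v"
  using assms by (rule paths_SucE) (auto simp: paths_0 that)

lemma finite_paths: "finite V \<Longrightarrow> finite (paths V adj n)"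
  by (rule finite_subset[OF _ finite_lists_length_eq[of V "Suc n"]]) (auto simp: paths_def)

lemma paths_split:
  assumes "p \<in> paths V adj (Suc n)"
  shows "take 2 p \<in> paths V adj (Suc 0)" "tl p \<in> paths V adj n" "hd (take 2 p) = hd p"
    "last (take 2 p) = hd (tl p)" "last (tl p) = last p" "take 2 p @ tl (tl p) = p"
proof -
  obtain u v q where p: "p = u # v # q" "u \<in> V" "adj u v" "v # q \<in> paths V adj n"
    using assms by (rule paths_SucE)
  moreover have "v \<in> V" using paths_hd[OF p(4)] by simp
  ultimately show "take 2 p \<in> paths V adj (Suc 0)" "tl p \<in> paths V adj n" "hd (take 2 p) = hd p"
    "last (take 2 p) = hd (tl p)" "last (tl p) = last p" "take 2 p @ tl (tl p) = p"
    by (auto simp: edges_iff)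
qed

lemma paths_join:
  assumes "a \<in> paths V adj (Suc 0)" "b \<in> paths V adj n" "last a = hd b"
  shows "hd a # b \<in> paths V adj (Suc n)" "hd a # take (Suc 0) b = a"
proof -
  obtain u v where "a = [u, v]" "u \<in> V" "adj u v" using assms(1) by (rule edgesE)
  moreover from this obtain q where "b = v # q" using assms(2,3) by (cases b) (auto simp: paths_Nil)
  ultimately show "hd a # b \<in> paths V adj (Suc n)" "hd a # take (Suc 0) b = a"
    using assms(2) by (auto simp: paths_Cons_Cons)
qed

lemma paths_rev:
  assumes "\<And>u v. u \<in> V \<Longrightarrow> v \<in> V \<Longrightarrow> adj u v \<Longrightarrow> adj v u" "p \<in> paths V adj n"
  shows "rev p \<in> paths V adj n"
proof -
  have V: "p ! j \<in> V" if "j \<le> n" for j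
    using assms(2) that nth_mem[of j p] by (auto simp: paths_def)
  have "adj (rev p ! i) (rev p ! Suc i)" if "i < n" for i
  proof -
    have "adj (p ! (n - Suc i)) (p ! Suc (n - Suc i))"
      using assms(2) that by (auto simp: paths_def)
    then have "adj (p ! Suc (n - Suc i)) (p ! (n - Suc i))"
      using that by (rule_tac assms(1)) (auto intro: V)
    moreover have "Suc (n - Suc i) = n - i" using that by simp
    ultimately show ?thesis using assms(2) that by (simp add: rev_nth paths_def)
  qed
  then show ?thesis using assms(2) by (simp add: paths_def)
qed

text \<open>A path is the same as an edge followed by a composable path. Composability is kept as a
  condition on the summand, so that the two sums run over independent ranges and can be
  interchanged.\<close>

lemma sum_paths_Suc:
  fixes f :: "'v list \<Rightarrow> 'v list \<Rightarrow> 'b :: comm_monoid_add"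
  assumes "finite V"
  shows "(\<Sum>p\<in>paths V adj (Suc n). f (take 2 p) (tl p)) =
    (\<Sum>a\<in>paths V adj (Suc 0). \<Sum>b\<in>paths V adj n. if last a = hd b then f a b else 0)"
proof -
  let ?S = "{z \<in> paths V adj (Suc 0) \<times> paths V adj n. last (fst z) = hd (snd z)}"
  have "(\<Sum>p\<in>paths V adj (Suc n). f (take 2 p) (tl p)) = (\<Sum>z\<in>?S. f (fst z) (snd z))"
    by (rule sum.reindex_bij_witness[of _ "\<lambda>z. hd (fst z) # snd z" "\<lambda>p. (take 2 p, tl p)"])
      (auto simp: paths_split paths_join elim: paths_SucE)
  also have "\<dots> = (\<Sum>z\<in>paths V adj (Suc 0) \<times> paths V adj n.
      if last (fst z) = hd (snd z) then f (fst z) (snd z) else 0)"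
    by (rule sum.inter_filter) (simp add: finite_paths assms)
  finally show ?thesis by (simp add: sum.cartesian_product split_beta)
qed

text \<open>For removing a fixed first edge in an induction along paths: if the tail function sees
  only tails that start at \<open>v\<close>, prepending \<open>u\<close> loses no term.\<close>

lemma sum_paths_Cons:
  fixes g :: "'v list \<Rightarrow> 'b :: comm_monoid_add"
  assumes "finite V" "u \<in> V" "adj u v" and hd: "\<And>q. q \<in> paths V adj n \<Longrightarrow> g q \<noteq> 0 \<Longrightarrow> hd q = v"
  shows "(\<Sum>p\<in>paths V adj (Suc n). if hd p = u then g (tl p) else 0) = (\<Sum>q\<in>paths V adj n. g q)"
proof -
  have "(\<Sum>q\<in>paths V adj n. g q) = (\<Sum>q\<in>{q \<in> paths V adj n. hd q = v}. g q)"
    using assms by (intro sum.mono_neutral_right) (auto simp: finite_paths)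
  also have "\<dots> = (\<Sum>p\<in>{p \<in> paths V adj (Suc n). hd p = u \<and> hd (tl p) = v}. g (tl p))"
  proof (rule sum.reindex_bij_witness[of _ tl "Cons u"])
    fix q assume "q \<in> {q \<in> paths V adj n. hd q = v}"
    then show "u # q \<in> {p \<in> paths V adj (Suc n). hd p = u \<and> hd (tl p) = v}"
      using assms by (cases q) (auto simp: paths_Cons_Cons paths_Nil)
  qed (auto elim!: paths_SucE)
  also have "\<dots> = (\<Sum>p\<in>paths V adj (Suc n). if hd p = u then g (tl p) else 0)"
    using assms paths_split(2)[of _ V adj n]
    by (intro sum.mono_neutral_cong_left) (auto simp: finite_paths)
  finally show ?thesis ..
qed

section \<open>The operators c_k on elementary paths\<close>

lemma c_path_Suc_0:
  "c_path \<mu> (Suc 0) (a # b # c # x) =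
    (if a = c then cscale (complex_of_real (sqrt (\<mu> b / \<mu> c))) (basis_vec (c # x)) else 0)"
  by (simp add: c_path_def)

text \<open>Reduces every position to the first one. The bound \<open>k \<ge> 1\<close> keeps the
  index \<open>k - 1\<close> in \<open>c_path\<close> from being truncated at 0.\<close>

lemma coef_c_path_Cons:
  assumes "k \<ge> 1"
  shows "coef (c_path \<mu> (Suc k) (a # x)) (a' # x') = (if a = a' then coef (c_path \<mu> k x) x' else 0)"
proof -
  obtain j where "k = Suc j" using assms by (cases k) auto
  moreover have "length (a # x) - 1 > Suc k \<longleftrightarrow> length x - 1 > k" by (cases x) auto
  ultimately show ?thesis
    by (simp add: c_path_def lookup_single when_def)
qed

lemma coef_c_path_hd:
  assumes "k \<ge> 1" "coef (c_path \<mu> k x) x' \<noteq> 0"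
  shows "hd x' = hd x"
  using assms by (cases x; cases k) (auto simp: c_path_def lookup_single when_def split: if_splits)

lemma coef_c_path_paths:
  assumes "p \<in> paths V adj (Suc (Suc n))" "k \<ge> 1" "coef (c_path \<mu> k p) q \<noteq> 0"
  shows "q \<in> paths V adj n"
  using assms
proof (induction k arbitrary: p q n)
  case (Suc k)
  obtain a b c x where p: "p = a # b # c # x" "a \<in> V" "adj a b" "b # c # x \<in> paths V adj (Suc n)"
    using Suc.prems(1) by (metis paths_SucE list.inject)
  show ?case
  proof (cases "k = 0")
    case True
    then show ?thesis using Suc.prems p
      by (auto simp: c_path_Suc_0 lookup_single when_def paths_Cons_Cons split: if_splits)
  next
    \<comment> \<open>Past the first position the second vertex \<open>b\<close> survives as well,
      so the edge from \<open>a\<close> to \<open>b\<close> still attaches to the shortened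
      tail.\<close>
    case False
    have "length p - 1 > Suc k" "q \<noteq> []"
      using Suc.prems by (auto simp: c_path_def lookup_single when_def p split: if_splits)
    then obtain m a' x' where n: "n = Suc m" and q: "q = a' # x'"
      using False Suc.prems(1) by (cases n; cases q) (auto simp: paths_def)
    have "a' = a" and nz: "coef (c_path \<mu> k (b # c # x)) x' \<noteq> 0"
      using Suc.prems(3) False unfolding p(1) q by (auto simp: coef_c_path_Cons split: if_splits)
    have "x' \<in> paths V adj m"
      using Suc.IH[OF _ _ nz] p(4) n False by simp
    moreover have "hd x' = b" using coef_c_path_hd[OF _ nz] False by simp
    ultimately show ?thesis
      using p n q \<open>a' = a\<close> by (cases x') (auto simp: paths_Cons_Cons paths_Nil)
  qed
qed simp

lemma tensor_basis_vec: "tensor (basis_vec a) (basis_vec b) = basis_vec (a, b)"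
  by (rule poly_mapping_eqI) (auto simp: lookup_single when_def split_paired_all)

section \<open>The fundamental representations\<close>

text \<open>Positivity of \<mu> lets the square roots in the reflection factors and in c_k cancel;
  symmetry of adjacency makes reversed paths available for reflection.\<close>

locale graph_dta = double_triangle_algebra V adj \<mu> mul one star F \<Phi>
  for V :: "'v set" and adj \<mu> mul one star and F :: "'f set" and \<Phi> +
  assumes finite_V: "finite V"
    and adj_sym: "u \<in> V \<Longrightarrow> v \<in> V \<Longrightarrow> adj u v \<Longrightarrow> adj v u"
    and \<mu>_pos: "v \<in> V \<Longrightarrow> \<mu> v > 0"
begin

lemma fundamental_ends:
  assumes "\<Phi> f \<alpha> \<beta> (basis_vec (\<xi>, \<xi>')) \<noteq> 0"
    and "f \<in> F" "\<alpha> \<in> edges V adj" "\<beta> \<in> edges V adj" "\<xi> \<in> paths V adj n" "\<xi>' \<in> paths V adj n"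
  shows "hd \<alpha> = hd \<xi>" "last \<alpha> = hd \<xi>'" "hd \<beta> = last \<xi>" "last \<beta> = last \<xi>'"
  using support[OF assms(2-6)] assms(1) by blast+

text \<open>By the support condition only the edge joining the two cut points contributes, so the
  single term of the concatenation rule is a full matrix product. In this form it combines with the
  sums in tensor products.\<close>

lemma fundamental_concat:
  assumes "f \<in> F" "\<alpha> \<in> edges V adj" "\<beta> \<in> edges V adj"
    and \<xi>: "\<xi>\<^sub>1 \<in> paths V adj n" "\<xi>\<^sub>2 \<in> paths V adj m" "last \<xi>\<^sub>1 = hd \<xi>\<^sub>2"
    and \<xi>': "\<xi>\<^sub>1' \<in> paths V adj n" "\<xi>\<^sub>2' \<in> paths V adj m" "last \<xi>\<^sub>1' = hd \<xi>\<^sub>2'"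
  shows "\<Phi> f \<alpha> \<beta> (basis_vec (\<xi>\<^sub>1 @ tl \<xi>\<^sub>2, \<xi>\<^sub>1' @ tl \<xi>\<^sub>2')) =
    (\<Sum>\<gamma>\<in>edges V adj. \<Phi> f \<alpha> \<gamma> (basis_vec (\<xi>\<^sub>1, \<xi>\<^sub>1')) * \<Phi> f \<gamma> \<beta> (basis_vec (\<xi>\<^sub>2, \<xi>\<^sub>2')))"
proof -
  let ?g = "[last \<xi>\<^sub>1, last \<xi>\<^sub>1']"
  let ?t = "\<lambda>\<gamma>. \<Phi> f \<alpha> \<gamma> (basis_vec (\<xi>\<^sub>1, \<xi>\<^sub>1')) * \<Phi> f \<gamma> \<beta> (basis_vec (\<xi>\<^sub>2, \<xi>\<^sub>2'))"
  have "?t \<gamma> = 0" if "\<gamma> \<in> edges V adj" "\<gamma> \<noteq> ?g" for \<gamma>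
    using fundamental_ends(3,4)[OF _ assms(1,2) that(1) \<xi>(1) \<xi>'(1)] that
    by (cases "\<Phi> f \<alpha> \<gamma> (basis_vec (\<xi>\<^sub>1, \<xi>\<^sub>1')) = 0") (auto elim!: edgesE)
  then have "(\<Sum>\<gamma>\<in>edges V adj. ?t \<gamma>) = (\<Sum>\<gamma>\<in>edges V adj. if \<gamma> = ?g then ?t ?g else 0)"
    by (intro sum.cong refl) auto
  also have "\<dots> = (if adj (last \<xi>\<^sub>1) (last \<xi>\<^sub>1') then ?t ?g else 0)"
    using \<xi>(1) \<xi>'(1) by (simp add: finite_paths finite_V edges_iff paths_last)
  finally show ?thesis
    using concatenation[OF assms(1-3) \<xi>(1) \<xi>'(1) \<xi>(2) \<xi>'(2)] \<xi>(3) \<xi>'(3)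
    by (simp add: concat_path_def tensor_basis_vec)
qed

text \<open>One reflection after the other: the conjugations cancel and the two factors are
  reciprocal, which leaves an identity without conjugates or weights.\<close>

lemma fundamental_flip:
  assumes "f \<in> F" "\<alpha> \<in> edges V adj" "\<beta> \<in> edges V adj" "\<xi> \<in> paths V adj n" "\<xi>' \<in> paths V adj n"
  shows "\<Phi> f \<alpha> \<beta> (basis_vec (\<xi>, \<xi>')) = \<Phi> f (rev \<beta>) (rev \<alpha>) (basis_vec (rev \<xi>', rev \<xi>))"
proof -
  define c where "c = sqrt (\<mu> (last \<xi>) * \<mu> (hd \<xi>') / (\<mu> (hd \<xi>) * \<mu> (last \<xi>')))"
  have rev: "rev \<alpha> \<in> edges V adj" "rev \<beta> \<in> edges V adj" "rev \<xi> \<in> paths V adj n" "rev \<xi>' \<in> paths V adj n"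
    using assms by (auto intro: paths_rev[OF adj_sym])
  have ends: "last (rev \<xi>) = hd \<xi>" "hd (rev \<xi>) = last \<xi>" "last (rev \<xi>') = hd \<xi>'" "hd (rev \<xi>') = last \<xi>'"
    by (auto simp: last_rev hd_rev)
  define c' where "c' = sqrt (\<mu> (hd \<xi>) * \<mu> (last \<xi>') / (\<mu> (last \<xi>) * \<mu> (hd \<xi>')))"
  have "\<Phi> f \<alpha> \<beta> (basis_vec (\<xi>, \<xi>')) = complex_of_real c * cnj (\<Phi> f \<beta> \<alpha> (basis_vec (rev \<xi>, rev \<xi>')))"
    using reflection[OF assms c_def] by simp
  also have "\<Phi> f \<beta> \<alpha> (basis_vec (rev \<xi>, rev \<xi>')) =
      complex_of_real c' * cnj (\<Phi> f (rev \<beta>) (rev \<alpha>) (basis_vec (rev \<xi>', rev \<xi>)))"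
    by (rule conjunct2[OF reflection[OF assms(1,3,2) rev(3,4)]]) (simp add: c'_def ends)
  also have "complex_of_real c * cnj (complex_of_real c' * cnj (\<Phi> f (rev \<beta>) (rev \<alpha>) (basis_vec (rev \<xi>', rev \<xi>)))) =
      complex_of_real (c * c') * \<Phi> f (rev \<beta>) (rev \<alpha>) (basis_vec (rev \<xi>', rev \<xi>))"
    by simp
  also have "c * c' = 1"
  proof -
    have "\<mu> (last \<xi>) > 0" "\<mu> (hd \<xi>) > 0" "\<mu> (last \<xi>') > 0" "\<mu> (hd \<xi>') > 0"
      using assms by (auto intro: \<mu>_pos paths_hd paths_last)
    then show ?thesis
      unfolding c_def c'_def real_sqrt_mult[symmetric] by simp
  qed
  finally show ?thesis by simp
qed

text \<open>Row \<open>p\<close> stands for \<alpha> \<star> \<xi>' and column \<open>q\<close> for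
  \<xi> \<star> \<beta>. With \<xi>, \<xi>' edges both run over the paths of length 2, so the matrix
  is square and orthonormal columns force orthonormal rows.\<close>

lemma fundamental_coisometry:
  assumes f: "f \<in> F" and p: "p \<in> paths V adj 2" "p' \<in> paths V adj 2"
  shows "(\<Sum>q\<in>paths V adj 2. \<Phi> f (take 2 p) (tl q) (basis_vec (take 2 q, tl p)) *
      cnj (\<Phi> f (take 2 p') (tl q) (basis_vec (take 2 q, tl p')))) = (if p = p' then 1 else 0)"
proof (rule isometry_imp_coisometry[OF _ _ p])
  show "finite (paths V adj 2)" by (simp add: finite_paths finite_V)
  fix q q' assume "q \<in> paths V adj 2" "q' \<in> paths V adj 2"
  then have q: "q \<in> paths V adj (Suc 1)" "q' \<in> paths V adj (Suc 1)" by (simp_all add: numeral_2_eq_2)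
  note s = paths_split[OF q(1)] and s' = paths_split[OF q(2)]
  let ?t = "\<lambda>\<alpha> \<xi>. cnj (\<Phi> f \<alpha> (tl q) (basis_vec (take 2 q, \<xi>))) * \<Phi> f \<alpha> (tl q') (basis_vec (take 2 q', \<xi>))"
  have "(\<Sum>p\<in>paths V adj 2. ?t (take 2 p) (tl p)) = (\<Sum>p\<in>paths V adj (Suc 1). ?t (take 2 p) (tl p))"
    by (simp add: numeral_2_eq_2)
  also have "\<dots> = (\<Sum>\<alpha>\<in>edges V adj. \<Sum>\<xi>\<in>paths V adj 1. if last \<alpha> = hd \<xi> then ?t \<alpha> \<xi> else 0)"
    using sum_paths_Suc[OF finite_V, of ?t adj 1] by simp
  \<comment> \<open>Pairs that do not compose contribute 0 by support, so the sum over rows is the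
    unrestricted sum of the unitarity condition.\<close>
  also have "\<dots> = (\<Sum>\<alpha>\<in>edges V adj. \<Sum>\<xi>\<in>paths V adj 1. ?t \<alpha> \<xi>)"
  proof (intro sum.cong refl)
    fix \<alpha> \<xi> assume "\<alpha> \<in> edges V adj" "\<xi> \<in> paths V adj 1"
    then show "(if last \<alpha> = hd \<xi> then ?t \<alpha> \<xi> else 0) = ?t \<alpha> \<xi>"
      using support[OF f, of \<alpha> "tl q" "take 2 q" 1 \<xi>] s by auto
  qed
  also have "\<dots> = (if tl q = tl q' \<and> take 2 q = take 2 q' then 1 else 0)"
    using s s' by (intro unitarity[OF f]) auto
  also have "tl q = tl q' \<and> take 2 q = take 2 q' \<longleftrightarrow> q = q'"
    using s(6) s'(6) by metis
  finally show "(\<Sum>p\<in>paths V adj 2. ?t (take 2 p) (tl p)) = (if q = q' then 1 else 0)" .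
qed

text \<open>Both reflections turn the second factor of the concatenation into the entry of the
  unitary matrix at the same column as the conjugate of the first one, so the sum over \<open>w\<close> is
  an inner product of two rows.\<close>

lemma fundamental_cup:
  assumes f: "f \<in> F" and \<alpha>: "\<alpha> \<in> edges V adj" and \<beta>: "\<beta> \<in> edges V adj"
    and p: "[a, b, c] \<in> paths V adj 2" and e: "e \<in> V"
  shows "(\<Sum>w\<in>{w\<in>V. adj e w}. \<Phi> f \<alpha> \<beta> (basis_vec ([a, b, c], [e, w, e])) * complex_of_real (sqrt (\<mu> w / \<mu> e))) =
    (if a = c then complex_of_real (sqrt (\<mu> b / \<mu> c)) * \<Phi> f \<alpha> \<beta> (basis_vec ([c], [e])) else 0)"
    (is "?L = ?R")
proof (cases "\<alpha> = [a, e] \<and> \<beta> = [c, e]")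
  \<comment> \<open>For other matrix indices the endpoints do not fit, and both sides vanish by
    support.\<close>
  case False
  have abc: "a \<in> V" "b \<in> V" "c \<in> V" "adj a b" "adj b c"
    using p by (auto simp: numeral_2_eq_2 paths_Cons_Cons paths_0)
  have "\<not> (hd \<alpha> = a \<and> last \<alpha> = e \<and> hd \<beta> = c \<and> last \<beta> = e)"
    using False \<alpha> \<beta> by (auto elim!: edgesE)
  then have "\<Phi> f \<alpha> \<beta> (basis_vec ([a, b, c], [e, w, e])) = 0" if "w \<in> V" "adj e w" for w
    using that p e by (intro support[OF f \<alpha> \<beta> p])
      (auto simp: numeral_2_eq_2 paths_Cons_Cons paths_0 intro: adj_sym)
  moreover have "\<Phi> f \<alpha> \<beta> (basis_vec ([c], [e])) = 0" if "a = c"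
    using False \<alpha> \<beta> abc e that by (intro support[OF f \<alpha> \<beta>, of _ 0]) (auto simp: paths_0 elim!: edgesE)
  ultimately show ?thesis by simp
next
  case True
  then have \<alpha>e: "\<alpha> = [a, e]" and \<beta>e: "\<beta> = [c, e]" by auto
  have abc: "a \<in> V" "b \<in> V" "c \<in> V" "adj a b" "adj b c"
    using p by (auto simp: numeral_2_eq_2 paths_Cons_Cons paths_0)
  have ae: "adj a e" "adj e a" "adj c e" "adj e c"
    using \<alpha> \<beta> abc e adj_sym by (auto simp: \<alpha>e \<beta>e edges_iff)
  have ba: "adj b a" "adj c b" using abc adj_sym by auto
  let ?U = "\<lambda>x w. \<Phi> f [e, x] [w, b] (basis_vec ([e, w], [x, b]))"
  \<comment> \<open>The path is cut at the tips b and w. The second factor is flipped, the first is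
    reflected, and its factor sqrt(\<mu> b \<mu> e / (\<mu> a \<mu> w)) loses its dependence on w
    against the weight sqrt(\<mu> w / \<mu> e).\<close>
  have summand: "\<Phi> f \<alpha> \<beta> (basis_vec ([a, b, c], [e, w, e])) * complex_of_real (sqrt (\<mu> w / \<mu> e)) =
      complex_of_real (sqrt (\<mu> b / \<mu> a)) * (if adj w b then ?U c w * cnj (?U a w) else 0)"
    if w: "w \<in> V" "adj e w" for w
  proof -
    have we: "adj w e" using w e adj_sym by auto
    have "\<Phi> f \<alpha> \<beta> (basis_vec ([a, b, c], [e, w, e])) =
      (if adj b w then \<Phi> f \<alpha> [b, w] (basis_vec ([a, b], [e, w])) * \<Phi> f [b, w] \<beta> (basis_vec ([b, c], [w, e])) else 0)"
      using concatenation[OF f \<alpha> \<beta>, of "[a, b]" 1 "[e, w]" "[b, c]" 1 "[w, e]"] abc e w we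
      by (simp add: edges_iff concat_path_def tensor_basis_vec)
    moreover have "adj b w \<longleftrightarrow> adj w b" using abc w adj_sym by auto
    moreover have "\<Phi> f [b, w] \<beta> (basis_vec ([b, c], [w, e])) = ?U c w" if "adj b w"
      using fundamental_flip[OF f _ \<beta>, of "[b, w]" "[b, c]" 1 "[w, e]"] that abc e w we
      by (simp add: edges_iff \<beta>e)
    moreover have "\<Phi> f \<alpha> [b, w] (basis_vec ([a, b], [e, w])) =
        complex_of_real (sqrt (\<mu> b * \<mu> e / (\<mu> a * \<mu> w))) * cnj (?U a w)" if "adj b w"
      using conjunct2[OF reflection[OF f \<alpha> _ _ _ refl, of "[b, w]" "[a, b]" 1 "[e, w]"]] that abc e w
      by (simp add: edges_iff \<alpha>e)
    moreover have "sqrt (\<mu> b * \<mu> e / (\<mu> a * \<mu> w)) * sqrt (\<mu> w / \<mu> e) = sqrt (\<mu> b / \<mu> a)"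
      using \<mu>_pos[OF e] \<mu>_pos[OF w(1)] unfolding real_sqrt_mult[symmetric] by simp
    ultimately show ?thesis
      by (simp add: mult_ac flip: of_real_mult)
  qed
  \<comment> \<open>The inner product of the rows [e,c,b] and [e,a,b]: columns not of the form
    [e,w,b] vanish by support. The rows coincide exactly when a = c, which is the delta in
    c_k.\<close>
  have "(\<Sum>w\<in>{w\<in>V. adj e w}. if adj w b then ?U c w * cnj (?U a w) else 0) =
    (\<Sum>q\<in>paths V adj 2. \<Phi> f (take 2 [e, c, b]) (tl q) (basis_vec (take 2 q, tl [e, c, b])) *
      cnj (\<Phi> f (take 2 [e, a, b]) (tl q) (basis_vec (take 2 q, tl [e, a, b]))))"
    (is "_ = (\<Sum>q\<in>_. ?V q)")
  proof -
    have "(\<Sum>q\<in>paths V adj 2. ?V q) = (\<Sum>q\<in>{[e, w, b] | w. w \<in> V \<and> adj e w \<and> adj w b}. ?V q)"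
    proof (rule sum.mono_neutral_right)
      show "finite (paths V adj 2)" by (simp add: finite_paths finite_V)
      show "{[e, w, b] | w. w \<in> V \<and> adj e w \<and> adj w b} \<subseteq> paths V adj 2"
        using e abc by (auto simp: numeral_2_eq_2 paths_Cons_Cons paths_0)
      show "\<forall>q\<in>paths V adj 2 - {[e, w, b] | w. w \<in> V \<and> adj e w \<and> adj w b}. ?V q = 0"
      proof
        fix q assume q: "q \<in> paths V adj 2 - {[e, w, b] | w. w \<in> V \<and> adj e w \<and> adj w b}"
        then obtain x y z where xyz: "q = [x, y, z]" "x \<in> V" "y \<in> V" "z \<in> V" "adj x y" "adj y z"
          by (auto simp: numeral_2_eq_2 paths_0 elim!: paths_SucE)
        then have "\<not> (x = e \<and> z = b)" using q by auto
        then show "?V q = 0"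
          using support[OF f, of "[e, c]" "[y, z]" "[x, y]" 1 "[c, b]"] xyz abc ae ba e
          by (auto simp: edges_iff)
      qed
    qed
    also have "\<dots> = (\<Sum>w\<in>{w \<in> V. adj e w \<and> adj w b}. ?V [e, w, b])"
      by (rule sum.reindex_bij_witness[of _ "\<lambda>w. [e, w, b]" "\<lambda>q. q ! 1"]) auto
    also have "\<dots> = (\<Sum>w\<in>{w\<in>V. adj e w}. if adj w b then ?U c w * cnj (?U a w) else 0)"
      using finite_V by (intro sum.mono_neutral_cong_left) auto
    finally show ?thesis ..
  qed
  also have "\<dots> = (if [e, c, b] = [e, a, b] then 1 else 0)"
    using abc e ae ba
    by (intro fundamental_coisometry[OF f]) (auto simp: numeral_2_eq_2 paths_Cons_Cons paths_0)
  finally have "?L = complex_of_real (sqrt (\<mu> b / \<mu> a)) * (if c = a then 1 else 0)"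
    by (simp add: summand flip: sum_distrib_left)
  moreover have "\<Phi> f \<alpha> \<beta> (basis_vec ([c], [e])) = 1" if "a = c"
    using length_zero[OF f \<alpha>, of c e] abc e that by (simp add: \<alpha>e \<beta>e)
  ultimately show ?thesis by auto
qed

end

section \<open>The relation with c_k along paths of any length\<close>

context graph_dta
begin

lemma fundamental_split:
  assumes "f \<in> F" "\<alpha> \<in> edges V adj" "\<beta> \<in> edges V adj"
    and "\<xi> \<in> paths V adj (Suc n)" "\<xi>' \<in> paths V adj (Suc n)"
  shows "\<Phi> f \<alpha> \<beta> (basis_vec (\<xi>, \<xi>')) =
    (\<Sum>\<gamma>\<in>edges V adj. \<Phi> f \<alpha> \<gamma> (basis_vec (take 2 \<xi>, take 2 \<xi>')) * \<Phi> f \<gamma> \<beta> (basis_vec (tl \<xi>, tl \<xi>')))"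
  using fundamental_concat[OF assms(1-3) paths_split(1,2,4)[OF assms(4)] paths_split(1,2,4)[OF assms(5)]]
  unfolding paths_split(6)[OF assms(4)] paths_split(6)[OF assms(5)] .

text \<open>The transpose of c_1 puts a detour e, w in front of \<eta>. Cutting both paths after two
  edges isolates this detour as [e,w,e], where \<open>fundamental_cup\<close> applies.\<close>

lemma fundamental_c_path_1:
  assumes f: "f \<in> F" "\<alpha> \<in> edges V adj" "\<beta> \<in> edges V adj"
    and \<xi>: "\<xi> \<in> paths V adj (Suc (Suc n))" and \<eta>: "\<eta> \<in> paths V adj n"
  shows "(\<Sum>\<zeta>\<in>paths V adj (Suc (Suc n)). \<Phi> f \<alpha> \<beta> (basis_vec (\<xi>, \<zeta>)) * coef (c_path \<mu> (Suc 0) \<zeta>) \<eta>) =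
    (\<Sum>\<rho>\<in>paths V adj n. coef (c_path \<mu> (Suc 0) \<xi>) \<rho> * \<Phi> f \<alpha> \<beta> (basis_vec (\<rho>, \<eta>)))"
proof -
  obtain a b q where q: "\<xi> = a # b # q" "a \<in> V" "adj a b" "b # q \<in> paths V adj (Suc n)"
    using \<xi> by (rule paths_SucE)
  obtain c x where cx: "q = c # x" "b \<in> V" "adj b c" "c # x \<in> paths V adj n"
    using q(4) by (rule paths_SucE) auto
  note \<xi>_eq = q(1)[unfolded cx(1)]
  have c: "c \<in> V" using paths_hd[OF cx(4)] by simp
  obtain e y where \<eta>_eq: "\<eta> = e # y" using \<eta> by (cases \<eta>) (auto simp: paths_Nil)
  have e: "e \<in> V" using paths_hd[OF \<eta>] \<eta>_eq by simp
  let ?h = "\<lambda>\<zeta>. \<Phi> f \<alpha> \<beta> (basis_vec (\<xi>, \<zeta>))"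
  let ?s = "\<lambda>u v. complex_of_real (sqrt (\<mu> u / \<mu> v))"
  let ?Z = "{e # w # \<eta> | w. w \<in> V \<and> adj e w}"
  have "(\<Sum>\<zeta>\<in>paths V adj (Suc (Suc n)). ?h \<zeta> * coef (c_path \<mu> (Suc 0) \<zeta>) \<eta>) =
      (\<Sum>\<zeta>\<in>?Z. ?h \<zeta> * coef (c_path \<mu> (Suc 0) \<zeta>) \<eta>)"
  proof (rule sum.mono_neutral_right)
    show "finite (paths V adj (Suc (Suc n)))" by (simp add: finite_paths finite_V)
    show "?Z \<subseteq> paths V adj (Suc (Suc n))"
      using \<eta> e adj_sym[OF e] by (auto simp: \<eta>_eq paths_Cons_Cons)
    show "\<forall>\<zeta>\<in>paths V adj (Suc (Suc n)) - ?Z. ?h \<zeta> * coef (c_path \<mu> (Suc 0) \<zeta>) \<eta> = 0"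
    proof
      fix \<zeta> assume \<zeta>: "\<zeta> \<in> paths V adj (Suc (Suc n)) - ?Z"
      then have "\<zeta> \<in> paths V adj (Suc (Suc n))" by simp
      then obtain u v r where r: "\<zeta> = u # v # r" "u \<in> V" "adj u v" "v # r \<in> paths V adj (Suc n)"
        by (rule paths_SucE)
      obtain w z where wz: "r = w # z" "v \<in> V" "adj v w"
        using r(4) by (rule paths_SucE) auto
      show "?h \<zeta> * coef (c_path \<mu> (Suc 0) \<zeta>) \<eta> = 0"
        using \<zeta> r wz by (auto simp: c_path_Suc_0 lookup_single when_def \<eta>_eq)
    qed
  qed
  also have "\<dots> = (\<Sum>w\<in>{w\<in>V. adj e w}. ?h (e # w # \<eta>) * ?s w e)"
    by (rule sum.reindex_bij_witness[of _ "\<lambda>w. e # w # \<eta>" "\<lambda>\<zeta>. \<zeta> ! 1"]) (auto simp: \<eta>_eq c_path_Suc_0)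
  also have "\<dots> = (\<Sum>w\<in>{w\<in>V. adj e w}. \<Sum>\<gamma>\<in>edges V adj.
      \<Phi> f \<alpha> \<gamma> (basis_vec ([a, b, c], [e, w, e])) * ?s w e * \<Phi> f \<gamma> \<beta> (basis_vec (c # x, \<eta>)))"
  proof (rule sum.cong[OF refl])
    fix w assume "w \<in> {w\<in>V. adj e w}"
    then have w: "w \<in> V" "adj e w" "adj w e" using e adj_sym by auto
    have "?h (e # w # \<eta>) = (\<Sum>\<gamma>\<in>edges V adj.
      \<Phi> f \<alpha> \<gamma> (basis_vec ([a, b, c], [e, w, e])) * \<Phi> f \<gamma> \<beta> (basis_vec (c # x, \<eta>)))"
      using fundamental_concat[OF f, of "[a, b, c]" 2 "c # x" n "[e, w, e]" \<eta>] q cx w e c \<eta>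
      by (simp add: \<eta>_eq numeral_2_eq_2 paths_Cons_Cons paths_0)
    then show "?h (e # w # \<eta>) * ?s w e = (\<Sum>\<gamma>\<in>edges V adj.
      \<Phi> f \<alpha> \<gamma> (basis_vec ([a, b, c], [e, w, e])) * ?s w e * \<Phi> f \<gamma> \<beta> (basis_vec (c # x, \<eta>)))"
      by (simp add: sum_distrib_left mult_ac)
  qed
  also have "\<dots> = (\<Sum>\<gamma>\<in>edges V adj. (\<Sum>w\<in>{w\<in>V. adj e w}.
      \<Phi> f \<alpha> \<gamma> (basis_vec ([a, b, c], [e, w, e])) * ?s w e) * \<Phi> f \<gamma> \<beta> (basis_vec (c # x, \<eta>)))"
    by (subst sum.swap) (simp only: sum_distrib_right)
  also have "\<dots> = (\<Sum>\<gamma>\<in>edges V adj.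
      (if a = c then ?s b c * \<Phi> f \<alpha> \<gamma> (basis_vec ([c], [e])) else 0) * \<Phi> f \<gamma> \<beta> (basis_vec (c # x, \<eta>)))"
    using q cx c
    by (intro sum.cong refl arg_cong2[of _ _ _ _ "(*)"] fundamental_cup f e)
      (auto simp: numeral_2_eq_2 paths_Cons_Cons paths_0)
  also have "\<dots> = (if a = c then ?s b c * (\<Sum>\<gamma>\<in>edges V adj.
      \<Phi> f \<alpha> \<gamma> (basis_vec ([c], [e])) * \<Phi> f \<gamma> \<beta> (basis_vec (c # x, \<eta>))) else 0)"
    by (simp add: sum_distrib_left mult.assoc)
  \<comment> \<open>The cup has left the vertices [c] and [e], and concatenation with a vertex
    changes nothing, so the sum over \<gamma> closes up again.\<close>
  also have "\<dots> = (if a = c then ?s b c * \<Phi> f \<alpha> \<beta> (basis_vec (c # x, \<eta>)) else 0)"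
    using fundamental_concat[OF f, of "[c]" 0 "c # x" n "[e]" \<eta>] cx c e \<eta>
    by (simp add: paths_0 \<eta>_eq)
  also have "\<dots> = (\<Sum>\<rho>\<in>paths V adj n. coef (c_path \<mu> (Suc 0) \<xi>) \<rho> * \<Phi> f \<alpha> \<beta> (basis_vec (\<rho>, \<eta>)))"
    using cx(4)
    by (simp add: \<xi>_eq c_path_Suc_0 lookup_single when_def mult_delta_left mult_delta_right
        finite_paths finite_V)
  finally show ?thesis .
qed

text \<open>Beyond the first position c_k does not touch the first edge. Splitting that edge off
  every path gives a common factor \<open>?T\<close> and lowers the position by one.\<close>

lemma fundamental_c_path:
  assumes f: "f \<in> F" "\<alpha> \<in> edges V adj" "\<beta> \<in> edges V adj"
    and \<xi>: "\<xi> \<in> paths V adj (Suc (Suc n))" and \<eta>: "\<eta> \<in> paths V adj n" and k: "k \<le> n"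
  shows "(\<Sum>\<zeta>\<in>paths V adj (Suc (Suc n)). \<Phi> f \<alpha> \<beta> (basis_vec (\<xi>, \<zeta>)) * coef (c_path \<mu> (Suc k) \<zeta>) \<eta>) =
    (\<Sum>\<rho>\<in>paths V adj n. coef (c_path \<mu> (Suc k) \<xi>) \<rho> * \<Phi> f \<alpha> \<beta> (basis_vec (\<rho>, \<eta>)))"
  using assms(2-)
proof (induction k arbitrary: n \<alpha> \<xi> \<eta>)
  case 0
  then show ?case using fundamental_c_path_1[OF f(1)] by simp
next
  case (Suc k)
  then obtain m where n: "n = Suc m" by (cases n) auto
  obtain a b x where \<xi>: "\<xi> = a # b # x" "a \<in> V" "adj a b" "b # x \<in> paths V adj (Suc (Suc m))"
    using Suc.prems(3) unfolding n by (rule paths_SucE)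
  obtain e v y where \<eta>: "\<eta> = e # v # y" "e \<in> V" "adj e v" "v # y \<in> paths V adj m"
    using Suc.prems(4) unfolding n by (rule paths_SucE)
  have v: "v \<in> V" using paths_hd[OF \<eta>(4)] by simp
  have b: "b \<in> V" using paths_hd[OF \<xi>(4)] by simp
  let ?C = "\<lambda>p q. coef (c_path \<mu> (Suc k) p) q"
  let ?T = "\<lambda>\<gamma>. \<Phi> f \<alpha> \<gamma> (basis_vec ([a, b], [e, v]))"
  let ?l = "\<lambda>z. (\<Sum>\<gamma>\<in>edges V adj. ?T \<gamma> * \<Phi> f \<gamma> \<beta> (basis_vec (b # x, z))) * ?C z (v # y)"
  let ?r = "\<lambda>z. ?C (b # x) z * (\<Sum>\<gamma>\<in>edges V adj. ?T \<gamma> * \<Phi> f \<gamma> \<beta> (basis_vec (z, v # y)))"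
  have "(\<Sum>\<zeta>\<in>paths V adj (Suc (Suc n)). \<Phi> f \<alpha> \<beta> (basis_vec (\<xi>, \<zeta>)) * coef (c_path \<mu> (Suc (Suc k)) \<zeta>) \<eta>) =
    (\<Sum>\<zeta>\<in>paths V adj (Suc (Suc (Suc m))). if hd \<zeta> = e then ?l (tl \<zeta>) else 0)"
    unfolding n
  proof (rule sum.cong[OF refl])
    fix \<zeta> assume \<zeta>: "\<zeta> \<in> paths V adj (Suc (Suc (Suc m)))"
    then obtain u w z where z: "\<zeta> = u # w # z" "u \<in> V" "adj u w" "w # z \<in> paths V adj (Suc (Suc m))"
      by (rule paths_SucE)
    have "w = v" if "?C (w # z) (v # y) \<noteq> 0"
      using coef_c_path_hd[OF _ that] by simp
    then show "\<Phi> f \<alpha> \<beta> (basis_vec (\<xi>, \<zeta>)) * coef (c_path \<mu> (Suc (Suc k)) \<zeta>) \<eta> =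
      (if hd \<zeta> = e then ?l (tl \<zeta>) else 0)"
      using fundamental_split[OF f(1) Suc.prems(1,2,3)[unfolded n] \<zeta>]
      by (cases "?C (w # z) (v # y) = 0") (auto simp: coef_c_path_Cons z(1) \<eta>(1) \<xi>(1))
  qed
  \<comment> \<open>Removing a backtrack preserves the initial vertex, so tails with a nonzero
    coefficient start at v and can be prolonged by e.\<close>
  also have "\<dots> = (\<Sum>z\<in>paths V adj (Suc (Suc m)). ?l z)"
    using \<eta> by (intro sum_paths_Cons[of _ _ _ v] finite_V) (auto dest!: coef_c_path_hd[rotated])
  also have "\<dots> = (\<Sum>\<gamma>\<in>edges V adj. ?T \<gamma> * (\<Sum>z\<in>paths V adj (Suc (Suc m)). \<Phi> f \<gamma> \<beta> (basis_vec (b # x, z)) * ?C z (v # y)))"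
    unfolding sum_distrib_left sum_distrib_right by (subst sum.swap) (simp only: mult.assoc)
  also have "\<dots> = (\<Sum>\<gamma>\<in>edges V adj. ?T \<gamma> * (\<Sum>z\<in>paths V adj m. ?C (b # x) z * \<Phi> f \<gamma> \<beta> (basis_vec (z, v # y))))"
    using Suc.prems(5) n by (intro sum.cong refl arg_cong2[of _ _ _ _ "(*)"] Suc.IH Suc.prems(2) \<xi>(4) \<eta>(4)) auto
  also have "\<dots> = (\<Sum>z\<in>paths V adj m. ?r z)"
    unfolding sum_distrib_left by (subst sum.swap) (simp only: mult_ac)
  also have "\<dots> = (\<Sum>\<rho>\<in>paths V adj (Suc m). if hd \<rho> = a then ?r (tl \<rho>) else 0)"
    using \<xi> by (intro sum_paths_Cons[of _ _ _ b, symmetric] finite_V) (auto dest!: coef_c_path_hd[rotated])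
  also have "\<dots> = (\<Sum>\<rho>\<in>paths V adj n. coef (c_path \<mu> (Suc (Suc k)) \<xi>) \<rho> * \<Phi> f \<alpha> \<beta> (basis_vec (\<rho>, \<eta>)))"
    unfolding n
  proof (rule sum.cong[OF refl])
    fix \<rho> assume \<rho>: "\<rho> \<in> paths V adj (Suc m)"
    then obtain u w z where z: "\<rho> = u # w # z" "u \<in> V" "adj u w" "w # z \<in> paths V adj m"
      by (rule paths_SucE)
    have "w = b" if "?C (b # x) (w # z) \<noteq> 0"
      using coef_c_path_hd[OF _ that] by simp
    then show "(if hd \<rho> = a then ?r (tl \<rho>) else 0) =
      coef (c_path \<mu> (Suc (Suc k)) \<xi>) \<rho> * \<Phi> f \<alpha> \<beta> (basis_vec (\<rho>, \<eta>))"
      using fundamental_split[OF f(1) Suc.prems(1,2) \<rho> Suc.prems(4)[unfolded n]]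
      by (cases "?C (b # x) (w # z) = 0") (auto simp: coef_c_path_Cons z(1) \<eta>(1) \<xi>(1))
  qed
  finally show ?case .
qed

end

section \<open>Tensor products of fundamental representations\<close>

context graph_dta
begin

lemma tensor_rep_elem_ends:
  assumes "tensor_rep_elem V adj \<Phi> fs p p' \<xi> \<xi>' \<noteq> 0" "set fs \<subseteq> F"
    and "p \<in> paths V adj (length fs)" "p' \<in> paths V adj (length fs)"
    and "\<xi> \<in> paths V adj n" "\<xi>' \<in> paths V adj n"
  shows "hd p = hd \<xi>" "last p = hd \<xi>'" "hd p' = last \<xi>" "last p' = last \<xi>'"
proof -
  have "hd p = hd \<xi> \<and> last p = hd \<xi>' \<and> hd p' = last \<xi> \<and> last p' = last \<xi>'"
    using assms
  proof (induction fs arbitrary: p p' \<xi> rule: induct_list012)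
    case (2 f)
    then show ?case
      using fundamental_ends[of f p p' \<xi> \<xi>' n] by simp
  next
    case (3 f g fs)
    have len: "length (f # g # fs) = Suc (length (g # fs))" by simp
    note p = paths_split[OF "3.prems"(3)[unfolded len]] and p' = paths_split[OF "3.prems"(4)[unfolded len]]
    obtain \<zeta> where \<zeta>: "\<zeta> \<in> paths V adj n"
      and nz: "\<Phi> f (take 2 p) (take 2 p') (basis_vec (\<xi>, \<zeta>)) \<noteq> 0"
        "tensor_rep_elem V adj \<Phi> (g # fs) (tl p) (tl p') \<zeta> \<xi>' \<noteq> 0"
      using "3.prems"(1,5) by (auto simp: paths_length elim!: sum.not_neutral_contains_not_neutral)
    have "hd (tl p) = hd \<zeta> \<and> last (tl p) = hd \<xi>' \<and> hd (tl p') = last \<zeta> \<and> last (tl p') = last \<xi>'"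
      using "3.prems" p p' \<zeta> nz by (intro "3.IH"(2)) auto
    then show ?case
      using fundamental_ends[OF nz(1), of n] "3.prems" p p' \<zeta> by auto
  qed simp
  then show "hd p = hd \<xi>" "last p = hd \<xi>'" "hd p' = last \<xi>" "last p' = last \<xi>'" by auto
qed

text \<open>For fixed matrix indices the entries form matrices P, Q in the pair of paths, and
  tensoring multiplies them. If C is the matrix of c_k, then P Q C = P C Q = C P Q.\<close>

lemma tensor_rep_elem_c_path:
  assumes "fs \<noteq> []" "set fs \<subseteq> F" "p \<in> paths V adj (length fs)" "p' \<in> paths V adj (length fs)"
    and "\<xi> \<in> paths V adj (Suc (Suc n))" "\<eta> \<in> paths V adj n" and k: "k \<le> n"
  shows "(\<Sum>\<zeta>\<in>paths V adj (Suc (Suc n)). tensor_rep_elem V adj \<Phi> fs p p' \<xi> \<zeta> * coef (c_path \<mu> (Suc k) \<zeta>) \<eta>) =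
    (\<Sum>\<rho>\<in>paths V adj n. coef (c_path \<mu> (Suc k) \<xi>) \<rho> * tensor_rep_elem V adj \<Phi> fs p p' \<rho> \<eta>)"
  using assms
proof (induction fs arbitrary: p p' \<xi> \<eta> rule: induct_list012)
  case (2 f)
  then show ?case
    using fundamental_c_path[of f p p' \<xi> n \<eta> k] by simp
next
  case (3 f g fs)
  have len: "length (f # g # fs) = Suc (length (g # fs))" by simp
  note p = paths_split[OF "3.prems"(3)[unfolded len]] and p' = paths_split[OF "3.prems"(4)[unfolded len]]
  let ?P = "\<lambda>\<xi> \<zeta>. \<Phi> f (take 2 p) (take 2 p') (basis_vec (\<xi>, \<zeta>))"
  let ?Q = "\<lambda>\<xi> \<zeta>. tensor_rep_elem V adj \<Phi> (g # fs) (tl p) (tl p') \<xi> \<zeta>"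
  let ?C = "\<lambda>\<xi> \<zeta>. coef (c_path \<mu> (Suc k) \<xi>) \<zeta>"
  let ?N = "paths V adj (Suc (Suc n))"
  have IH: "(\<Sum>\<zeta>\<in>?N. ?Q \<tau> \<zeta> * ?C \<zeta> \<eta>) = (\<Sum>\<rho>\<in>paths V adj n. ?C \<tau> \<rho> * ?Q \<rho> \<eta>)" if "\<tau> \<in> ?N" for \<tau>
    using that "3.prems" p p' by (intro "3.IH"(2)) auto
  have rel: "(\<Sum>\<zeta>\<in>?N. ?P \<xi> \<zeta> * ?C \<zeta> \<rho>) = (\<Sum>\<kappa>\<in>paths V adj n. ?C \<xi> \<kappa> * ?P \<kappa> \<rho>)"
    if "\<rho> \<in> paths V adj n" for \<rho>
    using that "3.prems" p p' by (intro fundamental_c_path) auto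
  have "(\<Sum>\<zeta>\<in>?N. tensor_rep_elem V adj \<Phi> (f # g # fs) p p' \<xi> \<zeta> * ?C \<zeta> \<eta>) =
      (\<Sum>\<zeta>\<in>?N. \<Sum>\<tau>\<in>?N. ?P \<xi> \<tau> * (?Q \<tau> \<zeta> * ?C \<zeta> \<eta>))"
    using paths_length[OF "3.prems"(5)] by (simp add: sum_distrib_right mult.assoc)
  also have "\<dots> = (\<Sum>\<tau>\<in>?N. ?P \<xi> \<tau> * (\<Sum>\<rho>\<in>paths V adj n. ?C \<tau> \<rho> * ?Q \<rho> \<eta>))"
    by (subst sum.swap) (simp add: IH flip: sum_distrib_left)
  also have "\<dots> = (\<Sum>\<rho>\<in>paths V adj n. (\<Sum>\<tau>\<in>?N. ?P \<xi> \<tau> * ?C \<tau> \<rho>) * ?Q \<rho> \<eta>)"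
    unfolding sum_distrib_left sum_distrib_right by (subst sum.swap) (simp only: mult.assoc)
  also have "\<dots> = (\<Sum>\<rho>\<in>paths V adj n. (\<Sum>\<kappa>\<in>paths V adj n. ?C \<xi> \<kappa> * ?P \<kappa> \<rho>) * ?Q \<rho> \<eta>)"
    by (intro sum.cong refl) (simp add: rel)
  also have "\<dots> = (\<Sum>\<kappa>\<in>paths V adj n. ?C \<xi> \<kappa> * (\<Sum>\<rho>\<in>paths V adj n. ?P \<kappa> \<rho> * ?Q \<rho> \<eta>))"
    unfolding sum_distrib_left sum_distrib_right by (subst sum.swap) (simp only: mult.assoc)
  also have "\<dots> = (\<Sum>\<kappa>\<in>paths V adj n. ?C \<xi> \<kappa> * tensor_rep_elem V adj \<Phi> (f # g # fs) p p' \<kappa> \<eta>)"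
    by (intro sum.cong refl) (simp add: paths_length)
  finally show ?case .
qed simp

text \<open>An interchange law: cutting paths into first edge and rest commutes with tensoring. The
  intermediate path splits into y and z, the intermediate index into \<gamma> and s, and the two
  double sums have the same terms.\<close>

lemma tensor_rep_elem_split:
  assumes "fs \<noteq> []" "set fs \<subseteq> F" "p \<in> paths V adj (length fs)" "p' \<in> paths V adj (length fs)"
    and "\<xi> \<in> paths V adj (Suc n)" "\<xi>' \<in> paths V adj (Suc n)"
  shows "tensor_rep_elem V adj \<Phi> fs p p' \<xi> \<xi>' =
    (\<Sum>q\<in>paths V adj (length fs). tensor_rep_elem V adj \<Phi> fs p q (take 2 \<xi>) (take 2 \<xi>') *
       tensor_rep_elem V adj \<Phi> fs q p' (tl \<xi>) (tl \<xi>'))"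
  using assms
proof (induction fs arbitrary: p p' \<xi> \<xi>' rule: induct_list012)
  case (2 f)
  then show ?case
    using fundamental_split[of f p p' \<xi> n \<xi>'] by simp
next
  case (3 f g fs)
  have len: "length (f # g # fs) = Suc (length (g # fs))" by simp
  note p = paths_split[OF "3.prems"(3)[unfolded len]] and p' = paths_split[OF "3.prems"(4)[unfolded len]]
  note \<xi> = paths_split[OF "3.prems"(5)] and \<xi>' = paths_split[OF "3.prems"(6)]
  have F: "f \<in> F" "set (g # fs) \<subseteq> F" using "3.prems"(2) by auto
  let ?e = "paths V adj (Suc 0)" and ?n = "paths V adj n" and ?m = "paths V adj (length (g # fs))"
  let ?P = "\<lambda>\<alpha> \<beta> \<xi> \<zeta>. \<Phi> f \<alpha> \<beta> (basis_vec (\<xi>, \<zeta>))"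
  let ?Q = "tensor_rep_elem V adj \<Phi> (g # fs)"
  let ?T = "\<lambda>\<gamma> s y z. ?P (take 2 p) \<gamma> (take 2 \<xi>) y * ?P \<gamma> (take 2 p') (tl \<xi>) z *
      (?Q (tl p) s y (take 2 \<xi>') * ?Q s (tl p') z (tl \<xi>'))"
  have "tensor_rep_elem V adj \<Phi> (f # g # fs) p p' \<xi> \<xi>' =
      (\<Sum>\<zeta>\<in>paths V adj (Suc n). ?P (take 2 p) (take 2 p') \<xi> \<zeta> * ?Q (tl p) (tl p') \<zeta> \<xi>')"
    using paths_length[OF "3.prems"(5)] by simp
  also have "\<dots> = (\<Sum>\<zeta>\<in>paths V adj (Suc n). \<Sum>\<gamma>\<in>?e. \<Sum>s\<in>?m. ?T \<gamma> s (take 2 \<zeta>) (tl \<zeta>))"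
  proof (rule sum.cong[OF refl])
    fix \<zeta> assume \<zeta>: "\<zeta> \<in> paths V adj (Suc n)"
    have "?P (take 2 p) (take 2 p') \<xi> \<zeta> =
      (\<Sum>\<gamma>\<in>?e. ?P (take 2 p) \<gamma> (take 2 \<xi>) (take 2 \<zeta>) * ?P \<gamma> (take 2 p') (tl \<xi>) (tl \<zeta>))"
      using fundamental_split[OF F(1) _ _ "3.prems"(5) \<zeta>, of "take 2 p" "take 2 p'"] p p' by simp
    moreover have "?Q (tl p) (tl p') \<zeta> \<xi>' =
      (\<Sum>s\<in>?m. ?Q (tl p) s (take 2 \<zeta>) (take 2 \<xi>') * ?Q s (tl p') (tl \<zeta>) (tl \<xi>'))"
      using F p p' \<zeta> "3.prems" by (intro "3.IH"(2)) auto
    ultimately show "?P (take 2 p) (take 2 p') \<xi> \<zeta> * ?Q (tl p) (tl p') \<zeta> \<xi>' =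
       (\<Sum>\<gamma>\<in>?e. \<Sum>s\<in>?m. ?T \<gamma> s (take 2 \<zeta>) (tl \<zeta>))"
      by (simp only: sum_product)
  qed
  also have "\<dots> = (\<Sum>y\<in>?e. \<Sum>z\<in>?n. if last y = hd z then (\<Sum>\<gamma>\<in>?e. \<Sum>s\<in>?m. ?T \<gamma> s y z) else 0)"
    by (rule sum_paths_Suc[OF finite_V])
  \<comment> \<open>In a nonzero term support identifies the end of y, the start of z, the end of
    \<gamma> and the start of s. Hence composability of y with z may be traded for that of \<gamma>
    with s.\<close>
  also have "\<dots> = (\<Sum>y\<in>?e. \<Sum>z\<in>?n. \<Sum>\<gamma>\<in>?e. \<Sum>s\<in>?m. if last \<gamma> = hd s then ?T \<gamma> s y z else 0)"
  proof (rule sum.cong[OF refl], rule sum.cong[OF refl])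
    fix y z assume yz: "y \<in> ?e" "z \<in> ?n"
    have "(if last y = hd z then ?T \<gamma> s y z else 0) = (if last \<gamma> = hd s then ?T \<gamma> s y z else 0)"
      if \<gamma>: "\<gamma> \<in> ?e" and s: "s \<in> ?m" for \<gamma> s
    proof (cases "?T \<gamma> s y z = 0")
      case False
      then have "last \<gamma> = last y" "last \<gamma> = hd z" "hd s = last y"
        using fundamental_ends[of f "take 2 p" \<gamma> "take 2 \<xi>" y "Suc 0"]
          fundamental_ends[of f \<gamma> "take 2 p'" "tl \<xi>" z n]
          tensor_rep_elem_ends[of "g # fs" "tl p" s y "take 2 \<xi>'" "Suc 0"]
          F yz \<gamma> s p p' \<xi> \<xi>'
        by auto
      then show ?thesis by simp
    qed simp
    then show "(if last y = hd z then (\<Sum>\<gamma>\<in>?e. \<Sum>s\<in>?m. ?T \<gamma> s y z) else 0) =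
        (\<Sum>\<gamma>\<in>?e. \<Sum>s\<in>?m. if last \<gamma> = hd s then ?T \<gamma> s y z else 0)"
      by (cases "last y = hd z") (simp_all cong: sum.cong)
  qed
  also have "\<dots> = (\<Sum>y\<in>?e. \<Sum>\<gamma>\<in>?e. \<Sum>z\<in>?n. \<Sum>s\<in>?m. if last \<gamma> = hd s then ?T \<gamma> s y z else 0)"
    by (rule sum.cong[OF refl]) (rule sum.swap)
  also have "\<dots> = (\<Sum>\<gamma>\<in>?e. \<Sum>y\<in>?e. \<Sum>z\<in>?n. \<Sum>s\<in>?m. if last \<gamma> = hd s then ?T \<gamma> s y z else 0)"
    by (rule sum.swap)
  also have "\<dots> = (\<Sum>\<gamma>\<in>?e. \<Sum>y\<in>?e. \<Sum>s\<in>?m. \<Sum>z\<in>?n. if last \<gamma> = hd s then ?T \<gamma> s y z else 0)"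
    by (rule sum.cong[OF refl], rule sum.cong[OF refl]) (rule sum.swap)
  also have "\<dots> = (\<Sum>\<gamma>\<in>?e. \<Sum>s\<in>?m. \<Sum>y\<in>?e. \<Sum>z\<in>?n. if last \<gamma> = hd s then ?T \<gamma> s y z else 0)"
    by (rule sum.cong[OF refl]) (rule sum.swap)
  also have "\<dots> = (\<Sum>\<gamma>\<in>?e. \<Sum>s\<in>?m. if last \<gamma> = hd s then (\<Sum>y\<in>?e. \<Sum>z\<in>?n. ?T \<gamma> s y z) else 0)"
    by (intro sum.cong refl) simp
  also have "\<dots> = (\<Sum>q\<in>paths V adj (Suc (length (g # fs))). \<Sum>y\<in>?e. \<Sum>z\<in>?n. ?T (take 2 q) (tl q) y z)"
    by (rule sum_paths_Suc[OF finite_V, symmetric])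
  also have "\<dots> = (\<Sum>q\<in>paths V adj (length (f # g # fs)).
      tensor_rep_elem V adj \<Phi> (f # g # fs) p q (take 2 \<xi>) (take 2 \<xi>') *
      tensor_rep_elem V adj \<Phi> (f # g # fs) q p' (tl \<xi>) (tl \<xi>'))"
    unfolding len
  proof (rule sum.cong[OF refl])
    fix q
    have "length (take 2 \<xi>) - 1 = Suc 0" "length (tl \<xi>) - 1 = n"
      using paths_length[OF \<xi>(1)] paths_length[OF \<xi>(2)] by auto
    then have "tensor_rep_elem V adj \<Phi> (f # g # fs) p q (take 2 \<xi>) (take 2 \<xi>') =
        (\<Sum>y\<in>?e. ?P (take 2 p) (take 2 q) (take 2 \<xi>) y * ?Q (tl p) (tl q) y (take 2 \<xi>'))"
      "tensor_rep_elem V adj \<Phi> (f # g # fs) q p' (tl \<xi>) (tl \<xi>') =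
        (\<Sum>z\<in>?n. ?P (take 2 q) (take 2 p') (tl \<xi>) z * ?Q (tl q) (tl p') z (tl \<xi>'))"
      by (simp_all only: tensor_rep_elem.simps)
    then show "(\<Sum>y\<in>?e. \<Sum>z\<in>?n. ?T (take 2 q) (tl q) y z) =
      tensor_rep_elem V adj \<Phi> (f # g # fs) p q (take 2 \<xi>) (take 2 \<xi>') *
      tensor_rep_elem V adj \<Phi> (f # g # fs) q p' (tl \<xi>) (tl \<xi>')"
      by (simp only: sum_product) (simp only: mult_ac)
  qed
  finally show ?case .
qed simp

end

section \<open>Irreducible representations on all paths\<close>

text \<open>Cancellation may shrink the support of a sum, so linearity is checked over a common
  finite superset of all supports involved.\<close>

lemma sum_keys_superset:
  assumes "finite K" "Poly_Mapping.keys a \<subseteq> K"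
  shows "(\<Sum>(p, p')\<in>Poly_Mapping.keys a. coef a (p, p') * h p p') = (\<Sum>(p, p')\<in>K. coef a (p, p') * h p p')"
  using assms by (intro sum.mono_neutral_left) (auto simp: in_keys_iff)

lemma ext_rep_add: "ext_rep d R i j (a + b) = ext_rep d R i j a + ext_rep d R i j b"
proof -
  let ?K = "Poly_Mapping.keys a \<union> Poly_Mapping.keys b \<union> Poly_Mapping.keys (a + b)"
  have "ext_rep d R i j c = (\<Sum>(p, p')\<in>?K. coef c (p, p') * ext_elem d R p p' i j)"
    if "c \<in> {a, b, a + b}" for c
    unfolding ext_rep_def using that by (intro sum_keys_superset) auto
  then show ?thesis
    by (simp add: lookup_add algebra_simps split_beta sum.distrib)
qed

lemma ext_rep_cscale: "ext_rep d R i j (cscale c a) = c * ext_rep d R i j a"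
proof -
  let ?K = "Poly_Mapping.keys a \<union> Poly_Mapping.keys (cscale c a)"
  have "ext_rep d R i j b = (\<Sum>(p, p')\<in>?K. coef b (p, p') * ext_elem d R p p' i j)"
    if "b \<in> {a, cscale c a}" for b
    unfolding ext_rep_def using that by (intro sum_keys_superset) auto
  then show ?thesis
    by (simp add: split_beta sum_distrib_left mult.assoc)
qed

lemma ext_rep_0: "ext_rep d R i j 0 = 0"
  by (simp add: ext_rep_def)

lemma sum_keys_tensor:
  assumes "finite V" "\<xi> \<in> path_space V adj n" "\<xi>' \<in> path_space V adj n"
  shows "(\<Sum>(p, p')\<in>Poly_Mapping.keys (tensor \<xi> \<xi>'). coef (tensor \<xi> \<xi>') (p, p') * h p p') =
    (\<Sum>p\<in>paths V adj n. \<Sum>p'\<in>paths V adj n. coef \<xi> p * coef \<xi>' p' * h p p')"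
proof -
  have "Poly_Mapping.keys (tensor \<xi> \<xi>') \<subseteq> paths V adj n \<times> paths V adj n"
    using assms(2,3) by (auto simp: path_space_def in_keys_iff)
  then show ?thesis
    using assms(1) by (subst sum_keys_superset[of "paths V adj n \<times> paths V adj n"])
      (auto simp: finite_paths sum.cartesian_product)
qed

lemma basis_vec_in_path_space: "p \<in> paths V adj n \<Longrightarrow> basis_vec p \<in> path_space V adj n"
  by (simp add: path_space_def)

lemma coef_c_op:
  assumes "finite V" "f \<in> path_space V adj n"
  shows "coef (c_op \<mu> k f) \<eta> = (\<Sum>p\<in>paths V adj n. coef f p * coef (c_path \<mu> k p) \<eta>)"
  unfolding c_op_def coef_sum_cscale
  using assms by (intro sum.mono_neutral_left) (auto simp: path_space_def finite_paths in_keys_iff)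

lemma c_path_eq_0: "p \<in> paths V adj n \<Longrightarrow> n \<le> k \<Longrightarrow> c_path \<mu> k p = 0"
  by (simp add: c_path_def paths_length)

text \<open>c_k kills paths of length at most k, and k starts at 1. So pairs of vertices or of edges
  give elements of the algebra, the only place where an intertwiner can be evaluated
  directly.\<close>

lemma basis_vec_in_ess_space:
  assumes "finite V" "p \<in> paths V adj n" "n \<le> 1"
  shows "basis_vec p \<in> ess_space V adj \<mu> n"
proof -
  have "coef (c_op \<mu> k (basis_vec p)) \<eta> = 0" if "k \<ge> 1" for k \<eta>
    using assms that c_path_eq_0[of _ V adj n k \<mu>]
    by (simp add: coef_c_op[OF assms(1) basis_vec_in_path_space[OF assms(2)]])
  then show ?thesis
    using assms by (auto simp: ess_space_def basis_vec_in_path_space intro!: poly_mapping_eqI)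
qed

lemma ess_space_path_space: "\<xi> \<in> ess_space V adj \<mu> n \<Longrightarrow> \<xi> \<in> path_space V adj n"
  by (simp add: ess_space_def)

lemma tensor_in_End_E:
  "\<xi> \<in> ess_space V adj \<mu> n \<Longrightarrow> \<xi>' \<in> ess_space V adj \<mu> n \<Longrightarrow> tensor \<xi> \<xi>' \<in> End_E V adj \<mu>"
  unfolding End_E_def by (intro free.span_base) blast

text \<open>Two edges are required: on a single edge the extension is R itself, and no factorization
  into edge and vertex is built into its definition.\<close>

lemma ext_elem_split:
  assumes "\<xi> \<in> paths V adj (Suc (Suc n))" "\<xi>' \<in> paths V adj (Suc (Suc n))"
  shows "ext_elem d R \<xi> \<xi>' i j =
    (\<Sum>k<d. ext_elem d R (take 2 \<xi>) (take 2 \<xi>') i k * ext_elem d R (tl \<xi>) (tl \<xi>') k j)"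
proof -
  have "\<exists>u v w p. \<zeta> = u # v # w # p" if "\<zeta> \<in> paths V adj (Suc (Suc n))" for \<zeta>
    using paths_length[OF that] by (auto simp: length_Suc_conv)
  then obtain u v w p u' v' w' p' where "\<xi> = u # v # w # p" "\<xi>' = u' # v' # w' # p'"
    using assms by meson
  then show ?thesis by simp
qed

lemma tensor_rep_basis_vec:
  "tensor_rep V adj \<Phi> fs p p' (basis_vec (\<xi>, \<xi>')) = tensor_rep_elem V adj \<Phi> fs p p' \<xi> \<xi>'"
  by (simp add: tensor_rep_def)

lemma ext_rep_tensor_basis_vec:
  assumes "finite V" "\<xi> \<in> path_space V adj n" "\<zeta> \<in> paths V adj n"
  shows "ext_rep d R i j (tensor \<xi> (basis_vec \<zeta>)) = (\<Sum>p\<in>paths V adj n. coef \<xi> p * ext_elem d R p \<zeta> i j)"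
  unfolding ext_rep_def sum_keys_tensor[OF assms(1,2) basis_vec_in_path_space[OF assms(3)]]
  using assms by (simp add: lookup_single when_def mult_delta_left mult_delta_right finite_paths)

section \<open>From tensor products to irreducible representations\<close>

context graph_dta
begin

text \<open>Since R occurs in a tensor product Q, it is the compression S Q T on A; the same
  compression describes the extension on elementary paths. Both formulas share one existential
  because they are compared later and must have the same \<open>fs\<close>, \<open>T\<close>,
  \<open>S\<close>.\<close>

lemma irrep_ext_elem:
  assumes irr: "irreducible_rep (End_E V adj \<mu>) mul one {..<d} R"
  shows "\<exists>fs T S. fs \<noteq> [] \<and> set fs \<subseteq> F \<and>
    (\<forall>n. \<forall>\<xi>\<in>paths V adj n. \<forall>\<xi>'\<in>paths V adj n. \<forall>\<alpha><d. \<forall>\<beta><d.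
       ext_elem d R \<xi> \<xi>' \<alpha> \<beta> = (\<Sum>j\<in>paths V adj (length fs). \<Sum>k\<in>paths V adj (length fs).
         S \<alpha> j * tensor_rep_elem V adj \<Phi> fs j k \<xi> \<xi>' * T k \<beta>)) \<and>
    (\<forall>a\<in>End_E V adj \<mu>. \<forall>\<alpha><d. \<forall>\<beta><d.
       R \<alpha> \<beta> a = (\<Sum>j\<in>paths V adj (length fs). \<Sum>k\<in>paths V adj (length fs).
         S \<alpha> j * tensor_rep V adj \<Phi> fs j k a * T k \<beta>))"
proof -
  obtain fs where fs: "fs \<noteq> []" "set fs \<subseteq> F"
    and occ: "occurs_in (End_E V adj \<mu>) {..<d} R (paths V adj (length fs)) (tensor_rep V adj \<Phi> fs)"
    using generated[OF irr] by blast
  let ?J = "paths V adj (length fs)"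
  let ?Q = "\<lambda>\<xi> \<xi>' j k. tensor_rep_elem V adj \<Phi> fs j k \<xi> \<xi>'"
  obtain T S where T: "intertwiner (End_E V adj \<mu>) {..<d} R ?J (tensor_rep V adj \<Phi> fs) T"
    and ST: "\<forall>i\<in>{..<d}. \<forall>i'\<in>{..<d}. (\<Sum>j\<in>?J. S i j * T j i') = (if i = i' then 1 else 0)"
    using occ unfolding occurs_in_def by blast
  have T': "(\<Sum>k\<in>?J. tensor_rep V adj \<Phi> fs j k a * T k i) = (\<Sum>k<d. T j k * R k i a)"
    if "a \<in> End_E V adj \<mu>" "j \<in> ?J" "i < d" for a i j
    using T that unfolding intertwiner_def by auto
  \<comment> \<open>From q T = T m and S T = 1 follows m = S q T.\<close>
  have recover: "m \<alpha> \<beta> = (\<Sum>j\<in>?J. \<Sum>k\<in>?J. S \<alpha> j * q j k * T k \<beta>)"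
    if "\<And>j. j \<in> ?J \<Longrightarrow> (\<Sum>k\<in>?J. q j k * T k \<beta>) = (\<Sum>k<d. T j k * m k \<beta>)" "\<alpha> < d"
    for m :: "nat \<Rightarrow> nat \<Rightarrow> complex" and q \<alpha> \<beta>
  proof -
    have "(\<Sum>j\<in>?J. \<Sum>k\<in>?J. S \<alpha> j * q j k * T k \<beta>) = (\<Sum>j\<in>?J. S \<alpha> j * (\<Sum>k<d. T j k * m k \<beta>))"
      by (simp add: mult.assoc that flip: sum_distrib_left)
    also have "\<dots> = (\<Sum>k<d. (\<Sum>j\<in>?J. S \<alpha> j * T j k) * m k \<beta>)"
      unfolding sum_distrib_left sum_distrib_right by (subst sum.swap) (simp only: mult.assoc)
    also have "\<dots> = m \<alpha> \<beta>"
      using ST that(2) by (simp add: mult_delta_left)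
    finally show ?thesis ..
  qed
  have short: "(\<Sum>k\<in>?J. ?Q \<xi> \<xi>' j k * T k i) = (\<Sum>k<d. T j k * ext_elem d R \<xi> \<xi>' k i)"
    if "\<xi> \<in> paths V adj n" "\<xi>' \<in> paths V adj n" "n \<le> 1" "j \<in> ?J" "i < d" for \<xi> \<xi>' n j i
  proof -
    have "basis_vec (\<xi>, \<xi>') \<in> End_E V adj \<mu>"
      using that finite_V by (subst tensor_basis_vec[symmetric])
        (intro tensor_in_End_E[where n = n] basis_vec_in_ess_space)
    moreover have "ext_elem d R \<xi> \<xi>' k i = R k i (basis_vec (\<xi>, \<xi>'))" for k
      using paths_length[OF that(1)] that(3) by (auto simp: length_Suc_conv le_Suc_eq)
    ultimately show ?thesis
      using T'[of "basis_vec (\<xi>, \<xi>')" j i] that by (simp add: tensor_rep_basis_vec)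
  qed
  \<comment> \<open>If Q1, Q2 belong to the first edge and the rest, and e1, e2 are their
    extensions, then Q1 Q2 T = Q1 T e2 = T e1 e2. Lengths 0 and 1 are taken from A.\<close>
  have inter: "(\<Sum>k\<in>?J. ?Q \<xi> \<xi>' j k * T k i) = (\<Sum>k<d. T j k * ext_elem d R \<xi> \<xi>' k i)"
    if "\<xi> \<in> paths V adj n" "\<xi>' \<in> paths V adj n" "j \<in> ?J" "i < d" for \<xi> \<xi>' n j i
    using that
  proof (induction n arbitrary: \<xi> \<xi>' j i)
    case 0
    then show ?case by (intro short[where n = 0]) auto
  next
    case (Suc n)
    show ?case
    proof (cases n)
      case 0
      then show ?thesis using Suc.prems by (intro short[where n = 1]) auto
    next
      case (Suc n')
      note p = paths_split[OF Suc.prems(1)] and p' = paths_split[OF Suc.prems(2)]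
      let ?e1 = "ext_elem d R (take 2 \<xi>) (take 2 \<xi>')" and ?e2 = "ext_elem d R (tl \<xi>) (tl \<xi>')"
      let ?Q1 = "?Q (take 2 \<xi>) (take 2 \<xi>')" and ?Q2 = "?Q (tl \<xi>) (tl \<xi>')"
      have "(\<Sum>k\<in>?J. ?Q \<xi> \<xi>' j k * T k i) = (\<Sum>k\<in>?J. \<Sum>q\<in>?J. ?Q1 j q * (?Q2 q k * T k i))"
        using Suc.prems
        by (intro sum.cong refl) (simp add: tensor_rep_elem_split[OF fs, of _ _ \<xi> n \<xi>'] sum_distrib_right mult.assoc)
      also have "\<dots> = (\<Sum>q\<in>?J. ?Q1 j q * (\<Sum>l<d. T q l * ?e2 l i))"
        using Suc.IH[OF p(2) p'(2) _ Suc.prems(4)]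
        by (subst sum.swap) (simp flip: sum_distrib_left)
      also have "\<dots> = (\<Sum>l<d. (\<Sum>q\<in>?J. ?Q1 j q * T q l) * ?e2 l i)"
        unfolding sum_distrib_left sum_distrib_right by (subst sum.swap) (simp only: mult.assoc)
      also have "\<dots> = (\<Sum>l<d. (\<Sum>h<d. T j h * ?e1 h l) * ?e2 l i)"
        using short[OF p(1) p'(1) _ Suc.prems(3)] by (intro sum.cong refl) simp
      also have "\<dots> = (\<Sum>h<d. T j h * (\<Sum>l<d. ?e1 h l * ?e2 l i))"
        unfolding sum_distrib_left sum_distrib_right by (subst sum.swap) (simp only: mult.assoc)
      also have "\<dots> = (\<Sum>h<d. T j h * ext_elem d R \<xi> \<xi>' h i)"
        using Suc.prems Suc by (simp add: ext_elem_split[of \<xi> V adj n' \<xi>'])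
      finally show ?thesis .
    qed
  qed
  have "ext_elem d R \<xi> \<xi>' \<alpha> \<beta> = (\<Sum>j\<in>?J. \<Sum>k\<in>?J. S \<alpha> j * ?Q \<xi> \<xi>' j k * T k \<beta>)"
    if "\<xi> \<in> paths V adj n" "\<xi>' \<in> paths V adj n" "\<alpha> < d" "\<beta> < d" for n \<xi> \<xi>' \<alpha> \<beta>
    using that by (intro recover inter)
  moreover have "R \<alpha> \<beta> a = (\<Sum>j\<in>?J. \<Sum>k\<in>?J. S \<alpha> j * tensor_rep V adj \<Phi> fs j k a * T k \<beta>)"
    if "a \<in> End_E V adj \<mu>" "\<alpha> < d" "\<beta> < d" for a \<alpha> \<beta>
    using that by (intro recover[of "\<lambda>j k. tensor_rep V adj \<Phi> fs j k a" \<beta> "\<lambda>k i. R k i a"] T')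
  ultimately show ?thesis
    using fs by (intro exI[of _ fs] exI[of _ T] exI[of _ S]) auto
qed

text \<open>Not automatic: an essential path is a combination of elementary ones that may lie
  outside the domain of R, and the extension multiplies edge matrices. Both sides are the same
  compression S Q T, with Q bilinear in the two paths.\<close>

lemma ext_rep_eq:
  assumes irr: "irreducible_rep (End_E V adj \<mu>) mul one {..<d} R"
    and a: "a \<in> End_E V adj \<mu>" and ij: "i < d" "j < d"
  shows "ext_rep d R i j a = R i j a"
proof -
  from irrep_ext_elem[OF irr] obtain fs T S where fs: "fs \<noteq> []" "set fs \<subseteq> F"
    and ext: "\<forall>n. \<forall>\<xi>\<in>paths V adj n. \<forall>\<xi>'\<in>paths V adj n. \<forall>\<alpha><d. \<forall>\<beta><d.
       ext_elem d R \<xi> \<xi>' \<alpha> \<beta> = (\<Sum>j\<in>paths V adj (length fs). \<Sum>k\<in>paths V adj (length fs).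
         S \<alpha> j * tensor_rep_elem V adj \<Phi> fs j k \<xi> \<xi>' * T k \<beta>)"
    and rep: "\<forall>a\<in>End_E V adj \<mu>. \<forall>\<alpha><d. \<forall>\<beta><d.
       R \<alpha> \<beta> a = (\<Sum>j\<in>paths V adj (length fs). \<Sum>k\<in>paths V adj (length fs).
         S \<alpha> j * tensor_rep V adj \<Phi> fs j k a * T k \<beta>)"
    by (elim exE conjE) (rule that)
  note * = ext[rule_format] rep[rule_format]
  let ?J = "paths V adj (length fs)"
  have gen: "ext_rep d R i j (tensor \<xi> \<xi>') = R i j (tensor \<xi> \<xi>')"
    if \<xi>: "\<xi> \<in> ess_space V adj \<mu> n" "\<xi>' \<in> ess_space V adj \<mu> n" for n \<xi> \<xi>'
  proof -
    let ?N = "paths V adj n"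
    note sumt = sum_keys_tensor[OF finite_V ess_space_path_space[OF \<xi>(1)] ess_space_path_space[OF \<xi>(2)]]
    have "R i j (tensor \<xi> \<xi>') = (\<Sum>s\<in>?J. \<Sum>t\<in>?J. \<Sum>p\<in>?N. \<Sum>p'\<in>?N.
        coef \<xi> p * coef \<xi>' p' * (S i s * tensor_rep_elem V adj \<Phi> fs s t p p' * T t j))"
      unfolding *(2)[OF tensor_in_End_E[OF \<xi>] ij] tensor_rep_def sumt sum_distrib_left sum_distrib_right
      by (simp only: mult_ac)
    also have "\<dots> = (\<Sum>s\<in>?J. \<Sum>p\<in>?N. \<Sum>t\<in>?J. \<Sum>p'\<in>?N.
        coef \<xi> p * coef \<xi>' p' * (S i s * tensor_rep_elem V adj \<Phi> fs s t p p' * T t j))"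
      by (rule sum.cong[OF refl]) (rule sum.swap)
    also have "\<dots> = (\<Sum>p\<in>?N. \<Sum>s\<in>?J. \<Sum>t\<in>?J. \<Sum>p'\<in>?N.
        coef \<xi> p * coef \<xi>' p' * (S i s * tensor_rep_elem V adj \<Phi> fs s t p p' * T t j))"
      by (rule sum.swap)
    also have "\<dots> = (\<Sum>p\<in>?N. \<Sum>s\<in>?J. \<Sum>p'\<in>?N. \<Sum>t\<in>?J.
        coef \<xi> p * coef \<xi>' p' * (S i s * tensor_rep_elem V adj \<Phi> fs s t p p' * T t j))"
      by (rule sum.cong[OF refl], rule sum.cong[OF refl]) (rule sum.swap)
    also have "\<dots> = (\<Sum>p\<in>?N. \<Sum>p'\<in>?N. \<Sum>s\<in>?J. \<Sum>t\<in>?J.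
        coef \<xi> p * coef \<xi>' p' * (S i s * tensor_rep_elem V adj \<Phi> fs s t p p' * T t j))"
      by (rule sum.cong[OF refl]) (rule sum.swap)
    also have "\<dots> = ext_rep d R i j (tensor \<xi> \<xi>')"
      unfolding ext_rep_def sumt
      by (intro sum.cong refl) (simp add: *(1)[OF _ _ ij] sum_distrib_left)
    finally show ?thesis ..
  qed
  have lin: "linear_on (End_E V adj \<mu>) (*) (R i j)"
    using irr ij by (simp add: irreducible_rep_def matrix_rep_def)
  have "a \<in> End_E V adj \<mu> \<and> ext_rep d R i j a = R i j a"
    using a unfolding End_E_def
  proof (induction rule: free.span_induct_alt)
    case base
    then show ?case
      using linear_on_0[OF lin subspace] free.span_zero by (simp add: ext_rep_0 End_E_def)
  next
    case (step c x y)
    then have x: "x \<in> End_E V adj \<mu>" "ext_rep d R i j x = R i j x"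
      using gen by (auto intro: tensor_in_End_E)
    have cx: "cscale c x \<in> End_E V adj \<mu>" using x(1) by (rule free.subspace_scale[OF subspace])
    then show ?case
      using step(2) x free.subspace_add[OF subspace, of "cscale c x" y]
      unfolding End_E_def[symmetric]
      by (simp add: ext_rep_add ext_rep_cscale linear_on_add[OF lin] linear_on_scale[OF lin])
  qed
  then show ?thesis ..
qed

text \<open>S and T act on matrix indices and c_k on paths, so the relation for tensor products
  survives the compression.\<close>

lemma ext_elem_c_path:
  assumes irr: "irreducible_rep (End_E V adj \<mu>) mul one {..<d} R"
    and p: "p \<in> paths V adj (Suc (Suc n))" and \<eta>: "\<eta> \<in> paths V adj n" and k: "k \<le> n" and ij: "i < d" "j < d"
  shows "(\<Sum>\<zeta>\<in>paths V adj (Suc (Suc n)). ext_elem d R p \<zeta> i j * coef (c_path \<mu> (Suc k) \<zeta>) \<eta>) =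
    (\<Sum>\<rho>\<in>paths V adj n. coef (c_path \<mu> (Suc k) p) \<rho> * ext_elem d R \<rho> \<eta> i j)"
proof -
  from irrep_ext_elem[OF irr] obtain fs T S where fs: "fs \<noteq> []" "set fs \<subseteq> F"
    and ext: "\<forall>n. \<forall>\<xi>\<in>paths V adj n. \<forall>\<xi>'\<in>paths V adj n. \<forall>\<alpha><d. \<forall>\<beta><d.
       ext_elem d R \<xi> \<xi>' \<alpha> \<beta> = (\<Sum>j\<in>paths V adj (length fs). \<Sum>k\<in>paths V adj (length fs).
         S \<alpha> j * tensor_rep_elem V adj \<Phi> fs j k \<xi> \<xi>' * T k \<beta>)"
    and rep: "\<forall>a\<in>End_E V adj \<mu>. \<forall>\<alpha><d. \<forall>\<beta><d.
       R \<alpha> \<beta> a = (\<Sum>j\<in>paths V adj (length fs). \<Sum>k\<in>paths V adj (length fs).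
         S \<alpha> j * tensor_rep V adj \<Phi> fs j k a * T k \<beta>)"
    by (elim exE conjE) (rule that)
  note * = ext[rule_format] rep[rule_format]
  let ?J = "paths V adj (length fs)" and ?N = "paths V adj (Suc (Suc n))"
  let ?Q = "tensor_rep_elem V adj \<Phi> fs" and ?C = "\<lambda>\<xi> \<zeta>. coef (c_path \<mu> (Suc k) \<xi>) \<zeta>"
  have "(\<Sum>\<zeta>\<in>?N. ext_elem d R p \<zeta> i j * ?C \<zeta> \<eta>) =
      (\<Sum>\<zeta>\<in>?N. \<Sum>s\<in>?J. \<Sum>t\<in>?J. S i s * (?Q s t p \<zeta> * ?C \<zeta> \<eta>) * T t j)"
    using p ij by (intro sum.cong refl) (simp add: *(1)[of p "Suc (Suc n)"] sum_distrib_left sum_distrib_right mult_ac)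
  also have "\<dots> = (\<Sum>s\<in>?J. \<Sum>\<zeta>\<in>?N. \<Sum>t\<in>?J. S i s * (?Q s t p \<zeta> * ?C \<zeta> \<eta>) * T t j)"
    by (rule sum.swap)
  also have "\<dots> = (\<Sum>s\<in>?J. \<Sum>t\<in>?J. \<Sum>\<zeta>\<in>?N. S i s * (?Q s t p \<zeta> * ?C \<zeta> \<eta>) * T t j)"
    by (rule sum.cong[OF refl]) (rule sum.swap)
  also have "\<dots> = (\<Sum>s\<in>?J. \<Sum>t\<in>?J. S i s * (\<Sum>\<zeta>\<in>?N. ?Q s t p \<zeta> * ?C \<zeta> \<eta>) * T t j)"
    by (simp only: sum_distrib_left sum_distrib_right)
  also have "\<dots> = (\<Sum>s\<in>?J. \<Sum>t\<in>?J. S i s * (\<Sum>\<rho>\<in>paths V adj n. ?C p \<rho> * ?Q s t \<rho> \<eta>) * T t j)"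
    using p \<eta> k by (intro sum.cong refl) (simp add: tensor_rep_elem_c_path[OF fs])
  also have "\<dots> = (\<Sum>s\<in>?J. \<Sum>t\<in>?J. \<Sum>\<rho>\<in>paths V adj n. S i s * (?C p \<rho> * ?Q s t \<rho> \<eta>) * T t j)"
    by (simp only: sum_distrib_left sum_distrib_right)
  also have "\<dots> = (\<Sum>s\<in>?J. \<Sum>\<rho>\<in>paths V adj n. \<Sum>t\<in>?J. S i s * (?C p \<rho> * ?Q s t \<rho> \<eta>) * T t j)"
    by (rule sum.cong[OF refl]) (rule sum.swap)
  also have "\<dots> = (\<Sum>\<rho>\<in>paths V adj n. \<Sum>s\<in>?J. \<Sum>t\<in>?J. S i s * (?C p \<rho> * ?Q s t \<rho> \<eta>) * T t j)"
    by (rule sum.swap)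
  also have "\<dots> = (\<Sum>\<rho>\<in>paths V adj n. ?C p \<rho> * ext_elem d R \<rho> \<eta> i j)"
    using \<eta> ij by (intro sum.cong refl) (simp add: *(1)[of _ n] sum_distrib_left sum_distrib_right mult_ac)
  finally show ?thesis .
qed

text \<open>Hence the coefficients of \<open>\<xi> \<otimes> \<zeta>\<close>, as a function of the elementary path \<open>\<zeta>\<close>, inherit
  from \<open>\<xi>\<close> the property of being essential.\<close>

lemma ext_rep_essential:
  assumes irr: "irreducible_rep (End_E V adj \<mu>) mul one {..<d} R"
    and \<xi>: "\<xi> \<in> ess_space V adj \<mu> n" and ij: "i < d" "j < d"
  shows "(\<Sum>\<zeta>\<in>paths V adj n. Poly_Mapping.single \<zeta> (ext_rep d R i j (tensor \<xi> (basis_vec \<zeta>)))) \<in> ess_space V adj \<mu> n"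
    (is "?g \<in> _")
proof -
  let ?h = "\<lambda>\<zeta>. ext_rep d R i j (tensor \<xi> (basis_vec \<zeta>))"
  have g: "coef ?g \<zeta> = (if \<zeta> \<in> paths V adj n then ?h \<zeta> else 0)" for \<zeta>
    by (simp add: lookup_sum lookup_single when_def finite_paths finite_V)
  have \<xi>P: "\<xi> \<in> path_space V adj n" using \<xi> by (rule ess_space_path_space)
  have gP: "?g \<in> path_space V adj n"
    by (auto simp: path_space_def in_keys_iff g split: if_splits)
  have "coef (c_op \<mu> k ?g) \<eta> = 0" if "k \<ge> 1" for k \<eta>
  proof (cases "k < n")
    case False
    then show ?thesis
      by (simp add: coef_c_op[OF finite_V gP] c_path_eq_0)
  next
    case True
    \<comment> \<open>Since 1 <= k < n, the length n is at least 2 and neither subtraction is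
      truncated.\<close>
    define m l where "m = n - 2" and "l = k - 1"
    then have n: "n = Suc (Suc m)" and k: "k = Suc l" "l \<le> m"
      using True that by auto
    let ?C = "\<lambda>\<xi> \<zeta>. coef (c_path \<mu> (Suc l) \<xi>) \<zeta>"
    have "coef (c_op \<mu> k ?g) \<eta> = (\<Sum>\<zeta>\<in>paths V adj n. ?h \<zeta> * ?C \<zeta> \<eta>)"
      unfolding coef_c_op[OF finite_V gP] k by (intro sum.cong refl) (simp add: g)
    also have "\<dots> = 0"
    proof (cases "\<eta> \<in> paths V adj m")
      case False
      then show ?thesis
        using coef_c_path_paths[of _ V adj m "Suc l" \<mu> \<eta>] unfolding n by (intro sum.neutral) auto
    next
      case True
      have "(\<Sum>\<zeta>\<in>paths V adj n. ?h \<zeta> * ?C \<zeta> \<eta>) =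
          (\<Sum>\<zeta>\<in>paths V adj n. \<Sum>p\<in>paths V adj n. coef \<xi> p * (ext_elem d R p \<zeta> i j * ?C \<zeta> \<eta>))"
        by (intro sum.cong refl)
          (simp add: ext_rep_tensor_basis_vec[OF finite_V \<xi>P] sum_distrib_right mult.assoc)
      also have "\<dots> = (\<Sum>p\<in>paths V adj n. coef \<xi> p * (\<Sum>\<rho>\<in>paths V adj m. ?C p \<rho> * ext_elem d R \<rho> \<eta> i j))"
        using True k ij unfolding n
        by (subst sum.swap) (simp add: ext_elem_c_path[OF irr] flip: sum_distrib_left)
      also have "\<dots> = (\<Sum>\<rho>\<in>paths V adj m. (\<Sum>p\<in>paths V adj n. coef \<xi> p * ?C p \<rho>) * ext_elem d R \<rho> \<eta> i j)"
        unfolding sum_distrib_left sum_distrib_right by (subst sum.swap) (simp only: mult.assoc)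
      \<comment> \<open>The operator has moved from \<zeta> onto \<xi>, which it
        annihilates.\<close>
      also have "\<dots> = (\<Sum>\<rho>\<in>paths V adj m. coef (c_op \<mu> k \<xi>) \<rho> * ext_elem d R \<rho> \<eta> i j)"
        by (simp add: coef_c_op[OF finite_V \<xi>P] k)
      also have "\<dots> = 0"
        using \<xi> that by (simp add: ess_space_def)
      finally show ?thesis .
    qed
    finally show ?thesis .
  qed
  then show ?thesis
    using gP by (auto simp: ess_space_def intro!: poly_mapping_eqI)
qed

end

section \<open>The projection to the algebra\<close>

lemma tensor_sum_left: "tensor (\<Sum>i\<in>I. cscale (c i) (x i)) y = (\<Sum>i\<in>I. cscale (c i) (tensor (x i) y))"
  by (rule poly_mapping_eqI) (auto simp: split_paired_all lookup_sum sum_distrib_right mult.assoc)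

lemma tensor_sum_right: "tensor x (\<Sum>i\<in>I. cscale (c i) (y i)) = (\<Sum>i\<in>I. cscale (c i) (tensor x (y i)))"
  by (rule poly_mapping_eqI) (auto simp: split_paired_all lookup_sum sum_distrib_left mult_ac)

lemma path_space_expand:
  assumes "finite V" "f \<in> path_space V adj n"
  shows "(\<Sum>p\<in>paths V adj n. cscale (coef f p) (basis_vec p)) = f"
proof (rule poly_mapping_eqI)
  fix q
  show "coef (\<Sum>p\<in>paths V adj n. cscale (coef f p) (basis_vec p)) q = coef f q"
    using assms by (auto simp: lookup_sum lookup_single when_def mult_delta_right finite_paths path_space_def in_keys_iff)
qed

lemma ext_rep_sum:
  "ext_rep d R i j (\<Sum>k\<in>I. cscale (c k) (a k)) = (\<Sum>k\<in>I. c k * ext_rep d R i j (a k))"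
  by (induction I rule: infinite_finite_induct) (auto simp: ext_rep_0 ext_rep_add ext_rep_cscale)

lemma ess_part_sum:
  "ess_part X d \<Psi> E (\<Sum>i\<in>I. cscale (c i) (a i)) = (\<Sum>i\<in>I. cscale (c i) (ess_part X d \<Psi> E (a i)))"
proof -
  have "ess_part X d \<Psi> E (cscale c a + b) = cscale c (ess_part X d \<Psi> E a) + ess_part X d \<Psi> E b" for c a b
    by (simp add: ess_part_def ext_rep_add ext_rep_cscale free.scale_left_distrib sum.distrib
        free.scale_sum_right)
  moreover have "ess_part X d \<Psi> E 0 = 0"
    by (simp add: ess_part_def ext_rep_0)
  ultimately show ?thesis
    by (induction I rule: infinite_finite_induct) auto
qed

text \<open>The form is bilinear rather than hermitian, so the coefficients carry no conjugation
  even for complex \<open>f\<close>. Finiteness of \<open>B\<close> comes from the finitely many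
  elementary paths of length n.\<close>

lemma ess_basis_expand:
  assumes V: "finite V" and B: "ess_basis V adj \<mu> n B"
  shows "finite B" "B \<subseteq> ess_space V adj \<mu> n"
    and "f \<in> ess_space V adj \<mu> n \<Longrightarrow>
      (\<Sum>b\<in>B. cscale (\<Sum>p\<in>paths V adj n. coef b p * coef f p) b) = f"
proof -
  have indep: "free.independent B" and span: "free.span B = ess_space V adj \<mu> n"
    and ortho: "\<And>b b'. b \<in> B \<Longrightarrow> b' \<in> B \<Longrightarrow> path_form b b' = (if b = b' then 1 else 0)"
    using B by (auto simp: ess_basis_def)
  show BE: "B \<subseteq> ess_space V adj \<mu> n" using free.span_superset span by blast
  have "f \<in> free.span (basis_vec ` paths V adj n)" if "f \<in> path_space V adj n" for f :: "'a list \<Rightarrow>\<^sub>0 complex"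
    using path_space_expand[OF V that]
    by (metis (no_types, lifting) free.span_base free.span_scale free.span_sum image_eqI)
  then have "B \<subseteq> free.span (basis_vec ` paths V adj n)"
    using BE ess_space_path_space by blast
  then show fin: "finite B"
    using free.independent_span_bound[OF finite_imageI[OF finite_paths[OF V]] indep] by simp
  have form: "(\<Sum>p\<in>paths V adj n. coef b p * coef b' p) = (if b = b' then 1 else 0)"
    if "b \<in> B" "b' \<in> B" for b b'
  proof -
    have "path_form b b' = (\<Sum>p\<in>paths V adj n. coef b p * coef b' p)"
      unfolding path_form_def using that BE V
      by (intro sum.mono_neutral_left) (auto simp: finite_paths ess_space_def path_space_def in_keys_iff)
    then show ?thesis using ortho that by simp
  qed
  assume f: "f \<in> ess_space V adj \<mu> n"
  let ?r = "free.representation B f"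
  have rep: "f = (\<Sum>b\<in>B. cscale (?r b) b)"
    using free.sum_representation_eq[OF indep, of f B] f span fin by simp
  have "(\<Sum>p\<in>paths V adj n. coef b p * coef f p) = ?r b" if b: "b \<in> B" for b
  proof -
    have "(\<Sum>p\<in>paths V adj n. coef b p * coef f p) =
        (\<Sum>p\<in>paths V adj n. \<Sum>b'\<in>B. ?r b' * (coef b p * coef b' p))"
      by (subst rep) (simp add: lookup_sum sum_distrib_left mult_ac)
    also have "\<dots> = (\<Sum>b'\<in>B. ?r b' * (if b = b' then 1 else 0))"
      using b by (subst sum.swap) (simp add: form flip: sum_distrib_left)
    finally show ?thesis using b fin by (simp add: mult_delta_right)
  qed
  then show "(\<Sum>b\<in>B. cscale (\<Sum>p\<in>paths V adj n. coef b p * coef f p) b) = f"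
    using rep by simp
qed

text \<open>The definition sums only over the indices that occur in \<open>t\<close>;
  \<open>e 0 = 0\<close> covers the others. The result is a description by slices, which is linear
  in \<open>t\<close>.\<close>

lemma coef_tensor_map_left:
  assumes "e 0 = 0"
  shows "coef (tensor_map_left e t) j = e (Poly_Mapping.map_key (\<lambda>i. (i, j)) t)"
proof (cases "j \<in> snd ` Poly_Mapping.keys t")
  case True
  then show ?thesis
    by (simp add: tensor_map_left_def lookup_sum lookup_single when_def)
next
  case False
  have "Poly_Mapping.map_key (\<lambda>i. (i, j)) t = 0"
    using False by (intro poly_mapping_eqI) (force simp: map_key.rep_eq inj_on_def in_keys_iff)
  then show ?thesis
    using False assms by (auto simp: tensor_map_left_def lookup_sum lookup_single when_def)
qed

lemma coef_tensor_map_right: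
  assumes "e 0 = 0"
  shows "coef (tensor_map_right e t) i = e (Poly_Mapping.map_key (\<lambda>j. (i, j)) t)"
proof (cases "i \<in> fst ` Poly_Mapping.keys t")
  case True
  then show ?thesis
    by (simp add: tensor_map_right_def lookup_sum lookup_single when_def)
next
  case False
  have "Poly_Mapping.map_key (\<lambda>j. (i, j)) t = 0"
    using False by (intro poly_mapping_eqI) (force simp: map_key.rep_eq inj_on_def in_keys_iff)
  then show ?thesis
    using False assms by (auto simp: tensor_map_right_def lookup_sum lookup_single when_def)
qed

locale graph_dta_irreps = graph_dta V adj \<mu> mul one star F \<Phi>
  for V :: "'v set" and adj \<mu> mul one star and F :: "'f set" and \<Phi> +
  fixes X :: "'x set" and d \<Psi> E
  assumes irreps: "irrep_system (End_E V adj \<mu>) mul one star X d \<Psi>"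
    and units: "matrix_units (End_E V adj \<mu>) X d \<Psi> E"
begin

lemma irrep: "x \<in> X \<Longrightarrow> irreducible_rep (End_E V adj \<mu>) mul one {..<d x} (\<Psi> x)"
  using irreps by (simp add: irrep_system_def)

lemma irrep_linear:
  "x \<in> X \<Longrightarrow> \<alpha> < d x \<Longrightarrow> \<beta> < d x \<Longrightarrow> linear_on (End_E V adj \<mu>) (*) (\<Psi> x \<alpha> \<beta>)"
  using irrep[of x] by (simp add: irreducible_rep_def matrix_rep_def)

lemma unit_closed: "x \<in> X \<Longrightarrow> \<alpha> < d x \<Longrightarrow> \<beta> < d x \<Longrightarrow> E x \<alpha> \<beta> \<in> End_E V adj \<mu>"
  using units by (simp add: matrix_units_def)

lemma irrep_unit:
  assumes "x \<in> X" "\<eta> < d x" "\<eta>' < d x" "y \<in> X" "\<alpha> < d y" "\<beta> < d y"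
  shows "\<Psi> y \<alpha> \<beta> (E x \<eta> \<eta>') = (if x = y \<and> \<alpha> = \<eta> \<and> \<beta> = \<eta>' then 1 else 0)"
  using units assms by (simp add: matrix_units_def)

text \<open>A sum over an infinite set would be 0 by convention and make \<open>ess_part\<close>
  meaningless. The corner units \<open>E x 0 0\<close> are independent, being dual to the corner
  entries of the \<Psi>, and A has a finite spanning set.\<close>

lemma finite_X: "finite X"
proof -
  let ?e = "\<lambda>x. E x 0 0"
  have d: "0 < d x" if "x \<in> X" for x
    using irrep[OF that] by (auto simp: irreducible_rep_def lessThan_empty_iff)
  have val: "\<Psi> y 0 0 (?e x) = (if x = y then 1 else 0)" if "x \<in> X" "y \<in> X" for x y
    using that d by (simp add: irrep_unit)
  have inj: "inj_on ?e X"
    by (rule inj_onI) (metis val zero_neq_one)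
  have "free.independent (?e ` X)"
    unfolding free.independent_explicit_finite_subsets
  proof (intro allI impI ballI)
    fix S u v assume S: "S \<subseteq> ?e ` X" "finite S" and sum0: "(\<Sum>v\<in>S. cscale (u v) v) = 0" and v: "v \<in> S"
    obtain x where x: "x \<in> X" "v = ?e x" using S v by auto
    have SA: "w \<in> End_E V adj \<mu>" if "w \<in> S" for w
      using that S d by (auto intro: unit_closed)
    note lin = irrep_linear[OF x(1) d[OF x(1)] d[OF x(1)]]
    have "0 = \<Psi> x 0 0 (\<Sum>v\<in>S. cscale (u v) v)"
      using linear_on_0[OF lin subspace] by (simp add: sum0)
    also have "\<dots> = (\<Sum>w\<in>S. u w * \<Psi> x 0 0 w)"
      by (rule linear_on_complex_sum[OF lin subspace]) (rule SA)
    also have "\<dots> = (\<Sum>w\<in>S. if w = v then u v else 0)"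
    proof (rule sum.cong[OF refl])
      fix w assume "w \<in> S"
      then obtain y where "y \<in> X" "w = ?e y" using S by auto
      then show "u w * \<Psi> x 0 0 w = (if w = v then u v else 0)"
        using val x inj by (auto simp: inj_on_def)
    qed
    finally show "u v = 0" using S v by simp
  qed
  moreover obtain S where S: "finite S" "free.span S = End_E V adj \<mu>" using finite_dim by blast
  moreover have "?e ` X \<subseteq> free.span S" using S d by (auto intro: unit_closed)
  ultimately have "finite (?e ` X)" using free.independent_span_bound[of S "?e ` X"] by simp
  then show ?thesis using inj by (rule finite_imageD)
qed

lemma ess_part_closed: "ess_part X d \<Psi> E a \<in> End_E V adj \<mu>"
  unfolding ess_part_def
  by (intro free.subspace_sum[OF subspace] free.subspace_scale[OF subspace] unit_closed) auto

text \<open>Characterizes \<open>ess_part\<close> by its entries: the matrix units are dual to the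
  coefficient functionals, so the prescribed coefficients are read off again.\<close>

lemma irrep_ess_part:
  assumes y: "y \<in> X" "\<alpha> < d y" "\<beta> < d y"
  shows "\<Psi> y \<alpha> \<beta> (ess_part X d \<Psi> E a) = ext_rep (d y) (\<Psi> y) \<alpha> \<beta> a"
proof -
  note lin = irrep_linear[OF y]
  let ?c = "\<lambda>x i j. ext_rep (d x) (\<Psi> x) i j a"
  have inner: "\<Psi> y \<alpha> \<beta> (\<Sum>j<d x. cscale (?c x i j) (E x i j)) = (if x = y then if i = \<alpha> then ?c y \<alpha> \<beta> else 0 else 0)"
    if "x \<in> X" "i < d x" for x i
    using that y by (subst linear_on_complex_sum[OF lin subspace])
      (auto simp: unit_closed irrep_unit mult_delta_right)
  have "\<Psi> y \<alpha> \<beta> (ess_part X d \<Psi> E a) = (\<Sum>x\<in>X. \<Sum>i<d x. \<Psi> y \<alpha> \<beta> (\<Sum>j<d x. cscale (?c x i j) (E x i j)))"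
    unfolding ess_part_def
    by (subst linear_on_sum[OF lin subspace] ; (intro sum.cong refl linear_on_sum[OF lin subspace])?)
      (auto intro!: free.subspace_sum[OF subspace] free.subspace_scale[OF subspace] unit_closed)
  also have "\<dots> = (\<Sum>x\<in>X. if x = y then ?c y \<alpha> \<beta> else 0)"
    using y by (intro sum.cong refl) (simp add: inner)
  also have "\<dots> = ?c y \<alpha> \<beta>" using y finite_X by simp
  finally show ?thesis .
qed

lemma ess_part_id:
  assumes a: "a \<in> End_E V adj \<mu>"
  shows "ess_part X d \<Psi> E a = a"
proof -
  \<comment> \<open>The difference is written with sums and scalings, the two operations for which
    linearity on A is available.\<close>
  let ?z = "cscale 1 a + cscale (-1) (ess_part X d \<Psi> E a)"
  have z: "?z = a - ess_part X d \<Psi> E a"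
    by (rule poly_mapping_eqI) (simp add: lookup_add lookup_minus)
  have zA: "?z \<in> End_E V adj \<mu>"
    using a ess_part_closed by (intro free.subspace_add[OF subspace] free.subspace_scale[OF subspace])
  have "?z = 0"
  proof (rule irrep_system_separates[OF irreps zA])
    fix x \<alpha> \<beta> assume x: "x \<in> X" "\<alpha> < d x" "\<beta> < d x"
    have "\<Psi> x \<alpha> \<beta> ?z = \<Psi> x \<alpha> \<beta> a - \<Psi> x \<alpha> \<beta> (ess_part X d \<Psi> E a)"
      using a ess_part_closed
      by (simp add: linear_on_add[OF irrep_linear[OF x]] linear_on_scale[OF irrep_linear[OF x]]
          free.subspace_scale[OF subspace] del: free.scale_one free.scale_minus_left)
    then show "\<Psi> x \<alpha> \<beta> ?z = 0"
      using x ext_rep_eq[OF irrep[OF x(1)] a x(2,3)] by (simp only: irrep_ess_part) simp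
  qed
  then show ?thesis using z by simp
qed

text \<open>For every matrix entry the values at \<xi> \<otimes> p, as p varies, form an essential
  vector. Its coefficient along b is the entry at \<xi> \<otimes> b, so evaluating the expansion at
  \<zeta> gives the claim entrywise.\<close>

lemma ess_part_essential_basis_vec:
  assumes B: "ess_basis V adj \<mu> n B" and \<xi>: "\<xi> \<in> ess_space V adj \<mu> n" and \<zeta>: "\<zeta> \<in> paths V adj n"
  shows "ess_part X d \<Psi> E (tensor \<xi> (basis_vec \<zeta>)) = (\<Sum>b\<in>B. cscale (coef b \<zeta>) (tensor \<xi> b))"
proof -
  note BE = ess_basis_expand(2)[OF finite_V B]
  have "ext_rep (d x) (\<Psi> x) i j (tensor \<xi> (basis_vec \<zeta>)) =
      ext_rep (d x) (\<Psi> x) i j (\<Sum>b\<in>B. cscale (coef b \<zeta>) (tensor \<xi> b))"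
    if x: "x \<in> X" "i < d x" "j < d x" for x i j
  proof -
    let ?h = "\<lambda>a. ext_rep (d x) (\<Psi> x) i j a"
    let ?g = "\<Sum>p\<in>paths V adj n. Poly_Mapping.single p (?h (tensor \<xi> (basis_vec p)))"
    have g: "coef ?g p = (if p \<in> paths V adj n then ?h (tensor \<xi> (basis_vec p)) else 0)" for p
      by (simp add: lookup_sum lookup_single when_def finite_paths finite_V)
    have "?h (tensor \<xi> (basis_vec \<zeta>)) = coef ?g \<zeta>" using \<zeta> by (simp add: g)
    also have "\<dots> = (\<Sum>b\<in>B. (\<Sum>p\<in>paths V adj n. coef b p * coef ?g p) * coef b \<zeta>)"
      by (subst ess_basis_expand(3)[OF finite_V B ext_rep_essential[OF irrep[OF x(1)] \<xi> x(2,3)], symmetric])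
        (simp add: coef_sum_cscale)
    also have "\<dots> = (\<Sum>b\<in>B. coef b \<zeta> * ?h (tensor \<xi> b))"
    proof (rule sum.cong[OF refl])
      fix b assume "b \<in> B"
      then have b: "(\<Sum>p\<in>paths V adj n. cscale (coef b p) (basis_vec p)) = b"
        using BE by (intro path_space_expand finite_V ess_space_path_space) auto
      have "(\<Sum>p\<in>paths V adj n. coef b p * coef ?g p) = ?h (tensor \<xi> b)"
        using arg_cong[OF b, of "\<lambda>b. ?h (tensor \<xi> b)"]
        by (simp add: tensor_sum_right ext_rep_sum g)
      then show "(\<Sum>p\<in>paths V adj n. coef b p * coef ?g p) * coef b \<zeta> = coef b \<zeta> * ?h (tensor \<xi> b)"
        by simp
    qed
    finally show ?thesis by (simp add: ext_rep_sum)
  qed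
  then have "ess_part X d \<Psi> E (tensor \<xi> (basis_vec \<zeta>)) =
      ess_part X d \<Psi> E (\<Sum>b\<in>B. cscale (coef b \<zeta>) (tensor \<xi> b))"
    unfolding ess_part_def by (intro sum.cong refl) simp
  also have "\<dots> = (\<Sum>b\<in>B. cscale (coef b \<zeta>) (tensor \<xi> b))"
    using BE \<xi>
    by (intro ess_part_id free.subspace_sum[OF subspace] free.subspace_scale[OF subspace])
      (auto intro: tensor_in_End_E)
  finally show ?thesis .
qed

text \<open>The weights are the coefficients of an essential b, so linearity brings the sum back
  into A, where the projection is the identity.\<close>

lemma ess_part_basis_vec_essential:
  assumes "b \<in> ess_space V adj \<mu> n" "\<xi> \<in> ess_space V adj \<mu> n"
  shows "(\<Sum>\<zeta>\<in>paths V adj n. cscale (coef b \<zeta>) (ess_part X d \<Psi> E (tensor (basis_vec \<zeta>) \<xi>))) = tensor b \<xi>"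
proof -
  have "(\<Sum>\<zeta>\<in>paths V adj n. cscale (coef b \<zeta>) (ess_part X d \<Psi> E (tensor (basis_vec \<zeta>) \<xi>))) =
      ess_part X d \<Psi> E (tensor (\<Sum>\<zeta>\<in>paths V adj n. cscale (coef b \<zeta>) (basis_vec \<zeta>)) \<xi>)"
    by (simp add: tensor_sum_left ess_part_sum)
  also have "\<dots> = tensor b \<xi>"
    using assms finite_V by (simp add: path_space_expand ess_space_path_space ess_part_id tensor_in_End_E)
  finally show ?thesis .
qed

end

section \<open>The counit property\<close>

context graph_dta_irreps
begin

text \<open>On \<open>tensor b b'\<close> the functional is the Kronecker delta, hence \<epsilon>(f
  \<otimes> b) and \<epsilon>(b \<otimes> f) are the coefficient \<open>r f b\<close>. Each identity
  then expands one of \<xi>, \<xi>' in the basis.\<close>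

lemma counit_tensor:
  assumes B: "ess_basis V adj \<mu> n B"
    and lin: "linear_on (End_E V adj \<mu>) (*) \<epsilon>"
    and eps: "\<And>b b'. b \<in> B \<Longrightarrow> b' \<in> B \<Longrightarrow> \<epsilon> (tensor b b') = (if b = b' then 1 else 0)"
    and \<xi>: "\<xi> \<in> ess_space V adj \<mu> n" "\<xi>' \<in> ess_space V adj \<mu> n"
  shows "(\<Sum>\<zeta>\<in>paths V adj n. cscale (\<epsilon> (ess_part X d \<Psi> E (tensor \<xi> (basis_vec \<zeta>))))
      (ess_part X d \<Psi> E (tensor (basis_vec \<zeta>) \<xi>'))) = tensor \<xi> \<xi>'"
    and "(\<Sum>\<zeta>\<in>paths V adj n. cscale (\<epsilon> (ess_part X d \<Psi> E (tensor (basis_vec \<zeta>) \<xi>')))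
      (ess_part X d \<Psi> E (tensor \<xi> (basis_vec \<zeta>)))) = tensor \<xi> \<xi>'"
proof -
  let ?P = "ess_part X d \<Psi> E" and ?N = "paths V adj n"
  note fin = ess_basis_expand(1)[OF finite_V B]
  have BE: "b \<in> ess_space V adj \<mu> n" if "b \<in> B" for b
    using ess_basis_expand(2)[OF finite_V B] that by blast
  note eps_sum = linear_on_complex_sum[OF lin subspace]
  define r where "r f b = (\<Sum>p\<in>?N. coef b p * coef f p)" for f b :: "'v list \<Rightarrow>\<^sub>0 complex"
  have expand: "(\<Sum>b\<in>B. cscale (r f b) b) = f" if "f \<in> ess_space V adj \<mu> n" for f
    unfolding r_def by (rule ess_basis_expand(3)[OF finite_V B that])
  have eps1: "\<epsilon> (tensor f b) = r f b" if f: "f \<in> ess_space V adj \<mu> n" and b: "b \<in> B" for f b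
  proof -
    have "\<epsilon> (tensor f b) = \<epsilon> (\<Sum>b'\<in>B. cscale (r f b') (tensor b' b))"
      by (subst expand[OF f, symmetric]) (simp add: tensor_sum_left)
    also have "\<dots> = (\<Sum>b'\<in>B. r f b' * \<epsilon> (tensor b' b))"
      using b f by (intro eps_sum) (auto intro!: tensor_in_End_E[where n = n] BE)
    finally show ?thesis using b fin by (simp add: eps mult_delta_right)
  qed
  have eps2: "\<epsilon> (tensor b f) = r f b" if f: "f \<in> ess_space V adj \<mu> n" and b: "b \<in> B" for f b
  proof -
    have "\<epsilon> (tensor b f) = \<epsilon> (\<Sum>b'\<in>B. cscale (r f b') (tensor b b'))"
      by (subst expand[OF f, symmetric]) (simp add: tensor_sum_right)
    also have "\<dots> = (\<Sum>b'\<in>B. r f b' * \<epsilon> (tensor b b'))"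
      using b f by (intro eps_sum) (auto intro!: tensor_in_End_E[where n = n] BE)
    finally show ?thesis using b fin by (simp add: eps mult_delta_right)
  qed
  have "(\<Sum>\<zeta>\<in>?N. cscale (\<epsilon> (?P (tensor \<xi> (basis_vec \<zeta>)))) (?P (tensor (basis_vec \<zeta>) \<xi>'))) =
      (\<Sum>\<zeta>\<in>?N. \<Sum>b\<in>B. cscale (r \<xi> b) (cscale (coef b \<zeta>) (?P (tensor (basis_vec \<zeta>) \<xi>'))))"
  proof (rule sum.cong[OF refl])
    fix \<zeta> assume "\<zeta> \<in> ?N"
    then have "\<epsilon> (?P (tensor \<xi> (basis_vec \<zeta>))) = (\<Sum>b\<in>B. coef b \<zeta> * \<epsilon> (tensor \<xi> b))"
      unfolding ess_part_essential_basis_vec[OF B \<xi>(1) \<open>\<zeta> \<in> ?N\<close>]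
      by (intro eps_sum) (auto intro!: tensor_in_End_E[where n = n] BE \<xi>)
    then show "cscale (\<epsilon> (?P (tensor \<xi> (basis_vec \<zeta>)))) (?P (tensor (basis_vec \<zeta>) \<xi>')) =
      (\<Sum>b\<in>B. cscale (r \<xi> b) (cscale (coef b \<zeta>) (?P (tensor (basis_vec \<zeta>) \<xi>'))))"
      by (simp add: eps1[OF \<xi>(1)] free.scale_sum_left mult.commute)
  qed
  also have "\<dots> = (\<Sum>b\<in>B. cscale (r \<xi> b) (\<Sum>\<zeta>\<in>?N. cscale (coef b \<zeta>) (?P (tensor (basis_vec \<zeta>) \<xi>'))))"
    by (subst sum.swap) (simp only: free.scale_sum_right)
  also have "\<dots> = (\<Sum>b\<in>B. cscale (r \<xi> b) (tensor b \<xi>'))"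
    by (intro sum.cong refl) (simp only: ess_part_basis_vec_essential[OF BE \<xi>(2)])
  also have "\<dots> = tensor \<xi> \<xi>'"
    using expand[OF \<xi>(1)] by (simp flip: tensor_sum_left)
  finally show "(\<Sum>\<zeta>\<in>?N. cscale (\<epsilon> (?P (tensor \<xi> (basis_vec \<zeta>)))) (?P (tensor (basis_vec \<zeta>) \<xi>'))) =
      tensor \<xi> \<xi>'" .
  \<comment> \<open>Here \<epsilon> sits on the factor with the elementary path on the left.
    Expanding the other factor first supplies the weights \<open>coef b \<zeta>\<close> that turn
    the sum into \<epsilon>(b \<otimes> \<xi>').\<close>
  have "(\<Sum>\<zeta>\<in>?N. cscale (\<epsilon> (?P (tensor (basis_vec \<zeta>) \<xi>'))) (?P (tensor \<xi> (basis_vec \<zeta>)))) =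
      (\<Sum>\<zeta>\<in>?N. \<Sum>b\<in>B. cscale (coef b \<zeta> * \<epsilon> (?P (tensor (basis_vec \<zeta>) \<xi>'))) (tensor \<xi> b))"
    by (intro sum.cong refl)
      (simp add: ess_part_essential_basis_vec[OF B \<xi>(1)] free.scale_sum_right mult.commute)
  also have "\<dots> = (\<Sum>b\<in>B. cscale (\<Sum>\<zeta>\<in>?N. coef b \<zeta> * \<epsilon> (?P (tensor (basis_vec \<zeta>) \<xi>'))) (tensor \<xi> b))"
    by (subst sum.swap) (simp add: free.scale_sum_left)
  also have "\<dots> = (\<Sum>b\<in>B. cscale (r \<xi>' b) (tensor \<xi> b))"
  proof (rule sum.cong[OF refl])
    fix b assume b: "b \<in> B"
    have "(\<Sum>\<zeta>\<in>?N. coef b \<zeta> * \<epsilon> (?P (tensor (basis_vec \<zeta>) \<xi>'))) =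
        \<epsilon> (\<Sum>\<zeta>\<in>?N. cscale (coef b \<zeta>) (?P (tensor (basis_vec \<zeta>) \<xi>')))"
      by (rule eps_sum[symmetric]) (rule ess_part_closed)
    also have "\<dots> = r \<xi>' b"
      by (simp add: ess_part_basis_vec_essential[OF BE[OF b] \<xi>(2)] eps2[OF \<xi>(2) b])
    finally show "cscale (\<Sum>\<zeta>\<in>?N. coef b \<zeta> * \<epsilon> (?P (tensor (basis_vec \<zeta>) \<xi>'))) (tensor \<xi> b) =
        cscale (r \<xi>' b) (tensor \<xi> b)" by simp
  qed
  also have "\<dots> = tensor \<xi> \<xi>'"
    using expand[OF \<xi>(2)] by (simp flip: tensor_sum_right)
  finally show "(\<Sum>\<zeta>\<in>?N. cscale (\<epsilon> (?P (tensor (basis_vec \<zeta>) \<xi>'))) (?P (tensor \<xi> (basis_vec \<zeta>)))) =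
      tensor \<xi> \<xi>'" .
qed

text \<open>\<open>s\<close> stands for a slice of a tensor, so that this covers both sides of the counit property.\<close>

lemma linear_slice_coproduct:
  fixes s :: "(('v list \<times> 'v list) \<times> ('v list \<times> 'v list) \<Rightarrow>\<^sub>0 complex) \<Rightarrow> 'v endo"
  assumes cop: "coproduct V adj \<mu> X d \<Psi> E \<Delta>"
    and lin: "linear_on (End_E V adj \<mu>) (*) \<epsilon>"
    and s: "\<And>t u. s (t + u) = s t + s u" "\<And>c t. s (cscale c t) = cscale c (s t)"
    and gen: "\<And>n \<xi> \<xi>'. \<xi> \<in> ess_space V adj \<mu> n \<Longrightarrow> \<xi>' \<in> ess_space V adj \<mu> n \<Longrightarrow>
      \<exists>c y. s (\<Delta> (tensor \<xi> \<xi>')) = (\<Sum>\<zeta>\<in>paths V adj n. cscale (c \<zeta>) (y \<zeta>)) \<and>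
        (\<forall>\<zeta>\<in>paths V adj n. y \<zeta> \<in> End_E V adj \<mu>) \<and>
        (\<Sum>\<zeta>\<in>paths V adj n. c \<zeta> * \<epsilon> (y \<zeta>)) = coef (tensor \<xi> \<xi>') k"
    and a: "a \<in> End_E V adj \<mu>"
  shows "\<epsilon> (s (\<Delta> a)) = coef a k"
proof -
  let ?A = "End_E V adj \<mu>"
  have \<Delta>: "linear_on ?A cscale \<Delta>" using cop by (simp add: coproduct_def)
  have s0: "s 0 = 0" using s(2)[of 0 0] by simp
  \<comment> \<open>Membership of the slices in A is carried through the induction because
    \<epsilon> is linear on A only.\<close>
  have "a \<in> ?A \<and> s (\<Delta> a) \<in> ?A \<and> \<epsilon> (s (\<Delta> a)) = coef a k"
    using a unfolding End_E_def
  proof (induction rule: free.span_induct_alt)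
    case base
    show ?case
      unfolding End_E_def[symmetric]
      using linear_on_0[OF \<Delta> subspace] linear_on_0[OF lin subspace] free.subspace_0[OF subspace]
      by (simp add: s0)
  next
    case (step c x y)
    then obtain n \<xi> \<xi>' where x: "x = tensor \<xi> \<xi>'" "\<xi> \<in> ess_space V adj \<mu> n" "\<xi>' \<in> ess_space V adj \<mu> n"
      by auto
    have xA: "x \<in> ?A" using x by (simp add: tensor_in_End_E)
    then have cxA: "cscale c x \<in> ?A" by (rule free.subspace_scale[OF subspace])
    obtain c' z where z: "s (\<Delta> x) = (\<Sum>\<zeta>\<in>paths V adj n. cscale (c' \<zeta>) (z \<zeta>))"
      and zA: "\<And>\<zeta>. \<zeta> \<in> paths V adj n \<Longrightarrow> z \<zeta> \<in> ?A"
      and zc: "(\<Sum>\<zeta>\<in>paths V adj n. c' \<zeta> * \<epsilon> (z \<zeta>)) = coef x k"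
      using gen[OF x(2,3)] unfolding x(1) by auto
    have sx: "s (\<Delta> x) \<in> ?A"
      unfolding z by (intro free.subspace_sum[OF subspace] free.subspace_scale[OF subspace] zA)
    have "\<epsilon> (s (\<Delta> x)) = coef x k"
      unfolding z zc[symmetric] by (rule linear_on_complex_sum[OF lin subspace zA])
    then show ?case
      using step(2) xA cxA sx free.subspace_scale[OF subspace, of "s (\<Delta> x)" c]
        free.subspace_add[OF subspace]
      unfolding End_E_def[symmetric]
      by (simp add: linear_on_add[OF \<Delta>] linear_on_scale[OF \<Delta>] s lookup_add
          linear_on_add[OF lin] linear_on_scale[OF lin])
  qed
  then show ?thesis by blast
qed

text \<open>Coefficients are compared one at a time: fixing an index in one factor makes its
  coefficient a scalar and leaves a combination of elements of A, to which \<epsilon> applies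
  linearly.\<close>

lemma counit:
  assumes B: "\<And>n. ess_basis V adj \<mu> n (B n)"
    and cop: "coproduct V adj \<mu> X d \<Psi> E \<Delta>"
    and lin: "linear_on (End_E V adj \<mu>) (*) \<epsilon>"
    and eps: "\<And>n b b'. b \<in> B n \<Longrightarrow> b' \<in> B n \<Longrightarrow> \<epsilon> (tensor b b') = (if b = b' then 1 else 0)"
    and a: "a \<in> End_E V adj \<mu>"
  shows "tensor_map_left \<epsilon> (\<Delta> a) = a" "tensor_map_right \<epsilon> (\<Delta> a) = a"
proof -
  let ?P = "ess_part X d \<Psi> E"
  have \<epsilon>0: "\<epsilon> 0 = 0" using linear_on_0[OF lin subspace] by simp
  have \<Delta>: "\<Delta> (tensor \<xi> \<xi>') = (\<Sum>\<zeta>\<in>paths V adj n. tensor (?P (tensor \<xi> (basis_vec \<zeta>))) (?P (tensor (basis_vec \<zeta>) \<xi>')))"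
    if "\<xi> \<in> ess_space V adj \<mu> n" "\<xi>' \<in> ess_space V adj \<mu> n" for n \<xi> \<xi>'
    using cop that by (simp add: coproduct_def)
  show "tensor_map_left \<epsilon> (\<Delta> a) = a"
  proof (rule poly_mapping_eqI)
    fix k
    have "\<epsilon> (Poly_Mapping.map_key (\<lambda>i. (i, k)) (\<Delta> a)) = coef a k"
    proof (rule linear_slice_coproduct[OF cop lin _ _ _ a])
      show "\<exists>c y. Poly_Mapping.map_key (\<lambda>i. (i, k)) (\<Delta> (tensor \<xi> \<xi>')) = (\<Sum>\<zeta>\<in>paths V adj n. cscale (c \<zeta>) (y \<zeta>)) \<and>
        (\<forall>\<zeta>\<in>paths V adj n. y \<zeta> \<in> End_E V adj \<mu>) \<and>
        (\<Sum>\<zeta>\<in>paths V adj n. c \<zeta> * \<epsilon> (y \<zeta>)) = coef (tensor \<xi> \<xi>') k"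
        if \<xi>: "\<xi> \<in> ess_space V adj \<mu> n" "\<xi>' \<in> ess_space V adj \<mu> n" for n \<xi> \<xi>'
      proof (intro exI conjI ballI)
        show "Poly_Mapping.map_key (\<lambda>i. (i, k)) (\<Delta> (tensor \<xi> \<xi>')) =
          (\<Sum>\<zeta>\<in>paths V adj n. cscale (coef (?P (tensor (basis_vec \<zeta>) \<xi>')) k) (?P (tensor \<xi> (basis_vec \<zeta>))))"
          by (rule poly_mapping_eqI) (simp add: \<Delta>[OF \<xi>] map_key.rep_eq inj_on_def lookup_sum mult.commute)
        show "(\<Sum>\<zeta>\<in>paths V adj n. coef (?P (tensor (basis_vec \<zeta>) \<xi>')) k * \<epsilon> (?P (tensor \<xi> (basis_vec \<zeta>)))) =
          coef (tensor \<xi> \<xi>') k"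
          by (subst counit_tensor(1)[OF B lin _ \<xi>, symmetric]) (auto simp: eps lookup_sum mult.commute)
      qed (rule ess_part_closed)
    qed (auto intro!: poly_mapping_eqI simp: map_key.rep_eq inj_on_def lookup_add)
    then show "coef (tensor_map_left \<epsilon> (\<Delta> a)) k = coef a k" by (simp add: coef_tensor_map_left \<epsilon>0)
  qed
  show "tensor_map_right \<epsilon> (\<Delta> a) = a"
  proof (rule poly_mapping_eqI)
    fix k
    have "\<epsilon> (Poly_Mapping.map_key (\<lambda>j. (k, j)) (\<Delta> a)) = coef a k"
    proof (rule linear_slice_coproduct[OF cop lin _ _ _ a])
      show "\<exists>c y. Poly_Mapping.map_key (\<lambda>j. (k, j)) (\<Delta> (tensor \<xi> \<xi>')) = (\<Sum>\<zeta>\<in>paths V adj n. cscale (c \<zeta>) (y \<zeta>)) \<and>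
        (\<forall>\<zeta>\<in>paths V adj n. y \<zeta> \<in> End_E V adj \<mu>) \<and>
        (\<Sum>\<zeta>\<in>paths V adj n. c \<zeta> * \<epsilon> (y \<zeta>)) = coef (tensor \<xi> \<xi>') k"
        if \<xi>: "\<xi> \<in> ess_space V adj \<mu> n" "\<xi>' \<in> ess_space V adj \<mu> n" for n \<xi> \<xi>'
      proof (intro exI conjI ballI)
        show "Poly_Mapping.map_key (\<lambda>j. (k, j)) (\<Delta> (tensor \<xi> \<xi>')) =
          (\<Sum>\<zeta>\<in>paths V adj n. cscale (coef (?P (tensor \<xi> (basis_vec \<zeta>))) k) (?P (tensor (basis_vec \<zeta>) \<xi>')))"
          by (rule poly_mapping_eqI) (simp add: \<Delta>[OF \<xi>] map_key.rep_eq inj_on_def lookup_sum)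
        show "(\<Sum>\<zeta>\<in>paths V adj n. coef (?P (tensor \<xi> (basis_vec \<zeta>))) k * \<epsilon> (?P (tensor (basis_vec \<zeta>) \<xi>'))) =
          coef (tensor \<xi> \<xi>') k"
          by (subst counit_tensor(2)[OF B lin _ \<xi>, symmetric]) (auto simp: eps lookup_sum mult.commute)
      qed (rule ess_part_closed)
    qed (auto intro!: poly_mapping_eqI simp: map_key.rep_eq inj_on_def lookup_add)
    then show "coef (tensor_map_right \<epsilon> (\<Delta> a)) k = coef a k" by (simp add: coef_tensor_map_right \<epsilon>0)
  qed
qed

end

section \<open>Finiteness and symmetry of ADE graphs, and the counit theorem\<close>

lemma graph_iso_finite_sym:
  assumes "graph_iso V adj W adj'" "finite W" "W \<noteq> {}"
    and "\<And>i j. adj' i j \<Longrightarrow> adj' j i"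
  shows "finite V \<and> V \<noteq> {} \<and> (\<forall>u\<in>V. \<forall>v\<in>V. adj u v \<longrightarrow> adj v u)"
  using assms unfolding graph_iso_def
  by (auto simp: bij_betw_def dest: finite_imageD)

lemma ADE_graph_finite_sym:
  assumes "ADE_graph V adj"
  shows "finite V \<and> V \<noteq> {} \<and> (\<forall>u\<in>V. \<forall>v\<in>V. adj u v \<longrightarrow> adj v u)"
proof -
  have A_sym: "A_adj j i" if "A_adj i j" for i j using that by (auto simp: A_adj_def)
  then have branched_sym: "branched_adj n b j i" if "branched_adj n b i j" for n b i j
    using that by (auto simp: branched_adj_def)
  have "\<exists>n adj'. (n::nat) \<ge> 1 \<and> graph_iso V adj {..<n} adj' \<and> (\<forall>i j. adj' i j \<longrightarrow> adj' j i)"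
    using assms unfolding ADE_graph_def
  proof (elim disjE exE conjE bexE)
    fix n :: nat assume "n \<ge> 1" "graph_iso V adj {..<n} A_adj"
    then show ?thesis using A_sym by metis
  next
    fix n :: nat assume "n \<ge> 4" "graph_iso V adj {..<n} (branched_adj n (n - 3))"
    moreover from this have "n \<ge> 1" by simp
    ultimately show ?thesis using branched_sym by metis
  next
    fix n :: nat assume "n \<in> {6, 7, 8}" "graph_iso V adj {..<n} (branched_adj n 2)"
    moreover from this have "n \<ge> 1" by auto
    ultimately show ?thesis using branched_sym by metis
  qed
  then obtain n :: nat and adj' where "n \<ge> 1" "graph_iso V adj {..<n} adj'" "\<And>i j. adj' i j \<Longrightarrow> adj' j i"
    by blast
  then show ?thesis
    by (intro graph_iso_finite_sym[of V adj "{..<n}" adj']) (auto simp: lessThan_empty_iff)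
qed

theorem proposition4p4:
  fixes V :: "'v set" and adj :: "'v \<Rightarrow> 'v \<Rightarrow> bool" and \<mu> :: "'v \<Rightarrow> real"
    and mul :: "'v endo \<Rightarrow> 'v endo \<Rightarrow> 'v endo" and one :: "'v endo" and star :: "'v endo \<Rightarrow> 'v endo"
    and F :: "'f set" and \<Phi> :: "'f \<Rightarrow> 'v list \<Rightarrow> 'v list \<Rightarrow> 'v endo \<Rightarrow> complex"
    and X :: "'x set" and d :: "'x \<Rightarrow> nat" and \<Psi> :: "'x \<Rightarrow> nat \<Rightarrow> nat \<Rightarrow> 'v endo \<Rightarrow> complex"
    and E :: "'x \<Rightarrow> nat \<Rightarrow> nat \<Rightarrow> 'v endo"
    and B :: "nat \<Rightarrow> ('v list \<Rightarrow>\<^sub>0 complex) set"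
    and \<Delta> :: "'v endo \<Rightarrow> (('v list \<times> 'v list) \<times> ('v list \<times> 'v list) \<Rightarrow>\<^sub>0 complex)"
    and \<epsilon> :: "'v endo \<Rightarrow> complex"
  assumes "ADE_graph V adj"
    and "perron_frobenius V adj \<mu>"
    and "double_triangle_algebra V adj \<mu> mul one star F \<Phi>"
    and "irrep_system (End_E V adj \<mu>) mul one star X d \<Psi>"
    and "matrix_units (End_E V adj \<mu>) X d \<Psi> E"
    and "\<And>n. ess_basis V adj \<mu> n (B n)"
    and "coproduct V adj \<mu> X d \<Psi> E \<Delta>"
    and "linear_on (End_E V adj \<mu>) (*) \<epsilon>"
    and "\<And>n \<xi> \<xi>'. \<xi> \<in> B n \<Longrightarrow> \<xi>' \<in> B n \<Longrightarrow> \<epsilon> (tensor \<xi> \<xi>') = (if \<xi> = \<xi>' then 1 else 0)"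
  shows "\<forall>a\<in>End_E V adj \<mu>.
           tensor_map_left \<epsilon> (\<Delta> a) = a \<and> tensor_map_right \<epsilon> (\<Delta> a) = a"
proof -
  have V: "finite V" "V \<noteq> {}" "\<And>u v. u \<in> V \<Longrightarrow> v \<in> V \<Longrightarrow> adj u v \<Longrightarrow> adj v u"
    using ADE_graph_finite_sym[OF assms(1)] by auto
  \<comment> \<open>The normalization makes 1 a lower bound for all components.\<close>
  have \<mu>: "\<mu> v > 0" if "v \<in> V" for v
  proof -
    have "Min (\<mu> ` V) \<le> \<mu> v" using V that by simp
    then show ?thesis using assms(2) by (simp add: perron_frobenius_def)
  qed
  interpret graph_dta_irreps V adj \<mu> mul one star F \<Phi> X d \<Psi> E
    using assms(3-5) V \<mu>
    by (auto intro!: graph_dta_irreps.intro graph_dta.intro graph_dta_axioms.intro graph_dta_irreps_axioms.intro)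
  show ?thesis
    by (intro ballI conjI counit[OF assms(6-8)]) (auto simp: assms(9))
qed

end
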